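(* Let $\varepsilon\ge 0$ and let $g(t)$, $t\in[0,\kappa)$, be a solution to the $\varepsilon$-Ricci flow $\frac{\partial}{\partial t}g_{ij}=-\varepsilon R\, g_{ij}$ on a closed surface $M^2$. Let $c_0$ be a constant with $0<c_0<1$, and suppose that the initial scalar curvature satisfies $$R(g(0))\ \geq\ -\frac{2\ln c_0}{1-c_0^2}-1\ >\ 0 .$$ Let $S$ and $T$ be solutions on $M^2\times[0,\kappa)$ to $$\frac{\partial S}{\partial t}=\Delta S-S\ln S+\varepsilon RS\qquad\text{and}\qquad \frac{\partial T}{\partial t}=\Delta T-T\ln T+\varepsilon RT$$ with $0<c_0S<T<S$ at the initial time $t=0$ (a condition which is preserved by the $\varepsilon$-Ricci flow). Then for all $t\in(0,\kappa)$, at every point of $M^2$, $$\frac{\partial }{\partial t}\ln S-|\nabla \ln S|^2+\ln S+\frac 1t=\Delta\ln S+\varepsilon R+\frac 1t>\frac{|\nabla h|^2}{1-h^2},$$ where $h:=T/S$.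
   Context: $M^2$ is a closed 2-dimensional manifold. For a constant $\varepsilon\ge 0$, a smooth one-parameter family of Riemannian metrics $g(t)$ on $M^2$ is a solution to the $\varepsilon$-Ricci flow if $\frac{\partial}{\partial t}g_{ij}=-\varepsilon R\, g_{ij}$, where $R=R(g(t))$ is the scalar curvature of $g(t)$. The Laplacian $\Delta$, the gradient $\nabla$ and the norm $|\cdot|$ are taken with respect to the evolving metric $g(t)$. $S$ and $T$ are smooth positive functions; $T$ denotes a function, not a time. *)

theory Defs
  imports "HOL-Analysis.Analysis"
begin

text \<open>
  Partial derivatives are taken within the set. The sets used below are open, or of the form
  \<open>J \<times> V\<close> with \<open>V\<close> open and \<open>J\<close> a half-open interval \<open>[0, \<kappa>)\<close>; on these the derivative
  within the set is unique, and at \<open>t = 0\<close> it is one-sided in time.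
\<close>

primrec Ck_on ::
  "nat \<Rightarrow> 'a::euclidean_space set \<Rightarrow> ('a \<Rightarrow> 'b::real_normed_vector) \<Rightarrow> bool" where
  "Ck_on 0 D f \<longleftrightarrow> continuous_on D f"
| "Ck_on (Suc n) D f \<longleftrightarrow> f differentiable_on D \<and>
     (\<forall>b\<in>Basis. Ck_on n D (\<lambda>x. frechet_derivative f (at x within D) b))"

definition smooth_on ::
  "'a::euclidean_space set \<Rightarrow> ('a \<Rightarrow> 'b::real_normed_vector) \<Rightarrow> bool" where
  "smooth_on D f \<longleftrightarrow> (\<forall>k. Ck_on k D f)"

text \<open>A chart is a pair of its domain and its coordinate map.\<close>

type_synonym 'a chart = "'a set \<times> ('a \<Rightarrow> real^2)"

abbreviation chart_dom :: "'a chart \<Rightarrow> 'a set" where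
  "chart_dom c \<equiv> fst c"

abbreviation chart_map :: "'a chart \<Rightarrow> 'a \<Rightarrow> real^2" where
  "chart_map c \<equiv> snd c"

definition chart_inv :: "'a chart \<Rightarrow> real^2 \<Rightarrow> 'a" where
  "chart_inv c = inv_into (chart_dom c) (chart_map c)"

definition transition :: "'a chart \<Rightarrow> 'a chart \<Rightarrow> real^2 \<Rightarrow> real^2" where
  "transition c c' = chart_map c' \<circ> chart_inv c"

definition smooth_atlas :: "'a::topological_space chart set \<Rightarrow> bool" where
  "smooth_atlas A \<longleftrightarrow>
     (\<Union>c\<in>A. chart_dom c) = UNIV \<and>
     (\<forall>c\<in>A. open (chart_dom c) \<and> open (chart_map c ` chart_dom c) \<and>
        homeomorphism (chart_dom c) (chart_map c ` chart_dom c) (chart_map c) (chart_inv c)) \<and>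
     (\<forall>c\<in>A. \<forall>c'\<in>A.
        smooth_on (chart_map c ` (chart_dom c \<inter> chart_dom c')) (transition c c'))"

text \<open>The underlying space of the surface is the whole type.\<close>

definition closed_surface ::
  "'a::{t2_space,second_countable_topology} chart set \<Rightarrow> bool" where
  "closed_surface A \<longleftrightarrow> smooth_atlas A \<and> compact (UNIV :: 'a set)"

text \<open>
  A metric is given by its components: \<open>g c p $ i $ j\<close> is \<open>g\<^sub>i\<^sub>j\<close> at the point \<open>p\<close>
  with respect to the chart \<open>c\<close>; only \<open>p \<in> chart_dom c\<close> matters.
\<close>

type_synonym 'a metric_comps = "'a chart \<Rightarrow> 'a \<Rightarrow> real^2^2"

definition in_chart :: "'a chart \<Rightarrow> ('a \<Rightarrow> 'b) \<Rightarrow> real^2 \<Rightarrow> 'b" where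
  "in_chart c f = f \<circ> chart_inv c"

definition riemannian_metric ::
  "'a::topological_space chart set \<Rightarrow> 'a metric_comps \<Rightarrow> bool" where
  "riemannian_metric A g \<longleftrightarrow>
     (\<forall>c\<in>A. smooth_on (chart_map c ` chart_dom c) (in_chart c (g c))) \<and>
     (\<forall>c\<in>A. \<forall>p\<in>chart_dom c.
        transpose (g c p) = g c p \<and> (\<forall>v. v \<noteq> 0 \<longrightarrow> v \<bullet> (g c p *v v) > 0)) \<and>
     (\<forall>c\<in>A. \<forall>c'\<in>A. \<forall>p\<in>chart_dom c \<inter> chart_dom c'.
        let D = jacobian (transition c c') (at (chart_map c p))
        in g c p = transpose D ** g c' p ** D)"

text \<open>
  Coordinate expressions: \<open>G\<close> is the matrix field of metric components and \<open>f\<close> a function,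
  both on an open subset of the plane.
\<close>

definition partial :: "2 \<Rightarrow> (real^2 \<Rightarrow> real) \<Rightarrow> real^2 \<Rightarrow> real" where
  "partial i f x = frechet_derivative f (at x) (axis i 1)"

text \<open>\<open>christoffel G k i j\<close> is \<open>\<Gamma>\<^sup>k\<^sub>i\<^sub>j\<close>.\<close>

definition christoffel :: "(real^2 \<Rightarrow> real^2^2) \<Rightarrow> 2 \<Rightarrow> 2 \<Rightarrow> 2 \<Rightarrow> real^2 \<Rightarrow> real" where
  "christoffel G k i j x = (1/2) * (\<Sum>l\<in>UNIV. matrix_inv (G x) $ k $ l *
     (partial i (\<lambda>y. G y $ j $ l) x + partial j (\<lambda>y. G y $ i $ l) x
       - partial l (\<lambda>y. G y $ i $ j) x))"

text \<open>The sign is such that round spheres have positive curvature.\<close>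

definition ricci_comp :: "(real^2 \<Rightarrow> real^2^2) \<Rightarrow> 2 \<Rightarrow> 2 \<Rightarrow> real^2 \<Rightarrow> real" where
  "ricci_comp G j k x =
     (\<Sum>l\<in>UNIV. partial l (christoffel G l j k) x - partial j (christoffel G l l k) x
       + (\<Sum>m\<in>UNIV. christoffel G l l m x * christoffel G m j k x
                   - christoffel G l j m x * christoffel G m l k x))"

definition scalar_curv_comp :: "(real^2 \<Rightarrow> real^2^2) \<Rightarrow> real^2 \<Rightarrow> real" where
  "scalar_curv_comp G x =
     (\<Sum>j\<in>UNIV. \<Sum>k\<in>UNIV. matrix_inv (G x) $ j $ k * ricci_comp G j k x)"

definition laplacian_comp ::
  "(real^2 \<Rightarrow> real^2^2) \<Rightarrow> (real^2 \<Rightarrow> real) \<Rightarrow> real^2 \<Rightarrow> real" where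
  "laplacian_comp G f x =
     (\<Sum>i\<in>UNIV. \<Sum>j\<in>UNIV. matrix_inv (G x) $ i $ j *
       (partial i (partial j f) x - (\<Sum>k\<in>UNIV. christoffel G k i j x * partial k f x)))"

definition gradient_comp ::
  "(real^2 \<Rightarrow> real^2^2) \<Rightarrow> (real^2 \<Rightarrow> real) \<Rightarrow> real^2 \<Rightarrow> real^2" where
  "gradient_comp G f x = matrix_inv (G x) *v (\<chi> j. partial j f x)"

text \<open>
  The scalar curvature, the Laplacian and the gradient on the surface, computed in a chart \<open>c\<close>
  around \<open>p\<close>. The scalars do not depend on the choice of \<open>c\<close>; statements about them are made
  for all charts of the atlas.
\<close>

definition scalar_curvature :: "'a metric_comps \<Rightarrow> 'a chart \<Rightarrow> 'a \<Rightarrow> real" where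
  "scalar_curvature g c p = scalar_curv_comp (in_chart c (g c)) (chart_map c p)"

definition laplacian :: "'a metric_comps \<Rightarrow> 'a chart \<Rightarrow> ('a \<Rightarrow> real) \<Rightarrow> 'a \<Rightarrow> real" where
  "laplacian g c f p = laplacian_comp (in_chart c (g c)) (in_chart c f) (chart_map c p)"

definition gradient :: "'a metric_comps \<Rightarrow> 'a chart \<Rightarrow> ('a \<Rightarrow> real) \<Rightarrow> 'a \<Rightarrow> real^2" where
  "gradient g c f p = gradient_comp (in_chart c (g c)) (in_chart c f) (chart_map c p)"

definition metric_norm :: "'a metric_comps \<Rightarrow> 'a chart \<Rightarrow> 'a \<Rightarrow> real^2 \<Rightarrow> real" where
  "metric_norm g c p v = sqrt (v \<bullet> (g c p *v v))"

text \<open>The interval \<open>[0, \<kappa>)\<close>, where \<open>\<kappa> = \<infinity>\<close> is allowed.\<close>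

definition time_interval :: "ereal \<Rightarrow> real set" where
  "time_interval \<kappa> = {t. 0 \<le> t \<and> ereal t < \<kappa>}"

definition smooth_family ::
  "'a chart set \<Rightarrow> ereal \<Rightarrow> (real \<Rightarrow> 'a \<Rightarrow> real) \<Rightarrow> bool" where
  "smooth_family A \<kappa> u \<longleftrightarrow>
     (\<forall>c\<in>A. smooth_on (time_interval \<kappa> \<times> chart_map c ` chart_dom c)
        (\<lambda>(t, x). in_chart c (u t) x))"

definition eps_ricci_flow ::
  "'a::topological_space chart set \<Rightarrow> real \<Rightarrow> ereal \<Rightarrow> (real \<Rightarrow> 'a metric_comps) \<Rightarrow> bool" where
  "eps_ricci_flow A \<epsilon> \<kappa> g \<longleftrightarrow>
     (\<forall>t\<in>time_interval \<kappa>. riemannian_metric A (g t)) \<and>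
     (\<forall>c\<in>A. smooth_on (time_interval \<kappa> \<times> chart_map c ` chart_dom c)
        (\<lambda>(t, x). in_chart c (g t c) x)) \<and>
     (\<forall>t\<in>time_interval \<kappa>. \<forall>c\<in>A. \<forall>p\<in>chart_dom c. \<forall>i j.
        ((\<lambda>s. g s c p $ i $ j) has_real_derivative
           - \<epsilon> * scalar_curvature (g t) c p * g t c p $ i $ j) (at t within time_interval \<kappa>))"

text \<open>\<open>\<partial>u/\<partial>t = \<Delta>u - u ln u + \<epsilon>Ru\<close>.\<close>

definition nonlinear_heat_solution ::
  "'a chart set \<Rightarrow> real \<Rightarrow> ereal \<Rightarrow> (real \<Rightarrow> 'a metric_comps) \<Rightarrow> (real \<Rightarrow> 'a \<Rightarrow> real) \<Rightarrow> bool"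
  where
  "nonlinear_heat_solution A \<epsilon> \<kappa> g u \<longleftrightarrow>
     (\<forall>t\<in>time_interval \<kappa>. \<forall>c\<in>A. \<forall>p\<in>chart_dom c.
        ((\<lambda>s. u s p) has_real_derivative
           laplacian (g t) c (u t) p - u t p * ln (u t p)
             + \<epsilon> * scalar_curvature (g t) c p * u t p) (at t within time_interval \<kappa>))"

end

theory Submission
  imports Defs "HOL-Library.Function_Algebras"
begin

text \<open>
  The proof is a chain of maximum principles. Write \<open>u = ln S\<close>, \<open>H = \<Delta>u + \<epsilon>R\<close>,
  \<open>P = |\<nabla>h|\<^sup>2 / (1 - h\<^sup>2)\<close>. One shows in turn that \<open>c\<^sub>0 < h < 1\<close> and the lower bound of \<open>R\<close>
  persist, that \<open>\<epsilon>(\<Delta> ln R + R) \<ge> -1/t\<close> (Hamilton's trace Harnack inequality), and that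
  \<open>t(H - P) > -1\<close>. In the last step the term \<open>4 Hess u(\<nabla>h, \<nabla>h) / (1 - h\<^sup>2)\<close> in the evolution of \<open>P\<close>
  is absorbed by the square \<open>2 |Hess u + \<epsilon>Rg/2 - dh \<otimes> dh / (1 - h\<^sup>2)|\<^sup>2\<close>, and what remains has a sign
  because \<open>R + 1 + 2 ln h / (1 - h\<^sup>2)\<close> is bounded below by its value for \<open>h = c\<^sub>0\<close> and minimal \<open>R\<close>.

  All local computations are done with an orthonormal frame \<open>X, Y\<close>. Since the metric changes
  conformally, \<open>[\<partial>\<^sub>t, X] = \<rho>X\<close> and \<open>[\<partial>\<^sub>t, Y] = \<rho>Y\<close> with \<open>\<rho> = \<epsilon>R/2\<close>, and every evolution equation becomes
  an identity between iterated derivations. The quantities to which the maximum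
  principle is applied must not depend on the chart. This needs no invariance of curvature or
  Laplacian: \<open>\<epsilon>R\<close> is determined by the flow equation, and the heat equation gives
  \<open>H = \<partial>\<^sub>t u - |\<nabla>u|\<^sup>2 + u\<close>, so that only the invariance of \<open>|\<nabla>f|\<^sup>2\<close> is used.
\<close>

section \<open>Smooth functions within a set\<close>

text \<open>The two Harnack bounds share the constant -1 for a reason. At a first contact of t(H -
  P) with -1 the completed square contributes (H - P)^2 = 1/t^2, which offsets the derivative of the
  factor t. The trace Harnack inequality bounds the curvature terms below by -\<epsilon>R/t, and
  this cancels against the part \<epsilon>R/t of -\<epsilon>R \<Delta>u. The surplus 1/t +
  \<epsilon>R excludes the contact without perturbation; only the curvature bound, the trace Harnack
  inequality and h < 1 use barriers moved slightly off the desired value.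

  The initial condition sits on the boundary t = 0 of the domain. Hence uniqueness of derivatives,
  closure of smooth functions under the usual operations and symmetry of second derivatives are
  developed within half-open sets such as [0, \<kappa>) \<times> V.

  For \<epsilon> = 0 the flow equation carries no information about R. Then the metric is static, R
  is constant in time and the trace Harnack inequality is trivial.\<close>

definition accessible :: "'a::euclidean_space set \<Rightarrow> bool" where
  "accessible D \<longleftrightarrow> (\<forall>z\<in>D. \<forall>b\<in>Basis. \<forall>e>0. \<exists>d. 0 < \<bar>d\<bar> \<and> \<bar>d\<bar> < e \<and> z + d *\<^sub>R b \<in> D)"

text \<open>\<open>accessible\<close> is what uniqueness of derivatives within a set requires: along
  every axis one can make arbitrarily small moves of at least one sign. One sign is enough, so the
  initial time t = 0 is covered.\<close>

lemma frechet_derivative_within_eq: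
  fixes f :: "'a::euclidean_space \<Rightarrow> 'b::real_normed_vector"
  assumes "accessible D" "z \<in> D" "(f has_derivative f') (at z within D)"
  shows "frechet_derivative f (at z within D) = f'"
proof (rule frechet_derivative_unique_within)
  show "(f has_derivative frechet_derivative f (at z within D)) (at z within D)"
    using assms(3) frechet_derivative_works differentiableI by blast
  show "(f has_derivative f') (at z within D)" by fact
  show "\<exists>d. 0 < \<bar>d\<bar> \<and> \<bar>d\<bar> < e \<and> z + d *\<^sub>R i \<in> D" if "i \<in> Basis" "e > 0" for i e
    using assms that unfolding accessible_def by blast
qed

lemma frechet_derivative_within_cong:
  assumes "\<And>z. z \<in> D \<Longrightarrow> f z = g z" "z \<in> D"
  shows "frechet_derivative f (at z within D) = frechet_derivative g (at z within D)"
proof -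
  have "(f has_derivative f') (at z within D) \<longleftrightarrow> (g has_derivative f') (at z within D)" for f'
    using assms by (metis has_derivative_transform)
  then show ?thesis unfolding frechet_derivative_def by simp
qed

lemma Ck_on_cong:
  assumes "\<And>z. z \<in> D \<Longrightarrow> f z = g z"
  shows "Ck_on n D f \<longleftrightarrow> Ck_on n D g"
  using assms
proof (induction n arbitrary: f g)
  case 0
  then show ?case by (simp cong: continuous_on_cong)
next
  case (Suc n)
  have "f differentiable_on D \<longleftrightarrow> g differentiable_on D"
    unfolding differentiable_on_def differentiable_def
    using Suc.prems by (metis has_derivative_transform)
  moreover have "Ck_on n D (\<lambda>x. frechet_derivative f (at x within D) b) \<longleftrightarrow>
      Ck_on n D (\<lambda>x. frechet_derivative g (at x within D) b)" for b
    by (rule Suc.IH) (metis Suc.prems frechet_derivative_within_cong)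
  ultimately show ?case by simp
qed

lemma Ck_on_Suc_imp: "Ck_on (Suc n) D f \<Longrightarrow> Ck_on n D f"
proof (induction n arbitrary: f)
  case 0
  then show ?case by (auto intro: differentiable_imp_continuous_on)
next
  case (Suc n)
  then show ?case by (metis Ck_on.simps(2))
qed

text \<open>By uniqueness an explicit derivative may replace \<open>frechet_derivative\<close> in
  the recursion, so each closure property below reduces to a derivative rule and, usually, induction
  on the order.\<close>

lemma Ck_on_SucI:
  assumes "accessible D"
    and "\<And>z. z \<in> D \<Longrightarrow> (f has_derivative f' z) (at z within D)"
    and "\<And>b. b \<in> Basis \<Longrightarrow> Ck_on n D (\<lambda>z. f' z b)"
  shows "Ck_on (Suc n) D f"
proof -
  have "Ck_on n D (\<lambda>x. frechet_derivative f (at x within D) b)" if "b \<in> Basis" for b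
  proof -
    have "frechet_derivative f (at x within D) b = f' x b" if "x \<in> D" for x
      using frechet_derivative_within_eq[OF assms(1) that assms(2)[OF that]] by simp
    then have "Ck_on n D (\<lambda>x. frechet_derivative f (at x within D) b) \<longleftrightarrow> Ck_on n D (\<lambda>x. f' x b)"
      by (intro Ck_on_cong)
    then show ?thesis using assms(3)[OF that] by simp
  qed
  moreover have "f differentiable_on D"
    using assms(2) by (auto simp: differentiable_on_def differentiable_def)
  ultimately show ?thesis by simp
qed

lemma Ck_on_SucD:
  assumes "Ck_on (Suc n) D f"
  shows "\<And>z. z \<in> D \<Longrightarrow> (f has_derivative frechet_derivative f (at z within D)) (at z within D)"
    and "\<And>b. b \<in> Basis \<Longrightarrow> Ck_on n D (\<lambda>z. frechet_derivative f (at z within D) b)"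
  using assms by (auto simp: differentiable_on_def frechet_derivative_works)

lemma Ck_on_const: "accessible D \<Longrightarrow> Ck_on n D (\<lambda>z. c)"
proof (induction n arbitrary: c)
  case (Suc n)
  show ?case
    by (intro Ck_on_SucI[where f' = "\<lambda>z b. 0"] Suc has_derivative_const)
qed simp

lemma Ck_on_bounded_linear:
  assumes "accessible D" "bounded_linear L"
  shows "Ck_on n D f \<Longrightarrow> Ck_on n D (\<lambda>z. L (f z))"
proof (induction n arbitrary: f)
  case 0
  then show ?case
    by (simp add: bounded_linear.continuous_on[OF assms(2)])
next
  case (Suc n)
  show ?case
    by (intro Ck_on_SucI[where f' = "\<lambda>z b. L (frechet_derivative f (at z within D) b)"] assms
        bounded_linear.has_derivative[OF assms(2)] Suc.IH Ck_on_SucD[OF Suc.prems])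
qed

lemma Ck_on_add:
  assumes "accessible D"
  shows "Ck_on n D f \<Longrightarrow> Ck_on n D g \<Longrightarrow> Ck_on n D (\<lambda>z. f z + g z)"
proof (induction n arbitrary: f g)
  case 0
  then show ?case by (auto intro: continuous_on_add)
next
  case (Suc n)
  show ?case
    by (intro Ck_on_SucI[where f' = "\<lambda>z b. frechet_derivative f (at z within D) b
          + frechet_derivative g (at z within D) b"] assms has_derivative_add Suc.IH
        Ck_on_SucD[OF Suc.prems(1)] Ck_on_SucD[OF Suc.prems(2)])
qed

lemma Ck_on_mult:
  fixes f g :: "'a::euclidean_space \<Rightarrow> real"
  assumes "accessible D"
  shows "Ck_on n D f \<Longrightarrow> Ck_on n D g \<Longrightarrow> Ck_on n D (\<lambda>z. f z * g z)"
proof (induction n arbitrary: f g)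
  case 0
  then show ?case by (auto intro: continuous_on_mult)
next
  case (Suc n)
  show ?case
    by (intro Ck_on_SucI[where f' = "\<lambda>z b. f z * frechet_derivative g (at z within D) b
          + frechet_derivative f (at z within D) b * g z"] assms has_derivative_mult Ck_on_add Suc.IH
        Ck_on_SucD[OF Suc.prems(1)] Ck_on_SucD[OF Suc.prems(2)]
        Ck_on_Suc_imp[OF Suc.prems(1)] Ck_on_Suc_imp[OF Suc.prems(2)])
qed

lemma Ck_on_inverse:
  fixes f :: "'a::euclidean_space \<Rightarrow> real"
  assumes "accessible D" "\<And>z. z \<in> D \<Longrightarrow> f z \<noteq> 0"
  shows "Ck_on n D f \<Longrightarrow> Ck_on n D (\<lambda>z. inverse (f z))"
proof (induction n)
  case 0
  then show ?case using assms by (auto intro: continuous_on_inverse)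
next
  case (Suc n)
  show ?case
  proof (rule Ck_on_SucI[where f' = "\<lambda>z b. - (inverse (f z) * frechet_derivative f (at z within D) b
         * inverse (f z))"])
    show "((\<lambda>z. inverse (f z)) has_derivative
         (\<lambda>b. - (inverse (f z) * frechet_derivative f (at z within D) b * inverse (f z)))) (at z within D)"
      if "z \<in> D" for z
      using Deriv.has_derivative_inverse[OF assms(2)[OF that] Ck_on_SucD(1)[OF Suc.prems that]] .
    have "Ck_on n D (\<lambda>z. (-1) * (inverse (f z) * frechet_derivative f (at z within D) b * inverse (f z)))"
      if "b \<in> Basis" for b
      using Suc.IH Ck_on_SucD(2)[OF Suc.prems that] Ck_on_Suc_imp[OF Suc.prems]
      by (intro Ck_on_mult Ck_on_const assms) auto
    then show "Ck_on n D (\<lambda>z. - (inverse (f z) * frechet_derivative f (at z within D) b * inverse (f z)))"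
      if "b \<in> Basis" for b using that by simp
  qed (rule assms)
qed

text \<open>A case distinction replaces induction: the derivative of ln f contains no logarithm,
  only f' and 1/f, whose regularity is known. For \<open>sqrt\<close> the root reappears in the
  derivative.\<close>

lemma Ck_on_ln:
  fixes f :: "'a::euclidean_space \<Rightarrow> real"
  assumes "accessible D" "\<And>z. z \<in> D \<Longrightarrow> f z > 0"
  shows "Ck_on n D f \<Longrightarrow> Ck_on n D (\<lambda>z. ln (f z))"
proof -
  have "Ck_on (Suc n) D (\<lambda>z. ln (f z))" if C: "Ck_on (Suc n) D f" for n
  proof (rule Ck_on_SucI[where f' = "\<lambda>z b. frechet_derivative f (at z within D) b * inverse (f z)"])
    show "((\<lambda>z. ln (f z)) has_derivative
         (\<lambda>b. frechet_derivative f (at z within D) b * inverse (f z))) (at z within D)"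
      if "z \<in> D" for z
      using has_derivative_ln[OF assms(2)[OF that] Ck_on_SucD(1)[OF C that]]
      by (simp add: mult.commute)
    show "Ck_on n D (\<lambda>z. frechet_derivative f (at z within D) b * inverse (f z))"
      if "b \<in> Basis" for b
      using Ck_on_SucD(2)[OF C that] Ck_on_Suc_imp[OF C] assms
      by (intro Ck_on_mult Ck_on_inverse assms) (auto dest: assms(2))
  qed (rule assms)
  then show "Ck_on n D f \<Longrightarrow> Ck_on n D (\<lambda>z. ln (f z))"
    using assms(2) by (cases n) (auto intro!: continuous_on_ln, metis less_irrefl)
qed

lemma Ck_on_sqrt:
  fixes f :: "'a::euclidean_space \<Rightarrow> real"
  assumes "accessible D" "\<And>z. z \<in> D \<Longrightarrow> f z > 0"
  shows "Ck_on n D f \<Longrightarrow> Ck_on n D (\<lambda>z. sqrt (f z))"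
proof (induction n)
  case 0
  then show ?case by (auto intro: continuous_on_real_sqrt)
next
  case (Suc n)
  show ?case
  proof (rule Ck_on_SucI[where f' = "\<lambda>z b. frechet_derivative f (at z within D) b * inverse (2 * sqrt (f z))"])
    show "((\<lambda>z. sqrt (f z)) has_derivative
         (\<lambda>b. frechet_derivative f (at z within D) b * inverse (2 * sqrt (f z)))) (at z within D)"
      if "z \<in> D" for z
      using has_derivative_real_sqrt[OF assms(2)[OF that] Ck_on_SucD(1)[OF Suc.prems that]]
      by (simp add: field_simps)
    show "Ck_on n D (\<lambda>z. frechet_derivative f (at z within D) b * inverse (2 * sqrt (f z)))"
      if "b \<in> Basis" for b
      using Suc.IH Ck_on_SucD(2)[OF Suc.prems that] Ck_on_Suc_imp[OF Suc.prems]
      by (intro Ck_on_mult Ck_on_inverse Ck_on_const assms) (auto dest: assms(2))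
  qed (rule assms)
qed

section \<open>Symmetry of mixed second derivatives\<close>

lemma has_real_derivative_along:
  fixes f :: "'a::real_normed_vector \<Rightarrow> real"
  assumes "(f has_derivative F) (at (w + x *\<^sub>R b))"
  shows "((\<lambda>x. f (w + x *\<^sub>R b)) has_real_derivative F b) (at x)"
proof -
  have "((\<lambda>x. w + x *\<^sub>R b) has_derivative (\<lambda>h. h *\<^sub>R b)) (at x)"
    by (auto intro!: derivative_eq_intros)
  from has_derivative_compose[OF this assms]
  have "((\<lambda>x. f (w + x *\<^sub>R b)) has_derivative (\<lambda>h. F (h *\<^sub>R b))) (at x)" .
  moreover have "F (h *\<^sub>R b) = F b * h" for h
    using linear_scale[OF has_derivative_linear[OF assms]] by simp
  ultimately show ?thesis by (simp add: has_field_derivative_def)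
qed

text \<open>The mean value theorem is applied twice: along b to the increment of f in direction c,
  then along c to the derivative in direction b.\<close>

lemma second_difference:
  fixes f :: "'a::real_normed_vector \<Rightarrow> real"
  assumes f: "\<And>y. y \<in> U \<Longrightarrow> (f has_derivative f' y) (at y)"
    and A: "\<And>y. y \<in> U \<Longrightarrow> ((\<lambda>y. f' y b) has_derivative A' y) (at y)"
    and U: "\<And>x y. 0 \<le> x \<Longrightarrow> x \<le> s \<Longrightarrow> 0 \<le> y \<Longrightarrow> y \<le> s \<Longrightarrow> z + x *\<^sub>R b + y *\<^sub>R c \<in> U"
    and "0 < s"
  shows "\<exists>x y. 0 < x \<and> x < s \<and> 0 < y \<and> y < s \<and>
    f (z + s *\<^sub>R b + s *\<^sub>R c) - f (z + s *\<^sub>R b) - f (z + s *\<^sub>R c) + f z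
      = s * (s * A' (z + x *\<^sub>R b + y *\<^sub>R c) c)"
proof -
  let ?g = "\<lambda>x. f ((z + s *\<^sub>R c) + x *\<^sub>R b) - f (z + x *\<^sub>R b)"
  have "DERIV ?g x :> f' ((z + s *\<^sub>R c) + x *\<^sub>R b) b - f' (z + x *\<^sub>R b) b" if "0 \<le> x" "x \<le> s" for x
    using U[of x s] U[of x 0] that \<open>0 < s\<close>
    by (intro DERIV_diff has_real_derivative_along f) (simp_all add: algebra_simps)
  from MVT2[OF \<open>0 < s\<close> this] obtain x where x: "0 < x" "x < s"
    and 1: "?g s - ?g 0 = s * (f' ((z + s *\<^sub>R c) + x *\<^sub>R b) b - f' (z + x *\<^sub>R b) b)"
    by auto
  let ?k = "\<lambda>y. f' ((z + x *\<^sub>R b) + y *\<^sub>R c) b"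
  have "DERIV ?k y :> A' ((z + x *\<^sub>R b) + y *\<^sub>R c) c" if "0 \<le> y" "y \<le> s" for y
    using U[of x y] that x
    by (intro has_real_derivative_along[where f = "\<lambda>y. f' y b"] A) simp_all
  from MVT2[OF \<open>0 < s\<close> this] obtain y where y: "0 < y" "y < s"
    and 2: "?k s - ?k 0 = s * A' ((z + x *\<^sub>R b) + y *\<^sub>R c) c"
    by auto
  have "?g s - ?g 0 = s * (s * A' ((z + x *\<^sub>R b) + y *\<^sub>R c) c)"
    unfolding 1 using 2 by (simp add: algebra_simps)
  then show ?thesis using x y by (intro exI[of _ x] exI[of _ y]) (simp add: algebra_simps)
qed

text \<open>Each mixed derivative, taken at some point near z, equals the same second difference
  divided by s^2; continuity at z then forces equality.\<close>

lemma mixed_derivatives_commute: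
  fixes f :: "'a::real_normed_vector \<Rightarrow> real"
  assumes "open U" "z \<in> U"
    and f: "\<And>y. y \<in> U \<Longrightarrow> (f has_derivative f' y) (at y)"
    and A: "\<And>y. y \<in> U \<Longrightarrow> ((\<lambda>y. f' y b) has_derivative A' y) (at y)"
    and B: "\<And>y. y \<in> U \<Longrightarrow> ((\<lambda>y. f' y c) has_derivative B' y) (at y)"
    and contA: "continuous_on U (\<lambda>y. A' y c)" and contB: "continuous_on U (\<lambda>y. B' y b)"
  shows "A' z c = B' z b"
proof (rule ccontr)
  assume neq: "A' z c \<noteq> B' z b"
  define e where "e = \<bar>A' z c - B' z b\<bar> / 2"
  have "e > 0" using neq by (simp add: e_def)
  have "\<forall>\<^sub>F y in nhds z. y \<in> U" using assms(1,2) by (simp add: eventually_nhds_in_open)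
  moreover have "\<forall>\<^sub>F y in nhds z. dist (A' y c) (A' z c) < e"
    using contA assms(1,2) \<open>e > 0\<close> tendstoD
    by (metis continuous_on_eq_continuous_at isCont_def tendsto_at_iff_tendsto_nhds)
  moreover have "\<forall>\<^sub>F y in nhds z. dist (B' y b) (B' z b) < e"
    using contB assms(1,2) \<open>e > 0\<close> tendstoD
    by (metis continuous_on_eq_continuous_at isCont_def tendsto_at_iff_tendsto_nhds)
  ultimately have "\<forall>\<^sub>F y in nhds z. y \<in> U \<and> dist (A' y c) (A' z c) < e \<and> dist (B' y b) (B' z b) < e"
    by eventually_elim auto
  then obtain d where "d > 0" and d: "\<And>y. dist y z < d \<Longrightarrow>
      y \<in> U \<and> dist (A' y c) (A' z c) < e \<and> dist (B' y b) (B' z b) < e"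
    unfolding eventually_nhds_metric by blast
  \<comment> \<open>The summand 1 keeps n positive when b = c = 0 and makes the estimate by s * n
    strict. With s = d / (2n) the whole parallelogram stays in the ball of radius d.\<close>
  define n where "n = norm b + norm c + 1"
  have nb: "n > 0" by (simp add: add_nonneg_pos n_def)
  define s where "s = d / (2 * n)"
  have "s > 0" using \<open>d > 0\<close> nb by (simp add: s_def)
  have near: "dist (z + x *\<^sub>R b + y *\<^sub>R c) z < d" if "0 \<le> x" "x \<le> s" "0 \<le> y" "y \<le> s" for x y
  proof -
    have "dist (z + x *\<^sub>R b + y *\<^sub>R c) z \<le> norm (x *\<^sub>R b) + norm (y *\<^sub>R c)"
      by (metis add.assoc add_diff_cancel_left' dist_norm norm_triangle_ineq)
    also have "\<dots> \<le> s * norm b + s * norm c"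
      using that by (auto intro!: add_mono mult_right_mono)
    also have "\<dots> < s * n" using \<open>s > 0\<close> by (simp add: algebra_simps n_def)
    also have "\<dots> = d / 2" using nb by (simp add: s_def)
    finally show ?thesis using \<open>d > 0\<close> by simp
  qed
  have d1: "z + x *\<^sub>R b + y *\<^sub>R c \<in> U" if "0 \<le> x" "x \<le> s" "0 \<le> y" "y \<le> s" for x y
    using d[OF near[OF that]] by simp
  have ex1: "\<exists>x y. 0 < x \<and> x < s \<and> 0 < y \<and> y < s \<and>
      f (z + s *\<^sub>R b + s *\<^sub>R c) - f (z + s *\<^sub>R b) - f (z + s *\<^sub>R c) + f z
        = s * (s * A' (z + x *\<^sub>R b + y *\<^sub>R c) c)"
    by (rule second_difference[of U f f' b A']) (simp_all add: f A d1 \<open>s > 0\<close>)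
  obtain x y where xy: "0 < x" "x < s" "0 < y" "y < s"
    and W1: "f (z + s *\<^sub>R b + s *\<^sub>R c) - f (z + s *\<^sub>R b) - f (z + s *\<^sub>R c) + f z
      = s * (s * A' (z + x *\<^sub>R b + y *\<^sub>R c) c)"
    using ex1 by auto
  have near': "dist (z + x *\<^sub>R c + y *\<^sub>R b) z < d" if "0 \<le> x" "x \<le> s" "0 \<le> y" "y \<le> s" for x y
    using near[of y x] that by (simp add: algebra_simps)
  have d2: "z + x *\<^sub>R c + y *\<^sub>R b \<in> U" if "0 \<le> x" "x \<le> s" "0 \<le> y" "y \<le> s" for x y
    using d[OF near'[OF that]] by simp
  have ex2: "\<exists>x y. 0 < x \<and> x < s \<and> 0 < y \<and> y < s \<and>
      f (z + s *\<^sub>R c + s *\<^sub>R b) - f (z + s *\<^sub>R c) - f (z + s *\<^sub>R b) + f z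
        = s * (s * B' (z + x *\<^sub>R c + y *\<^sub>R b) b)"
    by (rule second_difference[of U f f' c B']) (simp_all add: f B d2 \<open>s > 0\<close>)
  obtain x' y' where xy': "0 < x'" "x' < s" "0 < y'" "y' < s"
    and W2: "f (z + s *\<^sub>R c + s *\<^sub>R b) - f (z + s *\<^sub>R c) - f (z + s *\<^sub>R b) + f z
      = s * (s * B' (z + x' *\<^sub>R c + y' *\<^sub>R b) b)"
    using ex2 by auto
  have "s * (s * A' (z + x *\<^sub>R b + y *\<^sub>R c) c) = s * (s * B' (z + x' *\<^sub>R c + y' *\<^sub>R b) b)"
    unfolding W1[symmetric] W2[symmetric] by (simp add: algebra_simps)
  then have "A' (z + x *\<^sub>R b + y *\<^sub>R c) c = B' (z + x' *\<^sub>R c + y' *\<^sub>R b) b"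
    using \<open>s > 0\<close> by simp
  moreover have "dist (A' (z + x *\<^sub>R b + y *\<^sub>R c) c) (A' z c) < e" using d near xy by simp
  moreover have "dist (B' (z + x' *\<^sub>R c + y' *\<^sub>R b) b) (B' z b) < e" using d near' xy' by simp
  ultimately have "\<bar>A' z c - B' z b\<bar> < 2 * e" by (auto simp: dist_real_def)
  then show False by (simp add: e_def)
qed

text \<open>The value \<open>0\<close> outside \<open>D\<close> makes the rules of calculus hold as equations between functions.\<close>

definition dir_deriv :: "'a::euclidean_space set \<Rightarrow> 'a \<Rightarrow> ('a \<Rightarrow> real) \<Rightarrow> 'a \<Rightarrow> real" where
  "dir_deriv D b f = (\<lambda>z. if z \<in> D then frechet_derivative f (at z within D) b else 0)"

lemma smooth_on_cong: "(\<And>z. z \<in> D \<Longrightarrow> f z = g z) \<Longrightarrow> smooth_on D f \<longleftrightarrow> smooth_on D g"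
  unfolding smooth_on_def using Ck_on_cong by metis

lemma smooth_on_has_derivative:
  "smooth_on D f \<Longrightarrow> z \<in> D \<Longrightarrow> (f has_derivative frechet_derivative f (at z within D)) (at z within D)"
  unfolding smooth_on_def using Ck_on_SucD(1) by blast

lemma smooth_on_continuous_on: "smooth_on D f \<Longrightarrow> continuous_on D f"
  unfolding smooth_on_def by (metis Ck_on.simps(1))

lemma smooth_on_dir_deriv: "smooth_on D f \<Longrightarrow> b \<in> Basis \<Longrightarrow> smooth_on D (dir_deriv D b f)"
proof -
  assume f: "smooth_on D f" and b: "b \<in> Basis"
  have "smooth_on D (\<lambda>z. frechet_derivative f (at z within D) b)"
    using f b Ck_on_SucD(2) unfolding smooth_on_def by blast
  then show ?thesis by (subst smooth_on_cong[where g = "\<lambda>z. frechet_derivative f (at z within D) b"])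
    (auto simp: dir_deriv_def)
qed

lemma dir_deriv_eq:
  assumes "accessible D" "z \<in> D" "(f has_derivative f') (at z within D)"
  shows "dir_deriv D b f z = f' b"
  using frechet_derivative_within_eq[OF assms] assms(2) by (simp add: dir_deriv_def)

text \<open>Symmetry is proved on the interior, where derivatives are unrestricted, and extends to
  the initial time by continuity, since D lies in the closure of its interior.\<close>

lemma dir_deriv_commute:
  assumes acc: "accessible D" and D: "D \<subseteq> closure (interior D)" and f: "smooth_on D f"
    and b: "b \<in> Basis" and c: "c \<in> Basis"
  shows "dir_deriv D b (dir_deriv D c f) = dir_deriv D c (dir_deriv D b f)"
proof -
  note sm = smooth_on_dir_deriv
  have int: "dir_deriv D b (dir_deriv D c f) z = dir_deriv D c (dir_deriv D b f) z" if z: "z \<in> interior D" for z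
  proof -
    let ?fr = "\<lambda>f y. frechet_derivative f (at y within D)"
    have der: "(k has_derivative ?fr k y) (at y)" if "smooth_on D k" "y \<in> interior D" for k y
      using smooth_on_has_derivative[OF that(1), of y] at_within_interior[OF that(2)] that interior_subset
      by auto
    have A: "((\<lambda>y. ?fr f y b) has_derivative ?fr (dir_deriv D b f) y) (at y)" if "y \<in> interior D" "b \<in> Basis" for y b
      by (rule has_derivative_transform_within_open[OF der[OF sm[OF f that(2)] that(1)] open_interior that(1)])
        (use interior_subset in \<open>auto simp: dir_deriv_def\<close>)
    have cont: "continuous_on (interior D) (\<lambda>y. ?fr (dir_deriv D b f) y c)" if "b \<in> Basis" "c \<in> Basis" for b c
    proof -
      have "continuous_on (interior D) (dir_deriv D c (dir_deriv D b f))"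
        using smooth_on_continuous_on[OF sm[OF sm[OF f that(1)] that(2)]] continuous_on_subset interior_subset
        by blast
      then show ?thesis
        by (rule continuous_on_eq) (use interior_subset in \<open>auto simp: dir_deriv_def\<close>)
    qed
    have "?fr (dir_deriv D b f) z c = ?fr (dir_deriv D c f) z b"
      by (rule mixed_derivatives_commute[OF open_interior z, of f "?fr f"])
        (auto intro: der f A cont b c)
    then show ?thesis using z interior_subset by (auto simp: dir_deriv_def)
  qed
  have "dir_deriv D b (dir_deriv D c f) z = dir_deriv D c (dir_deriv D b f) z" if zD: "z \<in> D" for z
  proof -
    have 0: "continuous_on D (\<lambda>z. dir_deriv D b (dir_deriv D c f) z - dir_deriv D c (dir_deriv D b f) z)"
      using smooth_on_continuous_on[OF sm[OF sm[OF f c] b]] smooth_on_continuous_on[OF sm[OF sm[OF f b] c]]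
      by (rule continuous_on_diff)
    then have "continuous (at z within D) (\<lambda>z. dir_deriv D b (dir_deriv D c f) z - dir_deriv D c (dir_deriv D b f) z)"
      using zD continuous_on_eq_continuous_within by blast
    moreover obtain w where w: "\<And>n. w n \<in> interior D" "w \<longlonglongrightarrow> z"
      using subsetD[OF D zD] unfolding closure_sequential by auto
    ultimately have "(\<lambda>n. dir_deriv D b (dir_deriv D c f) (w n) - dir_deriv D c (dir_deriv D b f) (w n))
        \<longlonglongrightarrow> dir_deriv D b (dir_deriv D c f) z - dir_deriv D c (dir_deriv D b f) z"
      using continuous_within_sequentially[of z D] interior_subset by (fastforce simp: o_def)
    then have "(\<lambda>n. 0) \<longlonglongrightarrow> dir_deriv D b (dir_deriv D c f) z - dir_deriv D c (dir_deriv D b f) z"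
      using w int by simp
    then show ?thesis by (simp add: LIMSEQ_const_iff)
  qed
  then show ?thesis by (auto simp: dir_deriv_def)
qed

section \<open>Derivations and evolving frames\<close>

locale regular_domain =
  fixes D :: "'z::euclidean_space set"
  assumes acc: "accessible D"
begin

lemma smooth_const [simp]: "smooth_on D (\<lambda>_. r)"
  by (simp add: smooth_on_def Ck_on_const acc)

lemma smooth_zero [simp]: "smooth_on D 0" and smooth_one [simp]: "smooth_on D 1"
  by (simp_all add: zero_fun_def one_fun_def)

lemma smooth_numeral [simp]: "smooth_on D (numeral n :: 'z \<Rightarrow> real)"
  by (simp add: numeral_fun)

lemma smooth_add [simp]: "smooth_on D f \<Longrightarrow> smooth_on D g \<Longrightarrow> smooth_on D (f + g)"
  for f g :: "'z \<Rightarrow> real"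
  by (simp add: smooth_on_def Ck_on_add acc plus_fun_def)

lemma smooth_mult [simp]: "smooth_on D f \<Longrightarrow> smooth_on D g \<Longrightarrow> smooth_on D (f * g)"
  for f g :: "'z \<Rightarrow> real"
  by (simp add: smooth_on_def Ck_on_mult acc times_fun_def)

lemma smooth_uminus [simp]: "smooth_on D f \<Longrightarrow> smooth_on D (- f)"
  for f :: "'z \<Rightarrow> real"
  using smooth_mult[of "\<lambda>_. -1" f] by (simp add: times_fun_def fun_Compl_def)

lemma smooth_diff [simp]: "smooth_on D f \<Longrightarrow> smooth_on D g \<Longrightarrow> smooth_on D (f - g)"
  for f g :: "'z \<Rightarrow> real"
  using smooth_add[of f "- g"] by simp

lemma smooth_inverse [simp]:
  "smooth_on D f \<Longrightarrow> (\<And>z. z \<in> D \<Longrightarrow> f z \<noteq> 0) \<Longrightarrow> smooth_on D (\<lambda>z. inverse (f z))"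
  for f :: "'z \<Rightarrow> real"
  by (simp add: smooth_on_def Ck_on_inverse acc)

lemma smooth_ln [simp]:
  "smooth_on D f \<Longrightarrow> (\<And>z. z \<in> D \<Longrightarrow> f z > 0) \<Longrightarrow> smooth_on D (\<lambda>z. ln (f z))"
  for f :: "'z \<Rightarrow> real"
  by (simp add: smooth_on_def Ck_on_ln acc)

lemma smooth_sqrt [simp]:
  "smooth_on D f \<Longrightarrow> (\<And>z. z \<in> D \<Longrightarrow> f z > 0) \<Longrightarrow> smooth_on D (\<lambda>z. sqrt (f z))"
  for f :: "'z \<Rightarrow> real"
  by (simp add: smooth_on_def Ck_on_sqrt acc)

end

locale derivation = regular_domain D for D :: "'z::euclidean_space set" +
  fixes \<delta> :: "('z \<Rightarrow> real) \<Rightarrow> 'z \<Rightarrow> real"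
  assumes smooth [simp]: "smooth_on D f \<Longrightarrow> smooth_on D (\<delta> f)"
    and cong: "(\<And>z. z \<in> D \<Longrightarrow> f z = g z) \<Longrightarrow> \<delta> f = \<delta> g"
    and const [simp]: "\<delta> (\<lambda>_. r) = 0"
    and add [simp]: "smooth_on D f \<Longrightarrow> smooth_on D g \<Longrightarrow> \<delta> (f + g) = \<delta> f + \<delta> g"
    and mult [simp]: "smooth_on D f \<Longrightarrow> smooth_on D g \<Longrightarrow> \<delta> (f * g) = \<delta> f * g + f * \<delta> g"
    and ln [simp]: "smooth_on D f \<Longrightarrow> (\<And>z. z \<in> D \<Longrightarrow> f z > 0) \<Longrightarrow>
      \<delta> (\<lambda>z. ln (f z)) = \<delta> f * (\<lambda>z. inverse (f z))"
begin

lemma zero [simp]: "\<delta> 0 = 0" and one [simp]: "\<delta> 1 = 0"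
  using const[of 0] const[of 1] by (simp_all add: zero_fun_def one_fun_def)

lemma numeral [simp]: "\<delta> (numeral n) = 0"
  by (simp add: numeral_fun)

lemma uminus [simp]: "smooth_on D f \<Longrightarrow> \<delta> (- f) = - \<delta> f"
  using mult[of "\<lambda>_. -1" f] by (simp add: times_fun_def fun_Compl_def plus_fun_def zero_fun_def)

lemma diff [simp]: "smooth_on D f \<Longrightarrow> smooth_on D g \<Longrightarrow> \<delta> (f - g) = \<delta> f - \<delta> g"
  using add[of f "- g"] by simp

text \<open>A derivation sees f only through its values on D, so f may be multiplied by the
  indicator of D. The indicator agrees on D with a constant, so its derivative is 0 and the product
  rule leaves it as a factor of \<delta> f.\<close>

lemma zero_outside: "smooth_on D f \<Longrightarrow> z \<notin> D \<Longrightarrow> \<delta> f z = 0"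
proof -
  assume "z \<notin> D" and f: "smooth_on D f"
  let ?k = "\<lambda>x. if x \<in> D then 1 else 0 :: real"
  have k: "smooth_on D ?k" "\<delta> ?k = 0"
    using smooth_one smooth_on_cong[of D ?k 1] cong[of ?k 1] by auto
  have "\<delta> f = \<delta> (f * ?k)" by (rule cong) simp
  also have "\<dots> = \<delta> f * ?k" using f k by simp
  finally have "\<delta> f z = (\<delta> f * ?k) z" by simp
  then show ?thesis using \<open>z \<notin> D\<close> by simp
qed

text \<open>Differentiate f (1/f) = 1, an equation valid on D; off D both sides of the claim are
  0.\<close>

lemma inverse [simp]:
  assumes f: "smooth_on D f" and nz: "\<And>z. z \<in> D \<Longrightarrow> f z \<noteq> 0"
  shows "\<delta> (\<lambda>z. inverse (f z)) = - \<delta> f * (\<lambda>z. inverse (f z)) * (\<lambda>z. inverse (f z))"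
proof -
  let ?i = "\<lambda>z. inverse (f z)"
  have "\<delta> (f * ?i) = \<delta> 1" by (rule cong) (simp add: nz)
  then have 0: "\<delta> f * ?i + f * \<delta> ?i = 0" using f nz by simp
  show ?thesis
  proof
    fix z
    show "\<delta> ?i z = (- \<delta> f * ?i * ?i) z"
    proof (cases "z \<in> D")
      case True
      have "\<delta> f z * inverse (f z) + f z * \<delta> ?i z = 0" using fun_cong[OF 0, of z] by simp
      then show ?thesis using nz[OF True] by (simp add: field_simps)
    next
      case False
      then show ?thesis using f nz zero_outside by simp
    qed
  qed
qed

end

lemma derivation_dir_deriv:
  assumes "accessible D" "b \<in> Basis"
  shows "derivation D (dir_deriv D b)"
proof unfold_locales
  note sd = smooth_on_has_derivative
  show "accessible D" by fact
  interpret regular_domain D by unfold_locales fact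
  show "smooth_on D (dir_deriv D b f)" if "smooth_on D f" for f
    using that assms smooth_on_dir_deriv by blast
  show "dir_deriv D b f = dir_deriv D b g" if "\<And>z. z \<in> D \<Longrightarrow> f z = g z" for f g
  proof
    show "dir_deriv D b f z = dir_deriv D b g z" for z
      using frechet_derivative_within_cong[of D f g z] that by (simp add: dir_deriv_def)
  qed
  show "dir_deriv D b (\<lambda>_. r) = 0" for r
  proof
    show "dir_deriv D b (\<lambda>_. r) z = 0 z" for z
      using dir_deriv_eq[where z = z and b = b, OF assms(1) _ has_derivative_const, of r]
      by (cases "z \<in> D") (auto simp: dir_deriv_def)
  qed
  show "dir_deriv D b (f + g) = dir_deriv D b f + dir_deriv D b g" if fg: "smooth_on D f" "smooth_on D g" for f g
  proof
    show "dir_deriv D b (f + g) z = (dir_deriv D b f + dir_deriv D b g) z" for z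
      using dir_deriv_eq[where z = z and b = b, OF assms(1) _ has_derivative_add[OF sd[OF fg(1)] sd[OF fg(2)]]]
      by (cases "z \<in> D") (auto simp: dir_deriv_def plus_fun_def)
  qed
  show "dir_deriv D b (f * g) = dir_deriv D b f * g + f * dir_deriv D b g"
    if fg: "smooth_on D f" "smooth_on D g" for f g
  proof
    show "dir_deriv D b (f * g) z = (dir_deriv D b f * g + f * dir_deriv D b g) z" for z
      using dir_deriv_eq[where z = z and b = b, OF assms(1) _ has_derivative_mult[OF sd[OF fg(1)] sd[OF fg(2)]]]
      by (cases "z \<in> D") (auto simp: dir_deriv_def plus_fun_def times_fun_def)
  qed
  show "dir_deriv D b (\<lambda>z. ln (f z)) = dir_deriv D b f * (\<lambda>z. inverse (f z))"
    if f: "smooth_on D f" "\<And>z. z \<in> D \<Longrightarrow> f z > 0" for f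
  proof
    show "dir_deriv D b (\<lambda>z. ln (f z)) z = (dir_deriv D b f * (\<lambda>z. inverse (f z))) z" for z
      using dir_deriv_eq[where z = z and b = b, OF assms(1) _ has_derivative_ln[OF f(2) sd[OF f(1)]]]
      by (cases "z \<in> D") (auto simp: dir_deriv_def mult.commute)
  qed
qed

lemma derivation_combination:
  assumes "derivation D \<delta>1" "derivation D \<delta>2" "smooth_on D \<alpha>" "smooth_on D \<beta>"
  shows "derivation D (\<lambda>f. \<alpha> * \<delta>1 f + \<beta> * \<delta>2 f)"
proof -
  interpret d1: derivation D \<delta>1 by fact
  interpret d2: derivation D \<delta>2 by fact
  show ?thesis
  proof
    show "\<alpha> * \<delta>1 f + \<beta> * \<delta>2 f = \<alpha> * \<delta>1 g + \<beta> * \<delta>2 g" if "\<And>z. z \<in> D \<Longrightarrow> f z = g z" for f g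
      using d1.cong[of f g] d2.cong[of f g] that by simp
  qed (use assms in \<open>simp_all add: algebra_simps\<close>)
qed

text \<open>
  \<open>X\<close>, \<open>Y\<close> is an orthonormal frame with \<open>\<nabla>\<^sub>X X = pY\<close> and \<open>\<nabla>\<^sub>Y Y = -qX\<close>, \<open>T\<close> is the time derivative of a
  metric evolving by \<open>\<partial>\<^sub>t g = -2\<rho>g\<close>, and \<open>\<tau>\<close> is the time coordinate.
\<close>

locale evolving_frame =
  X: derivation D X + Y: derivation D Y + T: derivation D T
  for D :: "'z::euclidean_space set" and X Y T +
  fixes p q \<rho> \<tau> :: "'z \<Rightarrow> real"
  assumes smooth_p [simp]: "smooth_on D p" and smooth_q [simp]: "smooth_on D q"
    and smooth_\<rho> [simp]: "smooth_on D \<rho>" and smooth_\<tau> [simp]: "smooth_on D \<tau>"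
    and XY: "smooth_on D f \<Longrightarrow> X (Y f) = Y (X f) - p * X f - q * Y f"
    and TX: "smooth_on D f \<Longrightarrow> T (X f) = X (T f) + \<rho> * X f"
    and TY: "smooth_on D f \<Longrightarrow> T (Y f) = Y (T f) + \<rho> * Y f"
    and Tp: "T p = \<rho> * p + Y \<rho>" and Tq: "T q = \<rho> * q - X \<rho>"
    and X\<tau> [simp]: "X \<tau> = 0" and Y\<tau> [simp]: "Y \<tau> = 0"
    and T\<tau>: "z \<in> D \<Longrightarrow> T \<tau> z = 1"
begin

definition lap :: "('z \<Rightarrow> real) \<Rightarrow> 'z \<Rightarrow> real" where
  "lap f = X (X f) + Y (Y f) + q * X f - p * Y f"

definition gam :: "('z \<Rightarrow> real) \<Rightarrow> ('z \<Rightarrow> real) \<Rightarrow> 'z \<Rightarrow> real" where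
  "gam f g = X f * X g + Y f * Y g"

text \<open>The Gaussian curvature as -d\<omega>(X, Y), where \<omega>(Z) = <\<nabla>_Z X, Y>, so
  that \<omega>(X) = p and \<omega>(Y) = q. The squares come from [X, Y] = -pX - qY.\<close>

definition K :: "'z \<Rightarrow> real" where
  "K = - X q + Y p - p * p - q * q"

text \<open>Hess f(Z, W) = Z(W f) - (\<nabla>_Z W) f on the frame; by \<open>XY\<close> the mixed
  entry is the same in either order.\<close>

definition hess11 :: "('z \<Rightarrow> real) \<Rightarrow> 'z \<Rightarrow> real" where
  "hess11 f = X (X f) - p * Y f"

definition hess12 :: "('z \<Rightarrow> real) \<Rightarrow> 'z \<Rightarrow> real" where
  "hess12 f = Y (X f) - q * Y f"

definition hess22 :: "('z \<Rightarrow> real) \<Rightarrow> 'z \<Rightarrow> real" where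
  "hess22 f = Y (Y f) + q * X f"

lemma smooth_lap [simp]: "smooth_on D f \<Longrightarrow> smooth_on D (lap f)"
  by (simp add: lap_def)

lemma smooth_gam [simp]: "smooth_on D f \<Longrightarrow> smooth_on D g \<Longrightarrow> smooth_on D (gam f g)"
  by (simp add: gam_def)

lemma smooth_K [simp]: "smooth_on D K"
  by (simp add: K_def)

lemma lap_cong: "(\<And>z. z \<in> D \<Longrightarrow> f z = g z) \<Longrightarrow> lap f = lap g"
  using X.cong[of f g] Y.cong[of f g] by (simp add: lap_def)

lemma lap_eq_hess: "lap f z = hess11 f z + hess22 f z"
  by (simp add: lap_def hess11_def hess22_def)

lemma lap_add: "smooth_on D f \<Longrightarrow> smooth_on D g \<Longrightarrow> lap (f + g) = lap f + lap g"
  by (simp add: lap_def algebra_simps)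

lemma lap_diff: "smooth_on D f \<Longrightarrow> smooth_on D g \<Longrightarrow> lap (f - g) = lap f - lap g"
  by (simp add: lap_def algebra_simps)

lemma lap_const [simp]: "lap (\<lambda>_. r) = 0"
  by (simp add: lap_def)

lemma lap_mult: "smooth_on D f \<Longrightarrow> smooth_on D g \<Longrightarrow>
    lap (f * g) = lap f * g + f * lap g + gam f g + gam f g"
  by (simp add: lap_def gam_def algebra_simps)

lemma gam_commute: "gam f g = gam g f"
  by (simp add: gam_def mult.commute)

text \<open>In dimension two a conformal change of the metric rescales the Laplacian without
  first-order terms; this is the infinitesimal form.\<close>

lemma T_lap: "smooth_on D f \<Longrightarrow> T (lap f) = lap (T f) + \<rho> * lap f + \<rho> * lap f"
  by (simp add: lap_def TX TY Tp Tq algebra_simps)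

lemma T_gam: "smooth_on D f \<Longrightarrow> smooth_on D g \<Longrightarrow>
    T (gam f g) = gam (T f) g + gam f (T g) + \<rho> * gam f g + \<rho> * gam f g"
  by (simp add: gam_def TX TY algebra_simps)

text \<open>Infinitesimal form of K(e^{2w} g) = e^{-2w} (K - \<Delta>w), with \<rho> the negative
  time derivative of w.\<close>

lemma T_K: "T K = \<rho> * K + \<rho> * K + lap \<rho>"
  by (simp add: K_def lap_def TX TY Tp Tq algebra_simps)

text \<open>Differentiating <\<nabla>u, \<nabla>h> along \<nabla>h gives Hess u(\<nabla>h,
  \<nabla>h) + Hess h(\<nabla>u, \<nabla>h), and the second term is half the derivative of
  |\<nabla>h|^2 along \<nabla>u.\<close>

lemma gam_gam_mixed: "smooth_on D u \<Longrightarrow> smooth_on D h \<Longrightarrow>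
  2 * gam h (gam u h) z = 2 * (hess11 u z * (X h z)\<^sup>2
     + 2 * hess12 u z * X h z * Y h z + hess22 u z * (Y h z)\<^sup>2) + gam u (gam h h) z"
  by (simp add: gam_def hess11_def hess12_def hess22_def XY algebra_simps power2_eq_square)

text \<open>In dimension two Ric = Kg, so the Ricci term is a multiple of |\<nabla>f|^2.\<close>

lemma bochner: "smooth_on D f \<Longrightarrow>
  lap (gam f f) z = 2 * ((hess11 f z)\<^sup>2 + 2 * (hess12 f z)\<^sup>2 + (hess22 f z)\<^sup>2)
    + 2 * gam f (lap f) z + 2 * K z * gam f f z"
  by (simp add: gam_def lap_def K_def hess11_def hess12_def hess22_def XY algebra_simps
      power2_eq_square)

end

section \<open>Evolution equations and barriers\<close>

text \<open>
  For \<open>A = Hess u + (k/2)g - v \<otimes> v / d\<close> with \<open>v = (x, y)\<close> this is \<open>2|A|\<^sup>2 \<ge> (tr A)\<^sup>2\<close>.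
\<close>

lemma hessian_square_ge:
  fixes a b c e k x y P d :: real
  assumes "P * d = x\<^sup>2 + y\<^sup>2" "d > 0"
  shows "2 * (a\<^sup>2 + 2 * b\<^sup>2 + c\<^sup>2) + 2 * k * (a + c) + k\<^sup>2 + 2 * P\<^sup>2 - 2 * k * P
     - 4 * (a * x\<^sup>2 + 2 * b * x * y + c * y\<^sup>2) / d \<ge> (a + c + k - P)\<^sup>2"
proof -
  \<comment> \<open>Rescaling v by 1 / sqrt d absorbs the denominator. The deficit is then a
    polynomial, namely the squares of the trace-free part of A.\<close>
  define s where "s = x / sqrt d"
  define t where "t = y / sqrt d"
  have x: "x = s * sqrt d" and y: "y = t * sqrt d" using assms by (simp_all add: s_def t_def)
  have "P * d = (s\<^sup>2 + t\<^sup>2) * d" using assms by (simp add: x y power_mult_distrib algebra_simps)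
  then have P: "P = s\<^sup>2 + t\<^sup>2" using assms by simp
  have "4 * (a * x\<^sup>2 + 2 * b * x * y + c * y\<^sup>2) / d = 4 * (a * s\<^sup>2 + 2 * b * s * t + c * t\<^sup>2)"
  proof -
    have "4 * (a * x\<^sup>2 + 2 * b * x * y + c * y\<^sup>2) = 4 * (a * s\<^sup>2 + 2 * b * s * t + c * t\<^sup>2) * (sqrt d * sqrt d)"
      unfolding x y by (simp add: power2_eq_square algebra_simps)
    then show ?thesis using assms by simp
  qed
  moreover have "2 * (a\<^sup>2 + 2 * b\<^sup>2 + c\<^sup>2) + 2 * k * (a + c) + k\<^sup>2 + 2 * P\<^sup>2 - 2 * k * P
     - 4 * (a * s\<^sup>2 + 2 * b * s * t + c * t\<^sup>2) - (a + c + k - P)\<^sup>2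
     = ((a - s\<^sup>2) - (c - t\<^sup>2))\<^sup>2 + 4 * (b - s * t)\<^sup>2"
    unfolding P by (simp add: power2_eq_square algebra_simps)
  ultimately show ?thesis by (smt (verit) zero_le_power2)
qed

lemma zero_le_mult_pos:
  fixes a b :: "'a::linordered_idom"
  shows "0 < a \<Longrightarrow> 0 \<le> a * b \<Longrightarrow> 0 \<le> b"
  by (simp add: zero_le_mult_iff not_le)

context evolving_frame
begin

text \<open>The reaction term 2\<epsilon>K^2 in the evolution of K is strictly positive and the
  diffusion term is nonnegative at a minimum.\<close>

lemma curvature_lower_barrier:
  assumes z: "z \<in> D" and \<rho>: "\<rho> = (\<lambda>_. \<epsilon>) * K" and "\<epsilon> > 0" and "K z > 0"
    and X0: "X K z = 0" and Y0: "Y K z = 0" and L0: "lap K z \<ge> 0"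
  shows "T K z > 0"
proof -
  have "lap \<rho> = (\<lambda>_. \<epsilon>) * lap K" unfolding \<rho> by (simp add: lap_mult gam_def)
  then have "T K z = 2 * \<epsilon> * K z * K z + \<epsilon> * lap K z"
    by (simp add: T_K) (simp add: \<rho>)
  then show ?thesis using assms by (simp add: add_pos_nonneg)
qed

text \<open>Here f = ln R, and M = \<Delta> ln R + R is Hamilton's trace Harnack expression. Taking
  the Laplacian of the equation for f and applying the Bochner formula produces the square 2|Hess f
  + Kg|^2, which controls M^2. The last three conclusions translate derivatives of K into
  derivatives of f.\<close>

lemma log_curvature_evolution:
  assumes z: "z \<in> D" and \<rho>: "\<rho> = (\<lambda>_. \<epsilon>) * K" and "\<epsilon> \<ge> 0" and pos: "\<And>z. z \<in> D \<Longrightarrow> K z > 0"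
    and f: "f = (\<lambda>z. ln (2 * K z))" and M: "M = lap f + K + K"
  shows "T f z = \<epsilon> * (M z + gam f f z)"
    and "T M z \<ge> \<epsilon> * (lap M z + 2 * gam f M z + (M z)\<^sup>2)"
    and "K z * (M z - 2 * K z) = lap K z - K z * gam f f z"
    and "X K z = K z * X f z" and "Y K z = K z * Y f z"
proof -
  have sf [simp]: "smooth_on D f" using X.smooth_ln[of "2 * K"] pos by (simp add: f)
  have sM [simp]: "smooth_on D M" by (simp add: M)
  \<comment> \<open>K is a multiple of e^f, so every derivation obeys this rule; it is proved once
    for X, Y and T.\<close>
  have der: "\<delta> K = K * \<delta> f" if "derivation D \<delta>" for \<delta>
  proof -
    interpret d: derivation D \<delta> by fact
    have *: "\<delta> f = 2 * \<delta> K * (\<lambda>z. inverse (2 * K z))"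
      using d.ln[of "2 * K"] pos by (simp add: f)
    show ?thesis
    proof
      fix z show "\<delta> K z = (K * \<delta> f) z"
        using pos[of z] d.zero_outside[of K z] by (cases "z \<in> D") (simp_all add: * field_simps)
    qed
  qed
  have XK: "X K = K * X f" and YK: "Y K = K * Y f" and TK: "T K = K * T f"
    by (rule der, unfold_locales)+
  have lapK: "lap K = K * (lap f + gam f f)"
    unfolding lap_def XK YK by (simp add: gam_def XK YK algebra_simps)
  have lap\<rho>: "lap \<rho> = (\<lambda>_. \<epsilon>) * lap K" unfolding \<rho> by (simp add: lap_mult gam_def)
  have Tf: "T f z = \<epsilon> * (M z + gam f f z)" if "z \<in> D" for z
  proof -
    have "K z * T f z = T K z" using TK by simp
    also have "\<dots> = K z * (\<epsilon> * (M z + gam f f z))"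
      unfolding T_K lap\<rho> lapK by (simp add: \<rho> M algebra_simps)
    finally show ?thesis using pos[OF that] by simp
  qed
  show "T f z = \<epsilon> * (M z + gam f f z)" by (rule Tf[OF z])
  show "X K z = K z * X f z" "Y K z = K z * Y f z" using XK YK by simp_all
  show "K z * (M z - 2 * K z) = lap K z - K z * gam f f z"
    by (simp add: lapK M algebra_simps)
  have "lap (T f) = lap ((\<lambda>_. \<epsilon>) * (M + gam f f))"
    by (rule lap_cong) (simp add: Tf)
  also have "\<dots> = (\<lambda>_. \<epsilon>) * (lap M + lap (gam f f))"
    by (simp add: lap_mult lap_add gam_def)
  finally have lapTf: "lap (T f) = (\<lambda>_. \<epsilon>) * (lap M + lap (gam f f))" .
  have gM: "gam f M z = gam f (lap f) z + 2 * K z * gam f f z"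
    unfolding M by (simp add: gam_def XK YK algebra_simps)
  have "T M z = lap (T f) z + 2 * \<rho> z * lap f z + 2 * K z * T f z"
    unfolding M by (simp add: T_lap TK algebra_simps)
  also have "\<dots> = \<epsilon> * (lap M z + lap (gam f f) z + 2 * K z * lap f z + 2 * K z * (M z + gam f f z))"
    unfolding lapTf Tf[OF z] by (simp add: \<rho> algebra_simps)
  also have "\<dots> = \<epsilon> * (lap M z + 2 * gam f M z + (2 * ((hess11 f z)\<^sup>2 + 2 * (hess12 f z)\<^sup>2 + (hess22 f z)\<^sup>2)
      + 4 * K z * lap f z + 4 * (K z)\<^sup>2))"
    unfolding bochner[OF sf] gM by (simp add: M power2_eq_square algebra_simps)
  \<comment> \<open>The left side is 2|Hess f + Kg|^2. It splits into the squared trace M^2 and the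
    trace-free part, which is discarded.\<close>
  also have "2 * ((hess11 f z)\<^sup>2 + 2 * (hess12 f z)\<^sup>2 + (hess22 f z)\<^sup>2) + 4 * K z * lap f z + 4 * (K z)\<^sup>2
      = (M z)\<^sup>2 + (hess11 f z - hess22 f z)\<^sup>2 + 4 * (hess12 f z)\<^sup>2"
    by (simp add: M lap_eq_hess power2_eq_square algebra_simps)
  finally show "T M z \<ge> \<epsilon> * (lap M z + 2 * gam f M z + (M z)\<^sup>2)"
    using \<open>\<epsilon> \<ge> 0\<close> by (simp add: mult_left_mono)
qed

text \<open>At a spatial minimum \<nabla>M = 0, and differentiating the factor \<tau> adds
  \<epsilon>M, so T F \<ge> \<epsilon>M (1 + F). Both factors are negative when F < -1; at F = -1
  this bound would only give 0.\<close>

lemma curvature_harnack_barrier: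
  assumes z: "z \<in> D" and \<rho>: "\<rho> = (\<lambda>_. \<epsilon>) * K" and "\<epsilon> > 0" and pos: "\<And>z. z \<in> D \<Longrightarrow> K z > 0"
    and f: "f = (\<lambda>z. ln (2 * K z))" and F: "F = \<tau> * (\<lambda>_. \<epsilon>) * (lap f + K + K)"
    and "\<tau> z > 0" and Fz: "F z < -1"
    and X0: "X F z = 0" and Y0: "Y F z = 0" and L0: "lap F z \<ge> 0"
  shows "T F z > 0"
proof -
  define M where "M = lap f + K + K"
  have sf [simp]: "smooth_on D f" using X.smooth_ln[of "2 * K"] pos by (simp add: f)
  have sM [simp]: "smooth_on D M" by (simp add: M_def)
  note ev = log_curvature_evolution[OF z \<rho> less_imp_le[OF \<open>\<epsilon> > 0\<close>] pos f M_def]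
  have F: "F = \<tau> * (\<lambda>_. \<epsilon>) * M" by (simp add: F M_def)
  have "X M z = 0" "Y M z = 0" using X0 Y0 \<open>\<tau> z > 0\<close> \<open>\<epsilon> > 0\<close> by (simp_all add: F)
  then have "gam f M z = 0" by (simp add: gam_def)
  have "lap F z = \<tau> z * \<epsilon> * lap M z" by (simp add: F lap_def algebra_simps)
  moreover have "\<tau> z * \<epsilon> > 0" using \<open>\<tau> z > 0\<close> \<open>\<epsilon> > 0\<close> by simp
  ultimately have LM: "lap M z \<ge> 0"
    using L0 by (metis zero_le_mult_iff not_le)
  have "\<epsilon> * (M z)\<^sup>2 \<le> T M z"
    using ev(2) LM \<open>gam f M z = 0\<close> \<open>\<epsilon> > 0\<close> by (smt (verit) mult_left_mono)
  then have "\<epsilon> * \<tau> z * (\<epsilon> * (M z)\<^sup>2) \<le> \<epsilon> * \<tau> z * T M z"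
    using \<open>\<tau> z > 0\<close> \<open>\<epsilon> > 0\<close> by (intro mult_left_mono) auto
  moreover have "T F z = \<epsilon> * M z + \<epsilon> * \<tau> z * T M z"
    using T\<tau>[OF z] by (simp add: F)
  ultimately have "T F z \<ge> \<epsilon> * M z + \<epsilon> * \<tau> z * (\<epsilon> * (M z)\<^sup>2)" by simp
  also have "\<epsilon> * M z + \<epsilon> * \<tau> z * (\<epsilon> * (M z)\<^sup>2) = \<epsilon> * M z * (1 + F z)"
    by (simp add: F power2_eq_square algebra_simps)
  finally have 1: "T F z \<ge> \<epsilon> * M z * (1 + F z)" .
  have "\<tau> z * (\<epsilon> * M z) < 0" using Fz by (simp add: F mult.assoc)
  then have "\<epsilon> * M z < 0" using \<open>\<tau> z > 0\<close> by (simp add: mult_less_0_iff)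
  then have "\<epsilon> * M z * (1 + F z) > 0" using Fz by (intro mult_neg_neg) auto
  then show ?thesis using 1 by simp
qed

text \<open>The logarithm turns the term S ln S into the linear term u, at the price of
  |\<nabla>u|^2.\<close>

lemma log_solution:
  assumes sS [simp]: "smooth_on D S" and pos: "\<And>z. z \<in> D \<Longrightarrow> S z > 0"
    and eq: "\<And>z. z \<in> D \<Longrightarrow> T S z = lap S z - S z * ln (S z) + 2 * \<rho> z * S z"
    and u: "u = (\<lambda>z. ln (S z))"
  shows "smooth_on D u"
    and "X S = S * X u" and "Y S = S * Y u" and "T S = S * T u"
    and "lap S = S * (lap u + gam u u)"
    and "\<And>z. z \<in> D \<Longrightarrow> T u z = lap u z + gam u u z - u z + 2 * \<rho> z"
proof -
  show su [simp]: "smooth_on D u" using pos by (simp add: u)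
  have der: "\<delta> S = S * \<delta> u" if "derivation D \<delta>" for \<delta>
  proof -
    interpret d: derivation D \<delta> by fact
    have *: "\<delta> u = \<delta> S * (\<lambda>z. inverse (S z))"
      using d.ln[of S] pos by (simp add: u)
    show ?thesis
    proof
      fix z show "\<delta> S z = (S * \<delta> u) z"
        using pos[of z] d.zero_outside[of S z] by (cases "z \<in> D") (simp_all add: * field_simps)
    qed
  qed
  show XS: "X S = S * X u" and YS: "Y S = S * Y u" and TS: "T S = S * T u"
    by (rule der, unfold_locales)+
  show lapS: "lap S = S * (lap u + gam u u)"
    unfolding lap_def XS YS by (simp add: gam_def XS YS algebra_simps)
  show "T u z = lap u z + gam u u z - u z + 2 * \<rho> z" if "z \<in> D" for z
  proof -
    have "S z * T u z = S z * (lap u z + gam u u z - u z + 2 * \<rho> z)"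
      using eq[OF that] unfolding TS lapS by (simp add: u algebra_simps)
    then show ?thesis using pos[OF that] by simp
  qed
qed

text \<open>The term 2\<rho> is common to both equations and cancels, so the equation for h is free
  of curvature. It is derived from V = hS by the product rule instead of differentiating a
  quotient.\<close>

lemma ratio_solution:
  assumes sS [simp]: "smooth_on D S" and posS: "\<And>z. z \<in> D \<Longrightarrow> S z > 0"
    and eqS: "\<And>z. z \<in> D \<Longrightarrow> T S z = lap S z - S z * ln (S z) + 2 * \<rho> z * S z"
    and sV [simp]: "smooth_on D V" and posV: "\<And>z. z \<in> D \<Longrightarrow> V z > 0"
    and eqV: "\<And>z. z \<in> D \<Longrightarrow> T V z = lap V z - V z * ln (V z) + 2 * \<rho> z * V z"
    and u: "u = (\<lambda>z. ln (S z))" and h: "h = V * (\<lambda>z. inverse (S z))"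
  shows "smooth_on D h" and "z \<in> D \<Longrightarrow> T h z = lap h z + 2 * gam u h z - h z * ln (h z)"
proof -
  note S = log_solution[OF sS posS eqS u]
  have "smooth_on D (\<lambda>z. inverse (S z))" using posS by (intro X.smooth_inverse) (auto dest: posS)
  then show sh [simp]: "smooth_on D h" by (simp add: h)
  assume z: "z \<in> D"
  have V: "V x = (h * S) x" if "x \<in> D" for x using posS[OF that] by (simp add: h)
  have TV: "T V = T h * S + h * T S" using T.cong[of V "h * S", OF V] by simp
  have LV: "lap V = lap h * S + h * lap S + gam h S + gam h S" using lap_cong[of V "h * S", OF V] by (simp add: lap_mult)
  have "ln (V z) = ln (h z) + ln (S z)"
    using posV[OF z] posS[OF z] by (simp add: h ln_mult ln_inverse)
  then have "T h z * S z = (lap h z + 2 * gam u h z - h z * ln (h z)) * S z"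
    using eqV[OF z] unfolding TV LV plus_fun_apply times_fun_apply eqS[OF z] V[OF z]
    by (simp add: gam_def S(2,3) algebra_simps)
  then show "T h z = lap h z + 2 * gam u h z - h z * ln (h z)" using posS[OF z] by simp
qed

text \<open>Commute T with the Laplacian, insert the equation for u and use the Bochner formula. The
  terms in K, \<nabla>K and \<Delta>K stay separate because \<open>main_barrier\<close> completes
  them to a square with |\<nabla>u|^2.\<close>

lemma heat_quantity_evolution:
  assumes su [simp]: "smooth_on D u"
    and eq: "\<And>z. z \<in> D \<Longrightarrow> T u z = lap u z + gam u u z - u z + 2 * \<rho> z"
    and \<rho>: "\<rho> = (\<lambda>_. \<epsilon>) * K" and H: "H = lap u + \<rho> + \<rho>"
  shows "T H z = lap H z + 2 * gam u H z
    + 2 * ((hess11 u z)\<^sup>2 + 2 * (hess12 u z)\<^sup>2 + (hess22 u z)\<^sup>2)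
    + 2 * K z * gam u u z - 4 * \<epsilon> * gam u K z + 2 * \<epsilon>\<^sup>2 * lap K z + 4 * \<epsilon>\<^sup>2 * (K z)\<^sup>2
    - lap u z + 2 * \<epsilon> * K z * lap u z"
proof -
  have sH [simp]: "smooth_on D H" by (simp add: H)
  have "lap (T u) = lap (H + gam u u - u)"
    by (rule lap_cong) (simp add: eq H)
  also have "\<dots> = lap H + lap (gam u u) - lap u" by (simp add: lap_add lap_diff)
  finally have L: "lap (T u) = lap H + lap (gam u u) - lap u" .
  have lap\<rho>: "lap \<rho> = (\<lambda>_. \<epsilon>) * lap K" unfolding \<rho> by (simp add: lap_mult gam_def)
  have T\<rho>: "T \<rho> z = \<epsilon> * T K z" for z by (simp add: \<rho>)
  have TK: "T K z = 2 * \<epsilon> * (K z)\<^sup>2 + \<epsilon> * lap K z"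
    unfolding T_K lap\<rho> by (simp add: \<rho> power2_eq_square)
  have gH: "gam u H z = gam u (lap u) z + 2 * \<epsilon> * gam u K z"
    by (simp add: H gam_def \<rho> algebra_simps)
  have "T H z = lap (T u) z + 2 * \<rho> z * lap u z + 2 * T \<rho> z"
    unfolding H by (simp add: T_lap)
  also have "\<dots> = lap H z + lap (gam u u) z - lap u z + 2 * \<rho> z * lap u z
      + 2 * \<epsilon> * (2 * \<epsilon> * (K z)\<^sup>2 + \<epsilon> * lap K z)"
    unfolding L T\<rho> TK by simp
  finally show ?thesis
    unfolding bochner[OF su] gH by (simp add: \<rho> power2_eq_square algebra_simps)
qed

text \<open>The term discarded in the inequality is \<open>2 |Hess h + 2h dh \<otimes> dh / (1 - h\<^sup>2)|\<^sup>2 / (1 - h\<^sup>2)\<close>.\<close>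

lemma ratio_gradient_evolution:
  assumes z: "z \<in> D" and su [simp]: "smooth_on D u" and sh [simp]: "smooth_on D h"
    and h0: "\<And>z. z \<in> D \<Longrightarrow> 0 < h z" and h1: "\<And>z. z \<in> D \<Longrightarrow> h z < 1"
    and eq: "\<And>z. z \<in> D \<Longrightarrow> T h z = lap h z + 2 * gam u h z - h z * ln (h z)"
    and \<rho>: "\<rho> = (\<lambda>_. \<epsilon>) * K"
    and P: "P = gam h h * (\<lambda>z. inverse ((1 - h * h) z))"
  shows "smooth_on D P" and "P z * (1 - (h z)\<^sup>2) = (X h z)\<^sup>2 + (Y h z)\<^sup>2"
    and "T P z \<le> lap P z + 2 * gam u P z - 2 * (P z)\<^sup>2 + 2 * (\<epsilon> - 1) * K z * P z
      + 4 * (hess11 u z * (X h z)\<^sup>2 + 2 * hess12 u z * X h z * Y h z + hess22 u z * (Y h z)\<^sup>2)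
          / (1 - (h z)\<^sup>2)
      - 2 * P z * (1 + ln (h z) / (1 - (h z)\<^sup>2))"
proof -
  define E where "E = 1 - h * h"
  have E: "E z > 0" if "z \<in> D" for z
    using mult_strict_mono[of "h z" 1 "h z" 1] h0[OF that] h1[OF that] by (simp add: E_def)
  have sE [simp]: "smooth_on D E" by (simp add: E_def)
  have "smooth_on D (\<lambda>z. inverse (E z))" using E by (intro X.smooth_inverse) (auto dest: E)
  then show sP [simp]: "smooth_on D P" by (simp add: P E_def)
  define N where "N = gam h h"
  have sN [simp]: "smooth_on D N" by (simp add: N_def)
  \<comment> \<open>The derivatives of P are read off from |\<nabla>h|^2 = P (1 - h^2), where the
    product rule gives polynomial expressions.\<close>
  have N: "N x = (P * E) x" if "x \<in> D" for x
    using E[OF that] by (simp add: P N_def E_def)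
  have Ez: "E z = 1 - (h z)\<^sup>2" by (simp add: E_def power2_eq_square)
  have Nz: "N z = (X h z)\<^sup>2 + (Y h z)\<^sup>2" by (simp add: N_def gam_def power2_eq_square)
  show PD: "P z * (1 - (h z)\<^sup>2) = (X h z)\<^sup>2 + (Y h z)\<^sup>2"
    using N[OF z] by (simp add: Ez Nz)
  have XN: "X N z = X P z * E z - 2 * P z * h z * X h z"
    using fun_cong[OF X.cong[of N "P * E", OF N], of z] by (simp add: E_def algebra_simps)
  have YN: "Y N z = Y P z * E z - 2 * P z * h z * Y h z"
    using fun_cong[OF Y.cong[of N "P * E", OF N], of z] by (simp add: E_def algebra_simps)
  have TN: "T N z = T P z * E z - 2 * P z * h z * T h z"
    using fun_cong[OF T.cong[of N "P * E", OF N], of z] by (simp add: E_def algebra_simps)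
  have LE: "lap E z = - 2 * h z * lap h z - 2 * N z"
    by (simp add: E_def lap_diff lap_mult N_def) (simp add: lap_def)
  have LN: "lap N z = lap P z * E z + P z * (- 2 * h z * lap h z - 2 * N z)
      - 4 * h z * (X P z * X h z + Y P z * Y h z)"
    using fun_cong[OF lap_cong[of N "P * E", OF N], of z]
    by (simp add: lap_mult LE) (simp add: gam_def E_def algebra_simps)
  have XN': "X N z = 2 * (hess11 h z * X h z + hess12 h z * Y h z)"
    by (simp add: N_def gam_def hess11_def hess12_def XY algebra_simps)
  have YN': "Y N z = 2 * (hess12 h z * X h z + hess22 h z * Y h z)"
    by (simp add: N_def gam_def hess22_def hess12_def XY algebra_simps)
  define B where "B = hess11 u z * (X h z)\<^sup>2 + 2 * hess12 u z * X h z * Y h z + hess22 u z * (Y h z)\<^sup>2"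
  \<comment> \<open>The equation for h is differentiated by X and by Y at once (\<open>c\<close>),
    using d(h ln h) = (1 + ln h) dh.\<close>
  have gln: "gam h (T h) z = gam h (lap h) z + 2 * gam h (gam u h) z - (1 + ln (h z)) * N z"
  proof -
    have sl: "smooth_on D (\<lambda>z. ln (h z))" using h0 by simp
    have c: "\<delta> (T h) z = \<delta> (lap h) z + 2 * \<delta> (gam u h) z - (1 + ln (h z)) * \<delta> h z"
      if "derivation D \<delta>" for \<delta>
    proof -
      interpret d: derivation D \<delta> by fact
      have "\<delta> (T h) = \<delta> (lap h + 2 * gam u h - h * (\<lambda>z. ln (h z)))"
        by (rule d.cong) (simp add: eq)
      also have "\<dots> = \<delta> (lap h) + 2 * \<delta> (gam u h) - (\<delta> h * (\<lambda>z. ln (h z)) + h * (\<delta> h * (\<lambda>z. inverse (h z))))"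
        using sl h0 by simp
      finally have *: "\<delta> (T h) = \<dots>" .
      have 2: "\<delta> (T h) z = \<delta> (lap h) z + 2 * \<delta> (gam u h) z
          - (\<delta> h z * ln (h z) + h z * (\<delta> h z * inverse (h z)))"
        using fun_cong[OF *, of z] by simp
      have 3: "h z * (\<delta> h z * inverse (h z)) = \<delta> h z" using h0[OF z] by simp
      show ?thesis unfolding 2 3 by (simp add: algebra_simps)
    qed
    have "gam h (T h) z = X h z * X (T h) z + Y h z * Y (T h) z" by (simp add: gam_def)
    also have "\<dots> = gam h (lap h) z + 2 * gam h (gam u h) z - (1 + ln (h z)) * N z"
      unfolding c[OF X.derivation_axioms] c[OF Y.derivation_axioms]
      by (simp add: gam_def N_def algebra_simps)
    finally show ?thesis .
  qed
  have "T N z = 2 * gam h (T h) z + 2 * \<rho> z * N z"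
    unfolding N_def by (simp add: T_gam gam_commute[of "T h"])
  also have "\<dots> = 2 * gam h (lap h) z + 2 * (2 * gam h (gam u h) z) - 2 * (1 + ln (h z)) * N z + 2 * \<rho> z * N z"
    unfolding gln by (simp add: algebra_simps)
  also have "2 * gam h (gam u h) z = 2 * B + gam u N z"
    unfolding gam_gam_mixed[OF su sh] N_def B_def by simp
  also have "2 * gam h (lap h) z = lap N z - 2 * ((hess11 h z)\<^sup>2 + 2 * (hess12 h z)\<^sup>2 + (hess22 h z)\<^sup>2) - 2 * K z * N z"
    unfolding N_def bochner[OF sh] by simp
  finally have TN': "T N z = lap N z - 2 * ((hess11 h z)\<^sup>2 + 2 * (hess12 h z)\<^sup>2 + (hess22 h z)\<^sup>2)
     + 2 * (\<epsilon> - 1) * K z * N z + 4 * B + 2 * gam u N z - 2 * (1 + ln (h z)) * N z"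
    by (simp add: \<rho> algebra_simps)
  have gN: "gam u N z = gam u P z * E z - 2 * P z * h z * gam u h z"
    by (simp add: gam_def XN YN algebra_simps)
  have NP: "N z = P z * E z" using N[OF z] by simp
  define Q where "Q = X P z * X h z + Y P z * Y h z"
  define A where "A = hess11 h z * (X h z)\<^sup>2 + 2 * hess12 h z * X h z * Y h z + hess22 h z * (Y h z)\<^sup>2"
  \<comment> \<open>The gradient of |\<nabla>h|^2 is known in two ways, through P (1 - h^2) and
    through Hess h. Pairing both with \<nabla>h expresses <\<nabla>P, \<nabla>h> by the
    Hessian.\<close>
  have QA: "Q * E z = 2 * A + 2 * P z * h z * N z"
  proof -
    have 1: "X P z * E z = 2 * (hess11 h z * X h z + hess12 h z * Y h z) + 2 * P z * h z * X h z"
      and 2: "Y P z * E z = 2 * (hess12 h z * X h z + hess22 h z * Y h z) + 2 * P z * h z * Y h z"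
      using XN YN XN' YN' by linarith+
    have "Q * E z = (X P z * E z) * X h z + (Y P z * E z) * Y h z"
      unfolding Q_def by (simp add: algebra_simps)
    then show ?thesis unfolding 1 2 by (simp add: A_def Nz power2_eq_square algebra_simps)
  qed
  have key: "T P z * E z = (lap P z + 2 * gam u P z - 2 * (P z)\<^sup>2 + 2 * (\<epsilon> - 1) * K z * P z) * E z
      + 4 * B - 2 * P z * (E z + ln (h z))
      - (2 * ((hess11 h z)\<^sup>2 + 2 * (hess12 h z)\<^sup>2 + (hess22 h z)\<^sup>2) + 4 * h z * Q)"
  proof -
    have "T P z * E z = T N z + 2 * P z * h z * (lap h z + 2 * gam u h z - h z * ln (h z))"
      using TN eq[OF z] by simp
    also have "\<dots> = (lap P z + 2 * gam u P z - 2 * (P z)\<^sup>2 + 2 * (\<epsilon> - 1) * K z * P z) * E z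
      + 4 * B - 2 * P z * (E z + E z * ln (h z) + (h z)\<^sup>2 * ln (h z))
      - (2 * ((hess11 h z)\<^sup>2 + 2 * (hess12 h z)\<^sup>2 + (hess22 h z)\<^sup>2) + 4 * h z * Q)"
      unfolding TN' LN gN NP Q_def[symmetric] by (simp add: power2_eq_square algebra_simps)
    also have "E z + E z * ln (h z) + (h z)\<^sup>2 * ln (h z) = E z + ln (h z)"
      by (simp add: Ez algebra_simps)
    finally show ?thesis .
  qed
  \<comment> \<open>After multiplication by (1 - h^2)^2 and elimination of Q by \<open>QA\<close>,
    this is 2|(1 - h^2) Hess h + 2h dh \<otimes> dh|^2.\<close>
  have "0 \<le> 2 * ((hess11 h z)\<^sup>2 + 2 * (hess12 h z)\<^sup>2 + (hess22 h z)\<^sup>2) + 4 * h z * Q"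
  proof -
    have "E z * E z * (2 * ((hess11 h z)\<^sup>2 + 2 * (hess12 h z)\<^sup>2 + (hess22 h z)\<^sup>2) + 4 * h z * Q)
      = 2 * E z * E z * ((hess11 h z)\<^sup>2 + 2 * (hess12 h z)\<^sup>2 + (hess22 h z)\<^sup>2) + 4 * h z * E z * (Q * E z)"
      by (simp add: algebra_simps)
    also have "\<dots> = 2 * E z * E z * ((hess11 h z)\<^sup>2 + 2 * (hess12 h z)\<^sup>2 + (hess22 h z)\<^sup>2) + 8 * h z * E z * A
       + 8 * (h z)\<^sup>2 * (P z * E z) * N z"
      unfolding QA by (simp add: algebra_simps power2_eq_square)
    also have "\<dots> = 2 * ((E z * hess11 h z + 2 * h z * (X h z)\<^sup>2)\<^sup>2
      + 2 * (E z * hess12 h z + 2 * h z * X h z * Y h z)\<^sup>2 + (E z * hess22 h z + 2 * h z * (Y h z)\<^sup>2)\<^sup>2)"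
      unfolding NP[symmetric] A_def Nz by (simp add: algebra_simps power2_eq_square)
    also have "\<dots> \<ge> 0" by simp
    finally show ?thesis
      by (rule zero_le_mult_pos[rotated]) (simp add: E[OF z])
  qed
  then have "T P z * E z \<le> (lap P z + 2 * gam u P z - 2 * (P z)\<^sup>2 + 2 * (\<epsilon> - 1) * K z * P z) * E z
      + 4 * B - 2 * P z * (E z + ln (h z))"
    using key by linarith
  also have "\<dots> = (lap P z + 2 * gam u P z - 2 * (P z)\<^sup>2 + 2 * (\<epsilon> - 1) * K z * P z
      + 4 * B / E z - 2 * P z * (1 + ln (h z) / E z)) * E z"
    using E[OF z] by (simp add: field_simps)
  finally show "T P z \<le> lap P z + 2 * gam u P z - 2 * (P z)\<^sup>2 + 2 * (\<epsilon> - 1) * K z * P z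
      + 4 * (hess11 u z * (X h z)\<^sup>2 + 2 * hess12 u z * X h z * Y h z + hess22 u z * (Y h z)\<^sup>2)
          / (1 - (h z)\<^sup>2)
      - 2 * P z * (1 + ln (h z) / (1 - (h z)\<^sup>2))"
    using E[OF z] unfolding B_def[symmetric] Ez[symmetric] by simp
qed

end

text \<open>The derivative has the sign of 1/x^2 - 1 + 2 ln x, which is nonnegative by ln y \<le> y
  - 1 at y = 1/x^2. This makes h = c0 the worst case in the main estimate.\<close>

lemma ln_over_one_minus_square_mono:
  fixes c h :: real
  assumes "0 < c" "c \<le> h" "h < 1"
  shows "ln c / (1 - c\<^sup>2) \<le> ln h / (1 - h\<^sup>2)"
proof (rule DERIV_nonneg_imp_nondecreasing[OF \<open>c \<le> h\<close>])
  fix x assume x: "c \<le> x" "x \<le> h"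
  then have x01: "0 < x" "x < 1" using assms by auto
  then have x2: "x\<^sup>2 < 1" "0 < x\<^sup>2" by (simp_all add: power_less_one_iff)
  let ?d = "((1 / x) * (1 - x\<^sup>2) - ln x * (- (2 * x))) / (1 - x\<^sup>2)\<^sup>2"
  have "((\<lambda>x. ln x / (1 - x\<^sup>2)) has_real_derivative ?d) (at x)"
    using x01 x2 by (auto intro!: derivative_eq_intros simp: power2_eq_square)
  moreover have "?d \<ge> 0"
  proof -
    have "ln (1 / x\<^sup>2) \<le> 1 / x\<^sup>2 - 1" using x2 by (intro ln_le_minus_one) simp
    also have "ln (1 / x\<^sup>2) = - 2 * ln x" using x01 by (simp add: ln_div ln_realpow)
    finally have "0 \<le> x * (1 / x\<^sup>2 - 1 + 2 * ln x)" using x01 by simp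
    also have "\<dots> = (1 / x) * (1 - x\<^sup>2) - ln x * (- (2 * x))"
      using x01 by (simp add: field_simps power2_eq_square)
    finally show ?thesis by simp
  qed
  ultimately show "\<exists>y. ((\<lambda>x. ln x / (1 - x\<^sup>2)) has_real_derivative y) (at x) \<and> 0 \<le> y" by blast
qed

context evolving_frame
begin

lemma main_barrier:
  assumes z: "z \<in> D" and su [simp]: "smooth_on D u" and sh [simp]: "smooth_on D h"
    and equ: "\<And>z. z \<in> D \<Longrightarrow> T u z = lap u z + gam u u z - u z + 2 * \<rho> z"
    and eqh: "\<And>z. z \<in> D \<Longrightarrow> T h z = lap h z + 2 * gam u h z - h z * ln (h z)"
    and c: "0 < c" "c < 1"
    and h0: "\<And>z. z \<in> D \<Longrightarrow> c < h z" and h1: "\<And>z. z \<in> D \<Longrightarrow> h z < 1"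
    and \<rho>: "\<rho> = (\<lambda>_. \<epsilon>) * K" and "\<epsilon> \<ge> 0"
    and pos: "\<And>z. z \<in> D \<Longrightarrow> K z > 0"
    and Kz: "2 * K z \<ge> - (2 * ln c) / (1 - c\<^sup>2) - 1"
    and f: "f = (\<lambda>z. ln (2 * K z))" and harnack: "\<tau> z * (\<epsilon> * (lap f + K + K) z) \<ge> -1"
    and P: "P = gam h h * (\<lambda>z. inverse ((1 - h * h) z))"
    and F: "F = \<tau> * (lap u + \<rho> + \<rho> - P)"
    and "\<tau> z > 0" and Fz: "F z = -1"
    and X0: "X F z = 0" and Y0: "Y F z = 0" and L0: "lap F z \<ge> 0"
  shows "T F z > 0"
proof -
  define H where "H = lap u + \<rho> + \<rho>"
  define M where "M = lap f + K + K"
  define t where "t = \<tau> z"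
  have "t > 0" using \<open>\<tau> z > 0\<close> by (simp add: t_def)
  have h0': "0 < h z" if "z \<in> D" for z using h0[OF that] c by simp
  have sH [simp]: "smooth_on D H" by (simp add: H_def)
  note Pev = ratio_gradient_evolution[OF z su sh h0' h1 eqh \<rho> P]
  note Hev = heat_quantity_evolution[OF su equ \<rho> H_def, of z]
  note Mev = log_curvature_evolution[OF z \<rho> \<open>\<epsilon> \<ge> 0\<close> pos f M_def]
  have sP [simp]: "smooth_on D P" by (rule Pev(1))
  have F: "F = \<tau> * (H - P)" by (simp add: F H_def)
  have HP: "H z - P z = - 1 / t" using Fz \<open>t > 0\<close> by (simp add: F t_def field_simps)
  have X0: "X H z = X P z" and Y0: "Y H z = Y P z"
    using X0 Y0 \<open>\<tau> z > 0\<close> by (simp_all add: F)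
  then have gHP: "gam u H z = gam u P z" by (simp add: gam_def)
  have "lap F z = \<tau> z * (lap H z - lap P z)"
    by (simp add: F lap_diff lap_mult) (simp add: lap_def gam_def)
  then have LHP: "lap H z \<ge> lap P z" using L0 \<open>\<tau> z > 0\<close> by (simp add: zero_le_mult_iff)
  define E where "E = 1 - (h z)\<^sup>2"
  have E: "E > 0" using h0'[OF z] h1[OF z] by (simp add: E_def power_less_one_iff)
  define R where "R = 2 * K z"
  define B where "B = hess11 u z * (X h z)\<^sup>2 + 2 * hess12 u z * X h z * Y h z + hess22 u z * (Y h z)\<^sup>2"
  define W where "W = 2 * ((hess11 u z)\<^sup>2 + 2 * (hess12 u z)\<^sup>2 + (hess22 u z)\<^sup>2)"
  have "R > 0" using pos[OF z] by (simp add: R_def)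
  have "P z \<ge> 0" using Pev(2) E by (metis E_def sum_power2_ge_zero zero_le_mult_iff not_le)
  \<comment> \<open>Completing the square gives R|\<nabla>u - \<epsilon>\<nabla> ln R|^2 +
    \<epsilon>R (\<epsilon>M); the first summand is dropped and the trace Harnack bound is applied
    to the second.\<close>
  have curv: "2 * K z * gam u u z - 4 * \<epsilon> * gam u K z + 2 * \<epsilon>\<^sup>2 * lap K z + 4 * \<epsilon>\<^sup>2 * (K z)\<^sup>2 \<ge> - \<epsilon> * R / t"
  proof -
    have gK: "gam u K z = K z * gam u f z" unfolding gam_def by (simp add: Mev(4,5) algebra_simps)
    have lK: "lap K z = K z * (M z - 2 * K z) + K z * gam f f z" using Mev(3) by simp
    have "2 * K z * gam u u z - 4 * \<epsilon> * gam u K z + 2 * \<epsilon>\<^sup>2 * lap K z + 4 * \<epsilon>\<^sup>2 * (K z)\<^sup>2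
      = R * (gam u u z - 2 * \<epsilon> * gam u f z + \<epsilon>\<^sup>2 * gam f f z) + \<epsilon> * R * (\<epsilon> * M z)"
      unfolding gK lK by (simp add: R_def power2_eq_square algebra_simps)
    also have "gam u u z - 2 * \<epsilon> * gam u f z + \<epsilon>\<^sup>2 * gam f f z
        = (X u z - \<epsilon> * X f z)\<^sup>2 + (Y u z - \<epsilon> * Y f z)\<^sup>2"
      by (simp add: gam_def power2_eq_square algebra_simps)
    finally have 1: "2 * K z * gam u u z - 4 * \<epsilon> * gam u K z + 2 * \<epsilon>\<^sup>2 * lap K z + 4 * \<epsilon>\<^sup>2 * (K z)\<^sup>2
      \<ge> \<epsilon> * R * (\<epsilon> * M z)" using \<open>R > 0\<close> by simp
    have "t * (\<epsilon> * M z) \<ge> -1" using harnack unfolding M_def t_def .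
    then have "\<epsilon> * M z \<ge> -1 / t" using \<open>t > 0\<close> by (simp add: field_simps)
    then have "\<epsilon> * R * (\<epsilon> * M z) \<ge> \<epsilon> * R * (-1 / t)"
      using \<open>\<epsilon> \<ge> 0\<close> \<open>R > 0\<close> by (intro mult_left_mono) auto
    then show ?thesis using 1 by simp
  qed
  define \<Lambda> where "\<Lambda> = lap u z"
  have \<Lambda>: "\<Lambda> = P z - 1 / t - \<epsilon> * R"
    using HP by (simp add: \<Lambda>_def R_def H_def \<rho>)
  \<comment> \<open>This is \<open>hessian_square_ge\<close> with k = \<epsilon>R, d = 1 - h^2 and v
    = \<nabla>h. It absorbs the indefinite term in Hess u.\<close>
  have hs: "W + 2 * (\<epsilon> * R) * \<Lambda> + (\<epsilon> * R)\<^sup>2 + 2 * (P z)\<^sup>2 - 2 * (\<epsilon> * R) * P z - 4 * B / E \<ge> (\<Lambda> + \<epsilon> * R - P z)\<^sup>2"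
    unfolding W_def B_def \<Lambda>_def lap_eq_hess
    by (rule hessian_square_ge) (use Pev(2) E in \<open>simp_all add: E_def\<close>)
  have T1: "T H z \<ge> lap H z + 2 * gam u H z + W - \<epsilon> * R / t - \<Lambda> + \<epsilon> * R * \<Lambda>"
    using Hev curv unfolding W_def[symmetric] \<Lambda>_def[symmetric] by (simp add: R_def)
  have T2: "T P z \<le> lap P z + 2 * gam u P z - 2 * (P z)\<^sup>2 + (\<epsilon> - 1) * R * P z
      + 4 * B / E - 2 * P z * (1 + ln (h z) / E)"
    using Pev(3) unfolding B_def[symmetric] E_def[symmetric] by (simp add: R_def algebra_simps)
  \<comment> \<open>The trace of the completed square is H - P, hence -1/t here. Multiplied by t,
    its square will compensate the summand H - P that comes from differentiating \<tau>.\<close>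
  have "(\<Lambda> + \<epsilon> * R - P z)\<^sup>2 = 1 / t\<^sup>2" unfolding \<Lambda> by (simp add: power_divide)
  then have "T H z - T P z \<ge> 1 / t\<^sup>2 - 2 * (\<epsilon> * R) * \<Lambda> - (\<epsilon> * R)\<^sup>2 + 2 * (\<epsilon> * R) * P z
      - \<epsilon> * R / t - \<Lambda> + \<epsilon> * R * \<Lambda> - (\<epsilon> - 1) * R * P z + 2 * P z * (1 + ln (h z) / E)"
    using T1 T2 hs LHP gHP by linarith
  \<comment> \<open>The multiples of \<epsilon>R/t cancel exactly. The factor of P is the bracket
    controlled by the curvature hypothesis, and 1/t supplies strictness.\<close>
  also have "1 / t\<^sup>2 - 2 * (\<epsilon> * R) * \<Lambda> - (\<epsilon> * R)\<^sup>2 + 2 * (\<epsilon> * R) * P z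
      - \<epsilon> * R / t - \<Lambda> + \<epsilon> * R * \<Lambda> - (\<epsilon> - 1) * R * P z + 2 * P z * (1 + ln (h z) / E)
     = 1 / t\<^sup>2 + P z * (R + 1 + 2 * (ln (h z) / E)) + 1 / t + \<epsilon> * R"
    unfolding \<Lambda> by (simp add: algebra_simps power2_eq_square)
  finally have T3: "T H z - T P z \<ge> 1 / t\<^sup>2 + P z * (R + 1 + 2 * (ln (h z) / E)) + 1 / t + \<epsilon> * R" .
  have "ln c / (1 - c\<^sup>2) \<le> ln (h z) / E"
    unfolding E_def using c h0[OF z] h1[OF z] by (intro ln_over_one_minus_square_mono) auto
  moreover have "R \<ge> - 2 * (ln c / (1 - c\<^sup>2)) - 1" using Kz by (simp add: R_def)
  ultimately have "R + 1 + 2 * (ln (h z) / E) \<ge> 0" by linarith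
  then have "P z * (R + 1 + 2 * (ln (h z) / E)) \<ge> 0" using \<open>P z \<ge> 0\<close> by simp
  moreover have "\<epsilon> * R \<ge> 0" using \<open>\<epsilon> \<ge> 0\<close> \<open>R > 0\<close> by simp
  moreover have "1 / t > 0" using \<open>t > 0\<close> by simp
  ultimately have "T H z - T P z > 1 / t\<^sup>2" using T3 by linarith
  then have "t * (T H z - T P z) > t * (1 / t\<^sup>2)" using \<open>t > 0\<close> by (intro mult_strict_left_mono)
  moreover have "T F z = H z - P z + t * (T H z - T P z)" by (simp add: F T\<tau>[OF z] t_def)
  ultimately show ?thesis using HP \<open>t > 0\<close> by (simp add: power2_eq_square)
qed

end

section \<open>The frame of a metric in a chart\<close>

text \<open>The metric is \<open>(a dx + b dy)\<^sup>2 + (c dy)\<^sup>2\<close>; \<open>w1\<close>, \<open>w2\<close> are the components of the connection form.\<close>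

locale coframe =
  d0: derivation D d0 + d1: derivation D d1 + d2: derivation D d2
  for D :: "'z::euclidean_space set" and d0 d1 d2 +
  fixes a b c \<rho> \<tau> :: "'z \<Rightarrow> real"
  assumes d01: "smooth_on D f \<Longrightarrow> d0 (d1 f) = d1 (d0 f)"
    and d02: "smooth_on D f \<Longrightarrow> d0 (d2 f) = d2 (d0 f)"
    and d12: "smooth_on D f \<Longrightarrow> d1 (d2 f) = d2 (d1 f)"
    and smooth_a [simp]: "smooth_on D a" and smooth_b [simp]: "smooth_on D b"
    and smooth_c [simp]: "smooth_on D c"
    and a_pos: "z \<in> D \<Longrightarrow> a z > 0" and c_pos: "z \<in> D \<Longrightarrow> c z > 0"
    and sm_\<rho> [simp]: "smooth_on D \<rho>" and sm_\<tau> [simp]: "smooth_on D \<tau>"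
    and d0a: "z \<in> D \<Longrightarrow> d0 a z = - (\<rho> z * a z)"
    and d0b: "z \<in> D \<Longrightarrow> d0 b z = - (\<rho> z * b z)"
    and d0c: "z \<in> D \<Longrightarrow> d0 c z = - (\<rho> z * c z)"
    and d\<tau>: "z \<in> D \<Longrightarrow> d0 \<tau> z = 1" "d1 \<tau> = 0" "d2 \<tau> = 0"
begin

definition "ia = (\<lambda>z. inverse (a z))"
definition "ic = (\<lambda>z. inverse (c z))"
text \<open>Solution of the structure equations d\<theta>1 = \<omega> \<and> \<theta>2 and
  d\<theta>2 = -\<omega> \<and> \<theta>1 for \<theta>1 = a dx + b dy, \<theta>2 = c dy and \<omega>
  = w1 dx + w2 dy. Then \<open>p\<close> and \<open>q\<close> are the values \<omega>(X) and
  \<omega>(Y).\<close>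

definition "w1 = (d1 b - d2 a) * ic"
definition "w2 = (b * w1 + d1 c) * ia"
definition "p = w1 * ia"
definition "q = (w2 - b * p) * ic"
text \<open>The zero summand gives \<open>X\<close> the same shape as \<open>Y\<close>, so that
  \<open>derivation_combination\<close> applies to both.\<close>

definition "X f = ia * d1 f + 0 * d2 f"
definition "Y f = - (ic * b * ia) * d1 f + ic * d2 f"

lemma smooth_ia [simp]: "smooth_on D ia" and smooth_ic [simp]: "smooth_on D ic"
  unfolding ia_def ic_def by (auto intro!: d0.smooth_inverse dest: a_pos c_pos)

lemma smooth_w1 [simp]: "smooth_on D w1" and smooth_w2 [simp]: "smooth_on D w2"
  and smooth_p [simp]: "smooth_on D p" and smooth_q [simp]: "smooth_on D q"
  by (simp_all add: w1_def w2_def p_def q_def)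

lemma d_ia: "derivation D \<delta> \<Longrightarrow> \<delta> ia = - \<delta> a * ia * ia"
  unfolding ia_def by (rule derivation.inverse) (auto dest: a_pos)

lemma d_ic: "derivation D \<delta> \<Longrightarrow> \<delta> ic = - \<delta> c * ic * ic"
  unfolding ic_def by (rule derivation.inverse) (auto dest: c_pos)

lemmas d_inv [simp] =
  d_ia[OF d0.derivation_axioms] d_ia[OF d1.derivation_axioms] d_ia[OF d2.derivation_axioms]
  d_ic[OF d0.derivation_axioms] d_ic[OF d1.derivation_axioms] d_ic[OF d2.derivation_axioms]

lemma a_ia: "z \<in> D \<Longrightarrow> a z * ia z = 1" and c_ic: "z \<in> D \<Longrightarrow> c z * ic z = 1"
  using a_pos[of z] c_pos[of z] by (simp_all add: ia_def ic_def)

lemma derivation_X: "derivation D X" and derivation_Y: "derivation D Y"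
  unfolding X_def[abs_def] Y_def[abs_def]
  by (intro derivation_combination d1.derivation_axioms d2.derivation_axioms; simp)+

lemma XY: "smooth_on D f \<Longrightarrow> X (Y f) = Y (X f) - p * X f - q * Y f"
  by (simp add: X_def Y_def p_def q_def w1_def w2_def d12 algebra_simps)

text \<open>The evolution of a, b, c is given only at points of D. A derivation depends only on
  values on D, so these equations may still be differentiated.\<close>

lemma d_d0:
  assumes "derivation D \<delta>"
  shows "\<delta> (d0 a) = - (\<delta> \<rho> * a + \<rho> * \<delta> a)"
    and "\<delta> (d0 b) = - (\<delta> \<rho> * b + \<rho> * \<delta> b)"
    and "\<delta> (d0 c) = - (\<delta> \<rho> * c + \<rho> * \<delta> c)"
proof -
  interpret d: derivation D \<delta> by fact
  show "\<delta> (d0 a) = - (\<delta> \<rho> * a + \<rho> * \<delta> a)"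
    using d.cong[of "d0 a" "- (\<rho> * a)"] by (simp add: d0a)
  show "\<delta> (d0 b) = - (\<delta> \<rho> * b + \<rho> * \<delta> b)"
    using d.cong[of "d0 b" "- (\<rho> * b)"] by (simp add: d0b)
  show "\<delta> (d0 c) = - (\<delta> \<rho> * c + \<rho> * \<delta> c)"
    using d.cong[of "d0 c" "- (\<rho> * c)"] by (simp add: d0c)
qed

lemma d0_ia: "z \<in> D \<Longrightarrow> d0 ia z = \<rho> z * ia z" and d0_ic: "z \<in> D \<Longrightarrow> d0 ic z = \<rho> z * ic z"
  using a_ia[of z] c_ic[of z] by (simp_all add: d0a d0c)

text \<open>The connection form does not change when the coframe is scaled by a constant, so only
  derivatives of \<rho> survive: \<omega> evolves by (Y \<rho>) \<theta>1 - (X \<rho>) \<theta>2.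
  This is the dx component, and \<open>d0_w2\<close> the dy component.\<close>

lemma d0_w1: "z \<in> D \<Longrightarrow> d0 w1 z = (d2 \<rho> z * a z - d1 \<rho> z * b z) * ic z"
  unfolding w1_def
  by (simp del: d_inv add: d0_ic d01 d02 d_d0[OF d1.derivation_axioms] d_d0[OF d2.derivation_axioms]
      algebra_simps)

lemma d0_w2: "z \<in> D \<Longrightarrow> d0 w2 z = b z * Y \<rho> z - c z * X \<rho> z"
proof -
  assume z: "z \<in> D"
  have "d0 w2 z = (b z * d0 w1 z - d1 \<rho> z * c z) * ia z"
    unfolding w2_def using z
    by (simp del: d_inv add: d0_ia d01 d02 d0b d_d0[OF d1.derivation_axioms] algebra_simps)
  also have "\<dots> = b z * Y \<rho> z * (a z * ia z) - c z * X \<rho> z"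
    unfolding d0_w1[OF z] using a_ia[OF z] by (simp add: X_def Y_def algebra_simps)
  finally show ?thesis by (simp add: a_ia[OF z])
qed

text \<open>The factor \<delta> f vanishes off D, which turns an equation on D into one between
  functions.\<close>

lemma mult_zero_outside: "smooth_on D f \<Longrightarrow> derivation D \<delta> \<Longrightarrow> (\<And>z. z \<in> D \<Longrightarrow> g z = k z)
    \<Longrightarrow> g * \<delta> f = k * \<delta> f"
  using derivation.zero_outside by fastforce

lemma d0_X: "smooth_on D f \<Longrightarrow> d0 (X f) = X (d0 f) + \<rho> * X f"
proof -
  assume f: "smooth_on D f"
  have "d0 ia * d1 f = (\<rho> * ia) * d1 f"
    using f d1.derivation_axioms by (rule mult_zero_outside) (simp add: d0_ia del: d_inv)
  then show ?thesis
    using f by (simp add: X_def d01 algebra_simps del: d_inv)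
qed

lemma d0_Y: "smooth_on D f \<Longrightarrow> d0 (Y f) = Y (d0 f) + \<rho> * Y f"
proof -
  assume f: "smooth_on D f"
  have 1: "d0 (ic * b * ia) * d1 f = (\<rho> * (ic * b * ia)) * d1 f"
    using f d1.derivation_axioms
    by (rule mult_zero_outside) (simp add: d0_ia d0_ic d0b algebra_simps del: d_inv)
  have 2: "d0 ic * d2 f = (\<rho> * ic) * d2 f"
    using f d2.derivation_axioms by (rule mult_zero_outside) (simp add: d0_ic del: d_inv)
  have "d0 (Y f) = - (d0 (ic * b * ia) * d1 f) - (ic * b * ia) * d1 (d0 f) + d0 ic * d2 f + ic * d2 (d0 f)"
    using f unfolding Y_def by (simp add: d01 d02 algebra_simps del: d_inv)
  then show ?thesis unfolding 1 2 by (simp add: Y_def algebra_simps)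
qed

lemma w_zero_outside: "z \<notin> D \<Longrightarrow> w1 z = 0" "z \<notin> D \<Longrightarrow> w2 z = 0"
  by (simp_all add: w1_def w2_def d1.zero_outside d2.zero_outside)

lemma d0_p: "d0 p = \<rho> * p + Y \<rho>"
proof
  fix z show "d0 p z = (\<rho> * p + Y \<rho>) z"
  proof (cases "z \<in> D")
    case True
    have "d0 p z = (d2 \<rho> z * (a z * ia z) - d1 \<rho> z * b z * ia z) * ic z + \<rho> z * p z"
      unfolding p_def using True by (simp add: d0_w1 d0_ia del: d_inv) (simp add: algebra_simps)
    then show ?thesis unfolding a_ia[OF True] by (simp add: Y_def algebra_simps)
  next
    case False
    then show ?thesis
      by (simp add: d0.zero_outside p_def w_zero_outside derivation.zero_outside[OF derivation_Y])
  qed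
qed

lemma d0_q: "d0 q = \<rho> * q - X \<rho>"
proof
  fix z show "d0 q z = (\<rho> * q - X \<rho>) z"
  proof (cases "z \<in> D")
    case True
    have "d0 q z = - X \<rho> z * (c z * ic z) + \<rho> z * q z"
      unfolding q_def using True
      by (simp add: d0_w2 d0_p d0_ic d0b del: d_inv) (simp add: algebra_simps)
    then show ?thesis unfolding c_ic[OF True] by simp
  next
    case False
    then show ?thesis
      by (simp add: d0.zero_outside q_def p_def w_zero_outside derivation.zero_outside[OF derivation_X])
  qed
qed

sublocale evolving_frame D X Y d0 p q \<rho> \<tau>
proof (intro evolving_frame.intro evolving_frame_axioms.intro derivation_X derivation_Y d0.derivation_axioms)
  show "X \<tau> = 0" "Y \<tau> = 0" by (simp_all add: X_def Y_def d\<tau>)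
qed (simp_all add: XY d0_X d0_Y d0_p d0_q d\<tau>)

text \<open>
  \<open>Gm k i j\<close> is the \<open>k\<close>-th component of \<open>\<nabla>\<^sub>i \<partial>\<^sub>j\<close> for the connection with
  \<open>\<nabla>\<^sub>i e\<^sub>1 = w\<^sub>i e\<^sub>2\<close> and \<open>\<nabla>\<^sub>i e\<^sub>2 = - w\<^sub>i e\<^sub>1\<close>, where \<open>e\<close> is the frame dual to
  \<open>a dx + b dy\<close>, \<open>c dy\<close>. In this form the curvature is read off without using that the
  connection is torsion-free.
\<close>

definition dd :: "2 \<Rightarrow> ('z \<Rightarrow> real) \<Rightarrow> 'z \<Rightarrow> real" where
  "dd i = (if i = 1 then d1 else d2)"

definition ww :: "2 \<Rightarrow> 'z \<Rightarrow> real" where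
  "ww i = (if i = 1 then w1 else w2)"

definition Gm :: "2 \<Rightarrow> 2 \<Rightarrow> 2 \<Rightarrow> 'z \<Rightarrow> real" where
  "Gm k i j =
    (if j = 1 then (if k = 1 then dd i a * ia - b * ww i * ic else a * ww i * ic)
     else (if k = 1 then (dd i b - c * ww i) * ia - b * ia * ic * (b * ww i + dd i c)
           else (b * ww i + dd i c) * ic))"

lemma smooth_Gm [simp]: "smooth_on D (Gm k i j)"
  by (simp add: Gm_def dd_def ww_def)

text \<open>The structure equations solved for \<open>d2 a\<close> and \<open>d1 c\<close>.
  Eliminating these two derivatives is how vanishing torsion enters the algebra below.\<close>

lemma torsion_free:
  assumes "z \<in> D"
  shows "d2 a z = d1 b z - c z * w1 z" and "d1 c z = a z * w2 z - b z * w1 z"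
proof -
  have "c z * w1 z = (c z * ic z) * (d1 b z - d2 a z)" by (simp add: w1_def)
  then show "d2 a z = d1 b z - c z * w1 z" unfolding c_ic[OF assms] by simp
  have "a z * w2 z = (a z * ia z) * (b z * w1 z + d1 c z)" by (simp add: w2_def)
  then show "d1 c z = a z * w2 z - b z * w1 z" unfolding a_ia[OF assms] by simp
qed

text \<open>The second structure equation d\<omega> = -K \<theta>1 \<and> \<theta>2, where \<theta>1
  \<and> \<theta>2 = ac dx \<and> dy. The proof differentiates \<omega> = p \<theta>1 + q \<theta>2,
  that is w1 = ap and w2 = bp + cq.\<close>

lemma K_eq:
  assumes z: "z \<in> D"
  shows "K z * (a z * c z) = d2 w1 z - d1 w2 z"
proof -
  have w1: "w1 x = (a * p) x" if "x \<in> D" for x using a_ia[OF that] by (simp add: p_def)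
  have w2: "w2 x = (b * p + c * q) x" if "x \<in> D" for x
  proof -
    have "(c * q) x = (c x * ic x) * (w2 x - b x * p x)" by (simp add: q_def)
    then show ?thesis unfolding c_ic[OF that] by simp
  qed
  have 1: "d2 w1 = d2 a * p + a * d2 p" using d2.cong[of w1 "a * p", OF w1] by simp
  have 2: "d1 w2 = d1 b * p + b * d1 p + d1 c * q + c * d1 q"
    using d1.cong[of w2 "b * p + c * q", OF w2] by simp
  have "K z * (a z * c z) = - (a z * ia z) * c z * d1 q z + (c z * ic z) * (a z * d2 p z - b z * d1 p z * (a z * ia z))
      - ((p z)\<^sup>2 + (q z)\<^sup>2) * a z * c z"
    by (simp add: K_def X_def Y_def algebra_simps power2_eq_square)
  also have "\<dots> = d2 w1 z - d1 w2 z"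
    unfolding 1 2 a_ia[OF z] c_ic[OF z] plus_fun_apply times_fun_apply torsion_free[OF z] w1[OF z] w2[OF z]
    by (simp add: algebra_simps power2_eq_square)
  finally show ?thesis .
qed

definition ricci :: "2 \<Rightarrow> 2 \<Rightarrow> 'z \<Rightarrow> real" where
  "ricci j k z = (\<Sum>l\<in>UNIV. dd l (Gm l j k) z - dd j (Gm l l k) z
     + (\<Sum>m\<in>UNIV. Gm l l m z * Gm m j k z - Gm l j m z * Gm m l k z))"

text \<open>The right-hand sides are K times the metric components, as Ric = Kg in dimension two.
  Mixed second derivatives of a, b, c cancel by \<open>d12\<close>, leaving the curvature of
  \<omega>.\<close>

lemma ricci_eq:
  assumes z: "z \<in> D"
  shows "ricci 1 1 z = K z * (a z)\<^sup>2" "ricci 1 2 z = K z * (a z * b z)"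
    "ricci 2 1 z = K z * (a z * b z)" "ricci 2 2 z = K z * ((b z)\<^sup>2 + (c z)\<^sup>2)"
proof -
  have K: "K z = (d2 w1 z - d1 w2 z) * ia z * ic z"
    using K_eq[OF z] a_ia[OF z] c_ic[OF z] a_pos[OF z] c_pos[OF z]
    by (simp add: ia_def ic_def field_simps)
  have nz: "a z \<noteq> 0" "c z \<noteq> 0" using a_pos[OF z] c_pos[OF z] by simp_all
  have i: "ia z = 1 / a z" "ic z = 1 / c z" by (simp_all add: ia_def ic_def field_simps)
  show "ricci 1 1 z = K z * (a z)\<^sup>2"
    by (simp add: ricci_def sum_2 Gm_def dd_def ww_def d12 K) (simp add: i nz field_simps power2_eq_square)
  show "ricci 1 2 z = K z * (a z * b z)"
    by (simp add: ricci_def sum_2 Gm_def dd_def ww_def d12 K) (simp add: i nz field_simps power2_eq_square)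
  show "ricci 2 1 z = K z * (a z * b z)"
    by (simp add: ricci_def sum_2 Gm_def dd_def ww_def d12 K) (simp add: i nz field_simps power2_eq_square)
  show "ricci 2 2 z = K z * ((b z)\<^sup>2 + (c z)\<^sup>2)"
    by (simp add: ricci_def sum_2 Gm_def dd_def ww_def d12 K) (simp add: i nz field_simps power2_eq_square)
qed

end

section \<open>The time interval and derivatives on space-time domains\<close>

lemma time_intervalI: "0 \<le> t \<Longrightarrow> t \<le> s \<Longrightarrow> s \<in> time_interval \<kappa> \<Longrightarrow> t \<in> time_interval \<kappa>"
  unfolding time_interval_def by (auto intro: le_less_trans[of "ereal t" "ereal s"])

lemma time_interval_right:
  assumes "t \<in> time_interval \<kappa>" "e > 0"
  obtains s where "t < s" "s < t + e" "s \<in> time_interval \<kappa>"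
proof -
  have "ereal t < min \<kappa> (ereal (t + e))" using assms by (auto simp: time_interval_def)
  then obtain s where "ereal t < ereal s" "ereal s < min \<kappa> (ereal (t + e))"
    using ereal_dense2 by blast
  then show thesis using that assms by (auto simp: time_interval_def)
qed

lemma time_interval_interior:
  assumes "t \<in> time_interval \<kappa>" "0 < t"
  shows "t \<in> interior (time_interval \<kappa>)"
proof -
  obtain s where s: "t < s" "s \<in> time_interval \<kappa>" using time_interval_right[OF assms(1) zero_less_one] by blast
  have "{0<..<s} \<subseteq> time_interval \<kappa>" using time_intervalI[OF _ _ s(2)] by auto
  then show ?thesis using s(1) assms(2) by (intro interiorI[of "{0<..<s}"]) auto
qed

lemma accessible_time_interval: "accessible (time_interval \<kappa>)"
  unfolding accessible_def
proof (intro ballI allI impI)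
  fix t b e :: real assume t: "t \<in> time_interval \<kappa>" and b: "b \<in> Basis" and "e > 0"
  obtain s where "t < s" "s < t + e" "s \<in> time_interval \<kappa>"
    using time_interval_right[OF t \<open>e > 0\<close>] by blast
  then show "\<exists>d. 0 < \<bar>d\<bar> \<and> \<bar>d\<bar> < e \<and> t + d *\<^sub>R b \<in> time_interval \<kappa>"
    using b by (intro exI[of _ "s - t"]) auto
qed

lemma accessible_open: "open V \<Longrightarrow> accessible V"
  unfolding accessible_def
proof (intro ballI allI impI)
  fix x b :: 'a and e :: real assume V: "open V" and x: "x \<in> V" and b: "b \<in> Basis" and "e > 0"
  obtain d where "d > 0" and d: "ball x d \<subseteq> V" using V x open_contains_ball by blast
  define s where "s = min d e / 2"
  have "0 < s" "s < d" "s < e" using \<open>d > 0\<close> \<open>e > 0\<close> by (auto simp: s_def)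
  then have "x + s *\<^sub>R b \<in> ball x d" using b by (simp add: dist_norm)
  then show "\<exists>d. 0 < \<bar>d\<bar> \<and> \<bar>d\<bar> < e \<and> x + d *\<^sub>R b \<in> V"
    using d \<open>0 < s\<close> \<open>s < e\<close> by (intro exI[of _ s]) auto
qed

lemma accessible_Times:
  fixes A :: "'a::euclidean_space set" and B :: "'b::euclidean_space set"
  assumes "accessible A" "accessible B"
  shows "accessible (A \<times> B)"
  unfolding accessible_def
proof (intro ballI allI impI)
  fix z b :: "'a \<times> 'b" and e :: real assume z: "z \<in> A \<times> B" and b: "b \<in> Basis" and e: "e > 0"
  from b consider i where "i \<in> Basis" "b = (i, 0)" | i where "i \<in> Basis" "b = (0, i)"
    unfolding Basis_prod_def by auto
  then show "\<exists>d. 0 < \<bar>d\<bar> \<and> \<bar>d\<bar> < e \<and> z + d *\<^sub>R b \<in> A \<times> B"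
  proof cases
    case 1
    then show ?thesis using assms(1) z e unfolding accessible_def by (cases z) fastforce
  next
    case 2
    then show ?thesis using assms(2) z e unfolding accessible_def by (cases z) fastforce
  qed
qed

text \<open>Initial points are limits of points with positive time; \<open>dir_deriv_commute\<close>
  relies on this.\<close>

lemma time_slab_closure_interior:
  fixes V :: "'a::euclidean_space set"
  assumes "open V"
  shows "time_interval \<kappa> \<times> V \<subseteq> closure (interior (time_interval \<kappa> \<times> V))"
proof
  fix z assume z: "z \<in> time_interval \<kappa> \<times> V"
  obtain t x where tx: "z = (t, x)" "t \<in> time_interval \<kappa>" "x \<in> V" using z by auto
  have "t \<in> closure (interior (time_interval \<kappa>))"
    unfolding closure_approachable
  proof (intro allI impI)
    fix e :: real assume "e > 0"
    obtain s where s: "t < s" "s < t + e" "s \<in> time_interval \<kappa>"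
      using time_interval_right[OF tx(2) \<open>e > 0\<close>] by blast
    moreover have "0 < s" using s(1) tx(2) by (auto simp: time_interval_def)
    ultimately show "\<exists>y\<in>interior (time_interval \<kappa>). dist y t < e"
      by (intro bexI[of _ s] time_interval_interior) (auto simp: dist_real_def)
  qed
  then show "z \<in> closure (interior (time_interval \<kappa> \<times> V))"
    using tx assms closure_subset by (auto simp: interior_Times closure_Times interior_open)
qed

lemma spatial_Basis: "(0, axis i 1) \<in> (Basis :: (real \<times> (real^2)) set)"
  and time_Basis: "(1, 0) \<in> (Basis :: (real \<times> (real^2)) set)"
  by (auto simp: Basis_prod_def axis_in_Basis_iff)

lemma time_derivative:
  fixes f :: "real \<times> (real^2) \<Rightarrow> real"
  assumes "smooth_on (J \<times> V) f" "t \<in> J" "x \<in> V"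
  shows "((\<lambda>s. f (s, x)) has_real_derivative dir_deriv (J \<times> V) (1, 0) f (t, x)) (at t within J)"
proof -
  let ?F = "frechet_derivative f (at (t, x) within J \<times> V)"
  have F: "(f has_derivative ?F) (at (t, x) within J \<times> V)"
    using smooth_on_has_derivative[OF assms(1)] assms(2,3) by simp
  have 1: "((\<lambda>s. (s, x)) has_derivative (\<lambda>h. (h, 0))) (at t within J)"
    by (auto intro!: derivative_eq_intros)
  have "(f has_derivative ?F) (at (t, x) within (\<lambda>s. (s, x)) ` J)"
    by (rule has_derivative_subset[OF F]) (use assms(3) in auto)
  from has_derivative_in_compose[OF 1 this]
  have "((\<lambda>s. f (s, x)) has_derivative (\<lambda>h. ?F (h, 0))) (at t within J)" .
  moreover have "(\<lambda>h. ?F (h, 0)) = (*) (?F (1, 0))"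
  proof
    show "?F (h, 0) = ?F (1, 0) * h" for h
      using linear_scale[OF has_derivative_linear[OF F], of h "(1, 0)"] by simp
  qed
  moreover have "dir_deriv (J \<times> V) (1, 0) f (t, x) = ?F (1, 0)"
    using assms(2,3) by (simp add: dir_deriv_def)
  ultimately show ?thesis
    unfolding has_field_derivative_def by (simp only:)
qed

text \<open>The flow and heat equations prescribe derivatives within the interval, one-sided at 0;
  uniqueness there identifies them with the time derivation.\<close>

lemma time_derivative_eq:
  fixes f :: "real \<times> (real^2) \<Rightarrow> real"
  assumes "smooth_on (time_interval \<kappa> \<times> V) f" "t \<in> time_interval \<kappa>" "x \<in> V"
    and "((\<lambda>s. f (s, x)) has_real_derivative m) (at t within time_interval \<kappa>)"
  shows "dir_deriv (time_interval \<kappa> \<times> V) (1, 0) f (t, x) = m"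
proof -
  note e = frechet_derivative_within_eq[OF accessible_time_interval assms(2)]
  have "(*) (dir_deriv (time_interval \<kappa> \<times> V) (1, 0) f (t, x)) = (*) m"
    using e[OF time_derivative[OF assms(1-3), unfolded has_field_derivative_def]]
      e[OF assms(4)[unfolded has_field_derivative_def]] by simp
  from fun_cong[OF this, of 1] show ?thesis by simp
qed

lemma spatial_derivative:
  fixes f :: "real \<times> (real^2) \<Rightarrow> real"
  assumes "smooth_on (J \<times> V) f" "t \<in> J" "x \<in> V" "open V" and eq: "\<And>y. y \<in> V \<Longrightarrow> k y = f (t, y)"
  shows "(k has_derivative (\<lambda>h. frechet_derivative f (at (t, x) within J \<times> V) (0, h))) (at x)"
proof -
  let ?F = "frechet_derivative f (at (t, x) within J \<times> V)"
  have F: "(f has_derivative ?F) (at (t, x) within J \<times> V)"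
    using smooth_on_has_derivative[OF assms(1)] assms(2,3) by simp
  have 1: "((\<lambda>y. (t, y)) has_derivative (\<lambda>h. (0, h))) (at x within V)"
    by (auto intro!: derivative_eq_intros)
  have "(f has_derivative ?F) (at (t, x) within (\<lambda>y. (t, y)) ` V)"
    by (rule has_derivative_subset[OF F]) (use assms(2) in auto)
  from has_derivative_in_compose[OF 1 this]
  have "((\<lambda>y. f (t, y)) has_derivative (\<lambda>h. ?F (0, h))) (at x within V)" .
  from has_derivative_transform[OF assms(3) eq this]
  have "(k has_derivative (\<lambda>h. ?F (0, h))) (at x within V)" .
  then show ?thesis using at_within_open[OF assms(3,4)] by simp
qed

lemma partial_eq:
  fixes f :: "real \<times> (real^2) \<Rightarrow> real"
  assumes "smooth_on (J \<times> V) f" "t \<in> J" "x \<in> V" "open V" "\<And>y. y \<in> V \<Longrightarrow> k y = f (t, y)"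
  shows "partial i k x = dir_deriv (J \<times> V) (0, axis i 1) f (t, x)"
proof -
  have "frechet_derivative k (at x) = (\<lambda>h. frechet_derivative f (at (t, x) within J \<times> V) (0, h))"
    using frechet_derivative_at[OF spatial_derivative[OF assms]] by simp
  then show ?thesis using assms(2,3) by (simp add: partial_def dir_deriv_def)
qed

lemma matrix_inv_eq:
  fixes A B :: "real^'n^'n"
  assumes "A ** B = mat 1" "B ** A = mat 1"
  shows "matrix_inv A = B"
proof -
  have "A ** matrix_inv A = mat 1 \<and> matrix_inv A ** A = mat 1"
    unfolding matrix_inv_def by (rule someI[of _ B]) (use assms in simp)
  then have "matrix_inv A = matrix_inv A ** (A ** B)" "matrix_inv A ** A = mat 1"
    using assms by (simp_all add: matrix_mul_rid)
  then show ?thesis by (simp add: matrix_mul_assoc matrix_mul_lid)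
qed

lemma two_vec_eq: "(v :: 'a^2) = w \<longleftrightarrow> v $ 1 = w $ 1 \<and> v $ 2 = w $ 2"
  by (simp add: vec_eq_iff forall_2)

lemma axis_two [simp]: "axis (1::2) (x::'a::zero) $ 2 = 0" "axis (2::2) x $ 1 = 0"
  by (simp_all add: axis_def)

lemma smooth_on_fst:
  fixes D :: "('a::euclidean_space \<times> 'b::euclidean_space) set"
  shows "accessible D \<Longrightarrow> smooth_on D fst"
  unfolding smooth_on_def
proof
  fix n assume "accessible D"
  then show "Ck_on n D fst"
    by (cases n) (auto intro!: continuous_intros Ck_on_SucI[where f' = "\<lambda>z. fst"] has_derivative_fst Ck_on_const
        simp del: Ck_on.simps(2))
qed

section \<open>The flow in a single chart and its adapted frame\<close>

locale metric_flow_chart =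
  fixes \<kappa> :: ereal and V :: "(real^2) set" and G :: "real \<times> (real^2) \<Rightarrow> real^2^2" and \<epsilon> :: real
  assumes open_V: "open V"
    and smooth_G: "smooth_on (time_interval \<kappa> \<times> V) G"
    and sym: "t \<in> time_interval \<kappa> \<Longrightarrow> x \<in> V \<Longrightarrow> transpose (G (t, x)) = G (t, x)"
    and posdef: "t \<in> time_interval \<kappa> \<Longrightarrow> x \<in> V \<Longrightarrow> v \<noteq> 0 \<Longrightarrow> v \<bullet> (G (t, x) *v v) > 0"
    and flow: "t \<in> time_interval \<kappa> \<Longrightarrow> x \<in> V \<Longrightarrow>
      ((\<lambda>s. G (s, x) $ i $ j) has_real_derivative
         - \<epsilon> * scalar_curv_comp (\<lambda>y. G (t, y)) x * G (t, x) $ i $ j) (at t within time_interval \<kappa>)"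
begin

abbreviation "D \<equiv> time_interval \<kappa> \<times> V"
abbreviation "pt \<equiv> dir_deriv D (1, 0)"
abbreviation "pd i \<equiv> dir_deriv D (0, axis i 1)"
abbreviation "g i j \<equiv> (\<lambda>z. G z $ i $ j)"

lemma acc: "accessible D"
  by (intro accessible_Times accessible_time_interval accessible_open open_V)

sublocale regular_domain D by unfold_locales (rule acc)

lemma smooth_g [simp]: "smooth_on D (g i j)"
  using smooth_G unfolding smooth_on_def
  by (auto intro!: Ck_on_bounded_linear[OF acc, of "\<lambda>M. M $ i $ j"]
      bounded_linear_compose[OF bounded_linear_vec_nth bounded_linear_vec_nth])

lemma g_sym: "z \<in> D \<Longrightarrow> g 2 1 z = g 1 2 z"
proof -
  assume "z \<in> D"
  then have "transpose (G z) = G z" using sym[of "fst z" "snd z"] by auto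
  then have "transpose (G z) $ 1 $ 2 = G z $ 1 $ 2" by simp
  then show ?thesis by (simp add: transpose_def)
qed

lemma g11_pos: "z \<in> D \<Longrightarrow> g 1 1 z > 0"
  using posdef[of "fst z" "snd z" "axis 1 1"]
  by (auto simp: inner_vec_def sum_2 matrix_vector_mult_def axis_eq_0_iff)

lemma det_pos:
  assumes z: "z \<in> D" shows "g 1 1 z * g 2 2 z - (g 1 2 z)\<^sup>2 > 0"
proof -
  \<comment> \<open>On (-g12, g11) the quadratic form equals g11 times the determinant.\<close>
  define v :: "real^2" where "v = (\<chi> i. if i = 1 then - g 1 2 z else g 1 1 z)"
  have v: "v $ 1 = - g 1 2 z" "v $ 2 = g 1 1 z" by (simp_all add: v_def)
  have "v \<noteq> 0" using g11_pos[OF z] v(2) by auto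
  then have "v \<bullet> (G z *v v) > 0" using posdef[of "fst z" "snd z" v] z by auto
  also have "v \<bullet> (G z *v v) = g 1 1 z * (g 1 1 z * g 2 2 z - (g 1 2 z)\<^sup>2)"
    using g_sym[OF z]
    by (simp add: inner_vec_def sum_2 matrix_vector_mult_def v power2_eq_square algebra_simps)
  finally show ?thesis using g11_pos[OF z] by (simp add: zero_less_mult_iff)
qed

text \<open>The Cholesky factors of the metric: g11 = a^2, g12 = ab, g22 = b^2 + c^2. Positivity of
  both radicands makes them smooth.\<close>

definition "a = (\<lambda>z. sqrt (g 1 1 z))"
definition "b = g 1 2 * (\<lambda>z. inverse (a z))"
definition "c = (\<lambda>z. sqrt ((g 2 2 - b * b) z))"

lemma a_pos: "z \<in> D \<Longrightarrow> a z > 0"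
  using g11_pos[of z] by (simp add: a_def)

lemma smooth_a [simp]: "smooth_on D a"
  unfolding a_def by (intro smooth_sqrt smooth_g g11_pos)

lemma a_nz: "z \<in> D \<Longrightarrow> a z \<noteq> 0"
  by (metis a_pos less_irrefl)

lemma smooth_b [simp]: "smooth_on D b"
  unfolding b_def by (intro smooth_mult smooth_inverse smooth_g smooth_a a_nz)

lemma g11: "z \<in> D \<Longrightarrow> g 1 1 z = (a * a) z"
  using g11_pos[of z] by (simp add: a_def)

lemma g12: "z \<in> D \<Longrightarrow> g 1 2 z = (a * b) z"
  using a_pos[of z] by (simp add: b_def)

lemma c_radicand: "z \<in> D \<Longrightarrow> (g 2 2 - b * b) z > 0"
proof -
  assume z: "z \<in> D"
  have "(a z)\<^sup>2 * (g 2 2 - b * b) z = g 1 1 z * g 2 2 z - (g 1 2 z)\<^sup>2"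
    unfolding g11[OF z] g12[OF z] by (simp add: power2_eq_square algebra_simps)
  then have "(a z)\<^sup>2 * (g 2 2 - b * b) z > 0" using det_pos[OF z] by simp
  then show ?thesis using a_pos[OF z] by (simp add: zero_less_mult_iff)
qed

lemma c_pos: "z \<in> D \<Longrightarrow> c z > 0"
  using c_radicand[of z] by (simp add: c_def)

lemma smooth_c [simp]: "smooth_on D c"
  unfolding c_def by (intro smooth_sqrt smooth_diff smooth_mult smooth_g smooth_b c_radicand)

lemma g22: "z \<in> D \<Longrightarrow> g 2 2 z = (b * b + c * c) z"
  using c_radicand[of z] by (simp add: c_def)

sublocale dt: derivation D pt by (rule derivation_dir_deriv[OF acc time_Basis])
sublocale d1: derivation D "pd 1" by (rule derivation_dir_deriv[OF acc spatial_Basis])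
sublocale d2: derivation D "pd 2" by (rule derivation_dir_deriv[OF acc spatial_Basis])

text \<open>Read off from the evolution of a, so that smoothness on space-time is immediate; the
  slicewise scalar curvature offers this only after it has been computed in the frame, which itself
  presupposes a smooth \<rho>. The identification with \<epsilon>K follows in
  \<open>\<rho>_K\<close>.\<close>

definition "\<rho> = - (pt a) * (\<lambda>z. inverse (a z))"

lemma smooth_\<rho> [simp]: "smooth_on D \<rho>"
  unfolding \<rho>_def by (intro smooth_mult smooth_uminus smooth_inverse dt.smooth smooth_a a_nz)

abbreviation "Rs z \<equiv> scalar_curv_comp (\<lambda>y. G (fst z, y)) (snd z)"

lemma pt_g: "z \<in> D \<Longrightarrow> pt (g i j) z = - \<epsilon> * Rs z * g i j z"
  using time_derivative_eq[OF smooth_g _ _ flow, of "fst z" "snd z" i j] by auto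

lemma pt_a': "z \<in> D \<Longrightarrow> pt a z = - (\<epsilon> / 2 * Rs z * a z)"
proof -
  assume z: "z \<in> D"
  have "2 * a z * pt a z = pt (g 1 1) z" using dt.cong[of "g 1 1" "a * a", OF g11] by simp
  also have "\<dots> = 2 * a z * (- (\<epsilon> / 2 * Rs z * a z))"
    unfolding pt_g[OF z] g11[OF z] by simp
  finally show ?thesis by (rule mult_left_cancel[THEN iffD1, rotated]) (simp add: a_nz[OF z])
qed

lemma \<rho>_eq: "z \<in> D \<Longrightarrow> \<rho> z = \<epsilon> / 2 * Rs z"
  using a_pos[of z] by (simp add: \<rho>_def pt_a')

lemma pt_a: "z \<in> D \<Longrightarrow> pt a z = - (\<rho> z * a z)"
  by (simp add: \<rho>_eq pt_a')

lemma pt_b: "z \<in> D \<Longrightarrow> pt b z = - (\<rho> z * b z)"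
proof -
  assume z: "z \<in> D"
  have "a z * pt b z = pt (g 1 2) z - pt a z * b z" using dt.cong[of "g 1 2" "a * b", OF g12] by simp
  also have "\<dots> = a z * (- (\<rho> z * b z))"
    unfolding pt_g[OF z] g12[OF z] pt_a'[OF z] by (simp add: \<rho>_eq[OF z])
  finally show ?thesis by (rule mult_left_cancel[THEN iffD1, rotated]) (simp add: a_nz[OF z])
qed

lemma pt_c: "z \<in> D \<Longrightarrow> pt c z = - (\<rho> z * c z)"
proof -
  assume z: "z \<in> D"
  have "2 * c z * pt c z = pt (g 2 2) z - 2 * b z * pt b z"
    using dt.cong[of "g 2 2" "b * b + c * c", OF g22] by simp
  also have "\<dots> = 2 * c z * (- (\<rho> z * c z))"
    unfolding pt_g[OF z] g22[OF z] pt_b[OF z] by (simp add: \<rho>_eq[OF z] algebra_simps)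
  finally show ?thesis by (rule mult_left_cancel[THEN iffD1, rotated]) (use c_pos[OF z] in simp)
qed

lemma fst_derivs: "z \<in> D \<Longrightarrow> pt fst z = 1" "pd i fst = 0"
proof -
  have 1: "dir_deriv D e fst z = fst e" if "z \<in> D" for z e
    by (rule dir_deriv_eq[OF acc that]) (auto intro!: derivative_eq_intros)
  show "z \<in> D \<Longrightarrow> pt fst z = 1" by (simp add: 1)
  show "pd i fst = 0"
  proof
    fix z show "pd i fst z = 0 z" using 1[of z "(0, axis i 1)"] by (cases "z \<in> D") (auto simp: dir_deriv_def)
  qed
qed

sublocale coframe D pt "pd 1" "pd 2" a b c \<rho> fst
proof unfold_locales
  note comm = dir_deriv_commute[OF acc time_slab_closure_interior[OF open_V]]
  show "smooth_on D f \<Longrightarrow> pt (pd 1 f) = pd 1 (pt f)" "smooth_on D f \<Longrightarrow> pt (pd 2 f) = pd 2 (pt f)"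
    "smooth_on D f \<Longrightarrow> pd 1 (pd 2 f) = pd 2 (pd 1 f)" for f
    by (rule comm; simp add: time_Basis spatial_Basis)+
qed (simp_all add: a_pos c_pos pt_a pt_b pt_c fst_derivs smooth_on_fst acc)

lemma dd_eq: "dd i = pd i"
  using exhaust_2[of i] by (auto simp: dd_def)

lemma g_inverse:
  assumes z: "z \<in> D"
  defines "A \<equiv> matrix_inv (G z)"
  shows "A $ 1 $ 1 = ((b z)\<^sup>2 + (c z)\<^sup>2) / ((a z)\<^sup>2 * (c z)\<^sup>2)"
    "A $ 1 $ 2 = - b z / (a z * (c z)\<^sup>2)" "A $ 2 $ 1 = - b z / (a z * (c z)\<^sup>2)" "A $ 2 $ 2 = 1 / (c z)\<^sup>2"
proof -
  define B :: "real^2^2" where "B = (\<chi> i j. if i = 1 \<and> j = 1 then ((b z)\<^sup>2 + (c z)\<^sup>2) / ((a z)\<^sup>2 * (c z)\<^sup>2)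
    else if i = 2 \<and> j = 2 then 1 / (c z)\<^sup>2 else - b z / (a z * (c z)\<^sup>2))"
  have B: "B $ 1 $ 1 = ((b z)\<^sup>2 + (c z)\<^sup>2) / ((a z)\<^sup>2 * (c z)\<^sup>2)"
    "B $ 1 $ 2 = - b z / (a z * (c z)\<^sup>2)" "B $ 2 $ 1 = - b z / (a z * (c z)\<^sup>2)" "B $ 2 $ 2 = 1 / (c z)\<^sup>2"
    by (simp_all add: B_def)
  have G: "G z $ 1 $ 1 = (a z)\<^sup>2" "G z $ 1 $ 2 = a z * b z" "G z $ 2 $ 1 = a z * b z"
    "G z $ 2 $ 2 = (b z)\<^sup>2 + (c z)\<^sup>2"
    using g11[OF z] g12[OF z] g22[OF z] g_sym[OF z] by (simp_all add: power2_eq_square)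
  have nz: "a z \<noteq> 0" "c z \<noteq> 0" using a_pos[OF z] c_pos[OF z] by simp_all
  have "A = B" unfolding A_def
    by (rule matrix_inv_eq; simp add: vec_eq_iff forall_2 matrix_matrix_mult_def sum_2 mat_def G B)
      (simp_all add: nz field_simps power2_eq_square)
  then show "A $ 1 $ 1 = ((b z)\<^sup>2 + (c z)\<^sup>2) / ((a z)\<^sup>2 * (c z)\<^sup>2)"
    "A $ 1 $ 2 = - b z / (a z * (c z)\<^sup>2)" "A $ 2 $ 1 = - b z / (a z * (c z)\<^sup>2)" "A $ 2 $ 2 = 1 / (c z)\<^sup>2"
    using B by simp_all
qed

text \<open>The frame connection preserves the metric by construction and is torsion-free by
  \<open>torsion_free\<close>, hence it is the Levi-Civita connection. This is verified entry by
  entry.\<close>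

lemma christoffel_eq:
  assumes t: "t \<in> time_interval \<kappa>" and x: "x \<in> V"
  shows "christoffel (\<lambda>y. G (t, y)) k i j x = Gm k i j (t, x)"
proof -
  let ?z = "(t, x)"
  have z: "?z \<in> D" using t x by simp
  have P: "partial i (\<lambda>y. G (t, y) $ j $ l) x = dd i (g j l) ?z" for i j l
    unfolding dd_eq by (rule partial_eq[OF smooth_g t x open_V]) simp
  have sym: "dd i (g 2 1) = dd i (g 1 2)" for i
    using d1.cong[of "g 2 1" "g 1 2", OF g_sym] d2.cong[of "g 2 1" "g 1 2", OF g_sym] by (simp add: dd_def)
  have dg: "dd i (g 1 1) ?z = 2 * a ?z * dd i a ?z"
    "dd i (g 1 2) ?z = a ?z * dd i b ?z + dd i a ?z * b ?z"
    "dd i (g 2 2) ?z = 2 * b ?z * dd i b ?z + 2 * c ?z * dd i c ?z" for i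
    using d1.cong[of "g 1 1" "a * a", OF g11] d2.cong[of "g 1 1" "a * a", OF g11]
      d1.cong[of "g 1 2" "a * b", OF g12] d2.cong[of "g 1 2" "a * b", OF g12]
      d1.cong[of "g 2 2" "b * b + c * c", OF g22] d2.cong[of "g 2 2" "b * b + c * c", OF g22]
    by (simp_all add: dd_def)
  have nz: "a ?z \<noteq> 0" "c ?z \<noteq> 0" using a_pos[OF z] c_pos[OF z] by simp_all
  have i: "ia ?z = 1 / a ?z" "ic ?z = 1 / c ?z" by (simp_all add: ia_def ic_def field_simps)
  have tf: "pd 2 a ?z = pd 1 b ?z - c ?z * w1 ?z" "pd 1 c ?z = a ?z * w2 ?z - b ?z * w1 ?z"
    using torsion_free[OF z] .
  from exhaust_2[of k] exhaust_2[of i] exhaust_2[of j] show ?thesis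
    unfolding christoffel_def P
    by (elim disjE; simp add: sum_2 sym dg g_inverse[OF z] Gm_def ww_def)
      (simp_all add: dd_def tf i nz field_simps power2_eq_square)
qed

lemma scalar_curv_eq:
  assumes t: "t \<in> time_interval \<kappa>" and x: "x \<in> V"
  shows "scalar_curv_comp (\<lambda>y. G (t, y)) x = 2 * K (t, x)"
proof -
  let ?z = "(t, x)"
  have z: "?z \<in> D" using t x by simp
  have P: "partial l (christoffel (\<lambda>y. G (t, y)) k i j) x = dd l (Gm k i j) ?z" for l k i j
    unfolding dd_eq by (rule partial_eq[OF smooth_Gm t x open_V]) (rule christoffel_eq[OF t])
  have ric: "ricci_comp (\<lambda>y. G (t, y)) j k x = ricci j k ?z" for j k
    unfolding ricci_comp_def ricci_def P christoffel_eq[OF t x] ..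
  have nz: "a ?z \<noteq> 0" "c ?z \<noteq> 0" using a_pos[OF z] c_pos[OF z] by simp_all
  show ?thesis
    unfolding scalar_curv_comp_def ric
    by (simp add: sum_2 ricci_eq[OF z] g_inverse[OF z]) (simp add: nz field_simps power2_eq_square)
qed

text \<open>The frame calculus uses this as an equation between functions, so it is also checked off
  D, where p, q and all derivatives are 0.\<close>

lemma \<rho>_K: "\<rho> = (\<lambda>_. \<epsilon>) * K"
proof
  fix z show "\<rho> z = ((\<lambda>_. \<epsilon>) * K) z"
  proof (cases "z \<in> D")
    case True
    then show ?thesis using scalar_curv_eq[of "fst z" "snd z"] by (auto simp: \<rho>_eq)
  next
    case False
    then have "p z = 0" "q z = 0" by (simp_all add: p_def q_def w_zero_outside)
    with False show ?thesis
      by (simp add: \<rho>_def K_def dt.zero_outside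
          derivation.zero_outside[OF derivation_X] derivation.zero_outside[OF derivation_Y])
  qed
qed

lemma partial_pd:
  assumes "smooth_on D f" "t \<in> time_interval \<kappa>" "x \<in> V" "\<And>y. y \<in> V \<Longrightarrow> k y = f (t, y)"
  shows "partial i k x = dd i f (t, x)"
  unfolding dd_eq by (rule partial_eq[OF assms(1-3) open_V assms(4)])

lemma laplacian_eq:
  assumes f: "smooth_on D f" and t: "t \<in> time_interval \<kappa>" and x: "x \<in> V"
    and k: "\<And>y. y \<in> V \<Longrightarrow> k y = f (t, y)"
  shows "laplacian_comp (\<lambda>y. G (t, y)) k x = lap f (t, x)"
proof -
  let ?z = "(t, x)"
  have z: "?z \<in> D" using t x by simp
  have nz: "a ?z \<noteq> 0" "c ?z \<noteq> 0" using a_pos[OF z] c_pos[OF z] by simp_all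
  have i: "ia ?z = 1 / a ?z" "ic ?z = 1 / c ?z" by (simp_all add: ia_def ic_def field_simps)
  have tf: "pd 2 a ?z = pd 1 b ?z - c ?z * w1 ?z" "pd 1 c ?z = a ?z * w2 ?z - b ?z * w1 ?z"
    using torsion_free[OF z] .
  have P: "partial i k y = dd i f (t, y)" if "y \<in> V" for i y
    by (rule partial_pd[OF f t that k])
  have sdd: "smooth_on D (dd i f)" for i using f by (simp add: dd_def)
  have PP: "partial i (partial j k) x = dd i (dd j f) ?z" for i j
    by (rule partial_pd[OF sdd t x P])
  show ?thesis
    unfolding laplacian_comp_def christoffel_eq[OF t x] PP P[OF x] lap_def
    using f
    by (simp add: sum_2 g_inverse[OF z] Gm_def ww_def dd_def X_def Y_def p_def q_def d12)
      (simp add: tf i nz field_simps power2_eq_square)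
qed

lemma gradient_norm_eq:
  assumes f: "smooth_on D f" and t: "t \<in> time_interval \<kappa>" and x: "x \<in> V"
    and k: "\<And>y. y \<in> V \<Longrightarrow> k y = f (t, y)"
  defines "v \<equiv> gradient_comp (\<lambda>y. G (t, y)) k x"
  shows "v \<bullet> (G (t, x) *v v) = gam f f (t, x)"
proof -
  let ?z = "(t, x)"
  have z: "?z \<in> D" using t x by simp
  have nz: "a ?z \<noteq> 0" "c ?z \<noteq> 0" using a_pos[OF z] c_pos[OF z] by simp_all
  have i: "ia ?z = 1 / a ?z" "ic ?z = 1 / c ?z" by (simp_all add: ia_def ic_def field_simps)
  have G: "G ?z $ 1 $ 1 = (a ?z)\<^sup>2" "G ?z $ 1 $ 2 = a ?z * b ?z" "G ?z $ 2 $ 1 = a ?z * b ?z"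
    "G ?z $ 2 $ 2 = (b ?z)\<^sup>2 + (c ?z)\<^sup>2"
    using g11[OF z] g12[OF z] g22[OF z] g_sym[OF z] by (simp_all add: power2_eq_square)
  have P: "partial i k x = dd i f ?z" for i by (rule partial_pd[OF f t x k])
  have v: "v $ 1 = X f ?z / a ?z - b ?z / (a ?z * c ?z) * Y f ?z" "v $ 2 = Y f ?z / c ?z"
    unfolding v_def gradient_comp_def
    by (simp_all add: matrix_vector_mult_def sum_2 g_inverse[OF z] P X_def Y_def dd_def)
      (simp_all add: i nz field_simps power2_eq_square)
  show ?thesis
    by (simp add: inner_vec_def matrix_vector_mult_def sum_2 G v gam_def)
      (simp add: nz field_simps power2_eq_square)
qed

end

section \<open>The maximum principle on the surface\<close>

text \<open>If m < 0, then f' is negative just to the right of 0, and the mean value theorem pushes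
  f below its minimum.\<close>

lemma second_derivative_at_min:
  fixes f :: "real \<Rightarrow> real"
  assumes "e > 0" and f: "\<And>s. \<bar>s\<bar> < e \<Longrightarrow> (f has_real_derivative f' s) (at s)"
    and "f' 0 = 0" and m: "(f' has_real_derivative m) (at 0)"
    and min: "\<And>s. \<bar>s\<bar> < e \<Longrightarrow> f 0 \<le> f s"
  shows "m \<ge> 0"
proof (rule ccontr)
  assume "\<not> m \<ge> 0"
  then obtain d where "d > 0" and d: "\<And>h. 0 < h \<Longrightarrow> h < d \<Longrightarrow> f' h < 0"
    using DERIV_neg_dec_right[OF m] \<open>f' 0 = 0\<close> by auto
  define h where "h = min d e / 2"
  have h: "0 < h" "h < d" "h < e" using \<open>d > 0\<close> \<open>e > 0\<close> by (auto simp: h_def)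
  obtain z where "0 < z" "z < h" "f h - f 0 = (h - 0) * f' z"
    using MVT2[OF h(1), of f f'] f h by auto
  moreover have "f 0 \<le> f h" using min[of h] h by simp
  moreover have "f' z < 0" using d calculation h by simp
  ultimately show False using h(1) by (smt (verit) mult_pos_neg)
qed

context metric_flow_chart
begin

lemma derivative_along:
  assumes k: "smooth_on D k" and t: "t \<in> time_interval \<kappa>" and x: "x + s *\<^sub>R v \<in> V"
  shows "((\<lambda>s. k (t, x + s *\<^sub>R v)) has_real_derivative
     v $ 1 * pd 1 k (t, x + s *\<^sub>R v) + v $ 2 * pd 2 k (t, x + s *\<^sub>R v)) (at s)"
proof -
  let ?F = "\<lambda>h. frechet_derivative k (at (t, x + s *\<^sub>R v) within D) (0, h)"
  have F: "((\<lambda>y. k (t, y)) has_derivative ?F) (at (x + s *\<^sub>R v))"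
    by (rule spatial_derivative[OF k t x open_V]) simp
  have lin: "linear ?F" using F by (rule has_derivative_linear)
  have "v = v $ 1 *\<^sub>R axis 1 1 + v $ 2 *\<^sub>R axis 2 1"
    by (simp add: two_vec_eq)
  then have "?F v = ?F (v $ 1 *\<^sub>R axis 1 1 + v $ 2 *\<^sub>R axis 2 1)" by (rule arg_cong)
  also have "\<dots> = v $ 1 * ?F (axis 1 1) + v $ 2 * ?F (axis 2 1)"
    using linear_add[OF lin, of "v $ 1 *\<^sub>R axis 1 1" "v $ 2 *\<^sub>R axis 2 1"] linear_scale[OF lin] by simp
  also have "\<dots> = v $ 1 * pd 1 k (t, x + s *\<^sub>R v) + v $ 2 * pd 2 k (t, x + s *\<^sub>R v)"
    using t x by (simp add: dir_deriv_def)
  finally show ?thesis using has_real_derivative_along[where f = "\<lambda>y. k (t, y)", OF F] by simp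
qed

text \<open>In space this is an interior minimum, in time only the past is compared with \<beta>,
  hence an inequality for the time derivative. The sign of \<open>lap\<close> comes from the
  coordinate Hessian, since first-order terms vanish at a critical point.\<close>

lemma touch_conditions:
  assumes k [simp]: "smooth_on D k" and t: "t \<in> time_interval \<kappa>" "0 < t" and x: "x \<in> V"
    and eq: "k (t, x) = \<beta> t" and ge: "\<And>y. y \<in> V \<Longrightarrow> k (t, y) \<ge> \<beta> t"
    and past: "\<And>s. 0 \<le> s \<Longrightarrow> s \<le> t \<Longrightarrow> k (s, x) \<ge> \<beta> s"
    and \<beta>: "(\<beta> has_real_derivative \<beta>') (at t)"
  shows "pt k (t, x) \<le> \<beta>'" and "X k (t, x) = 0" and "Y k (t, x) = 0" and "lap k (t, x) \<ge> 0"
proof -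
  let ?z = "(t, x)"
  show "pt k ?z \<le> \<beta>'"
  proof (rule ccontr)
    assume "\<not> ?thesis"
    have "at t within time_interval \<kappa> = at t"
      by (rule at_within_interior[OF time_interval_interior[OF t]])
    then have "((\<lambda>s. k (s, x) - \<beta> s) has_real_derivative pt k ?z - \<beta>') (at t)"
      using time_derivative[OF k t(1) x] \<beta> by (auto intro: DERIV_diff)
    from DERIV_pos_inc_left[OF this] \<open>\<not> pt k ?z \<le> \<beta>'\<close>
    obtain d where "d > 0" and d: "\<And>h. 0 < h \<Longrightarrow> h < d \<Longrightarrow> k (t - h, x) - \<beta> (t - h) < k (t, x) - \<beta> t" by auto
    define h where "h = min d t / 2"
    have h: "0 < h" "h < d" "h < t" using \<open>d > 0\<close> t(2) by (auto simp: h_def)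
    then show False using d[OF h(1,2)] past[of "t - h"] eq by simp
  qed
  have "(\<lambda>h. frechet_derivative k (at ?z within D) (0, h)) = (\<lambda>v. 0)"
    by (rule differential_zero_maxmin[OF x open_V spatial_derivative[OF k t(1) x open_V refl]])
      (use eq ge in auto)
  then have 0: "frechet_derivative k (at ?z within D) (0, h) = 0" for h by metis
  have p0: "pd i k ?z = 0" for i using 0 t(1) x by (simp add: dir_deriv_def)
  then show "X k ?z = 0" "Y k ?z = 0" by (simp_all add: X_def Y_def)
  have hess: "v $ 1 * (v $ 1 * pd 1 (pd 1 k) ?z + v $ 2 * pd 2 (pd 1 k) ?z)
    + v $ 2 * (v $ 1 * pd 1 (pd 2 k) ?z + v $ 2 * pd 2 (pd 2 k) ?z) \<ge> 0" for v :: "real^2"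
  proof -
    obtain r where "r > 0" and r: "ball x r \<subseteq> V" using open_V x open_contains_ball by blast
    define e where "e = r / (norm v + 1)"
    have nv: "norm v + 1 > 0" by (simp add: add_nonneg_pos)
    have "e > 0" using \<open>r > 0\<close> nv by (simp add: e_def)
    have inV: "x + s *\<^sub>R v \<in> V" if "\<bar>s\<bar> < e" for s
    proof -
      have "norm (s *\<^sub>R v) \<le> \<bar>s\<bar> * (norm v + 1)" by (simp add: mult_left_mono)
      also have "\<dots> < e * (norm v + 1)" using that nv by (intro mult_strict_right_mono)
      also have "\<dots> = r" using nv by (simp add: e_def)
      finally have "dist x (x + s *\<^sub>R v) < r" by (simp add: dist_norm)
      then show ?thesis using r by auto
    qed
    let ?f = "\<lambda>s. k (t, x + s *\<^sub>R v)"
    let ?f' = "\<lambda>s. v $ 1 * pd 1 k (t, x + s *\<^sub>R v) + v $ 2 * pd 2 k (t, x + s *\<^sub>R v)"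
    have x0: "x + 0 *\<^sub>R v \<in> V" using x by simp
    have "(?f' has_real_derivative v $ 1 * (v $ 1 * pd 1 (pd 1 k) (t, x + 0 *\<^sub>R v) + v $ 2 * pd 2 (pd 1 k) (t, x + 0 *\<^sub>R v))
      + v $ 2 * (v $ 1 * pd 1 (pd 2 k) (t, x + 0 *\<^sub>R v) + v $ 2 * pd 2 (pd 2 k) (t, x + 0 *\<^sub>R v))) (at 0)"
      by (intro DERIV_add DERIV_cmult derivative_along[OF _ t(1) x0]) simp_all
    then have D2: "(?f' has_real_derivative v $ 1 * (v $ 1 * pd 1 (pd 1 k) ?z + v $ 2 * pd 2 (pd 1 k) ?z)
      + v $ 2 * (v $ 1 * pd 1 (pd 2 k) ?z + v $ 2 * pd 2 (pd 2 k) ?z)) (at 0)" by simp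
    show ?thesis
    proof (rule second_derivative_at_min[OF \<open>e > 0\<close> _ _ D2])
      show "(?f has_real_derivative ?f' s) (at s)" if "\<bar>s\<bar> < e" for s
        by (rule derivative_along[OF k t(1) inV[OF that]])
      show "?f' 0 = 0" using p0 by simp
      show "?f 0 \<le> ?f s" if "\<bar>s\<bar> < e" for s using ge[OF inV[OF that]] eq by simp
    qed
  qed
  \<comment> \<open>Coordinate components of the frame vectors X and Y; at the critical point
    \<open>lap\<close> is the sum of the Hessian form over them.\<close>
  define e1 :: "real^2" where "e1 = (\<chi> i. if i = 1 then ia ?z else 0)"
  define e2 :: "real^2" where "e2 = (\<chi> i. if i = 1 then - (ic ?z * b ?z * ia ?z) else ic ?z)"
  have e: "e1 $ 1 = ia ?z" "e1 $ 2 = 0" "e2 $ 1 = - (ic ?z * b ?z * ia ?z)" "e2 $ 2 = ic ?z"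
    by (simp_all add: e1_def e2_def)
  have "lap k ?z = X (X k) ?z + Y (Y k) ?z"
    using \<open>X k ?z = 0\<close> \<open>Y k ?z = 0\<close> by (simp add: lap_def)
  also have "X (X k) ?z = ia ?z * (ia ?z * pd 1 (pd 1 k) ?z)"
    by (simp add: X_def p0)
  also have "Y (Y k) ?z = - (ic ?z * b ?z * ia ?z) * (- (ic ?z * b ?z * ia ?z) * pd 1 (pd 1 k) ?z + ic ?z * pd 2 (pd 1 k) ?z)
    + ic ?z * (- (ic ?z * b ?z * ia ?z) * pd 1 (pd 2 k) ?z + ic ?z * pd 2 (pd 2 k) ?z)"
    by (simp add: Y_def p0 algebra_simps)
  finally show "lap k ?z \<ge> 0" using hess[of e1] hess[of e2] unfolding e by simp
qed

end

lemma matrix_inv_right_posdef: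
  fixes M :: "real^'n^'n"
  assumes "\<And>v. v \<noteq> 0 \<Longrightarrow> v \<bullet> (M *v v) > 0"
  shows "M ** matrix_inv M = mat 1"
proof -
  have "x = 0" if "M *v x = 0" for x using assms[of x] that by auto
  then have "\<exists>B. B ** M = mat 1" using matrix_left_invertible_ker by blast
  then have "invertible M" using invertible_left_inverse by blast
  then obtain B where "M ** B = mat 1" "B ** M = mat 1" unfolding invertible_def by blast
  then show ?thesis using matrix_inv_eq by metis
qed

locale surface_flow =
  fixes A :: "'a::{t2_space,second_countable_topology} chart set"
    and \<epsilon> :: real and \<kappa> :: ereal and g :: "real \<Rightarrow> 'a metric_comps"
  assumes surface: "closed_surface A" and \<epsilon>_nonneg: "0 \<le> \<epsilon>" and \<kappa>_pos: "0 < \<kappa>"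
    and ricci_flow: "eps_ricci_flow A \<epsilon> \<kappa> g"
begin

abbreviation "V c \<equiv> chart_map c ` chart_dom c"
abbreviation "J \<equiv> time_interval \<kappa>"
definition "G c = (\<lambda>(t, x). in_chart c (g t c) x)"
definition "coord F c = (\<lambda>(t, x). in_chart c (F t) x)" for F :: "real \<Rightarrow> 'a \<Rightarrow> real"

lemma zero_in_J: "0 \<in> J"
  using \<kappa>_pos by (simp add: time_interval_def zero_ereal_def)

lemma atlas: "smooth_atlas A" and compact_surface: "compact (UNIV :: 'a set)"
  using surface by (simp_all add: closed_surface_def)

lemma chart_exists: "\<exists>c\<in>A. p \<in> chart_dom c"
  using atlas unfolding smooth_atlas_def by blast

lemma chart_open: "c \<in> A \<Longrightarrow> open (chart_dom c)" "c \<in> A \<Longrightarrow> open (V c)"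
  using atlas unfolding smooth_atlas_def by blast+

lemma chart_homeo: "c \<in> A \<Longrightarrow> homeomorphism (chart_dom c) (V c) (chart_map c) (chart_inv c)"
  using atlas unfolding smooth_atlas_def by blast

lemma chart_inv_map [simp]: "c \<in> A \<Longrightarrow> p \<in> chart_dom c \<Longrightarrow> chart_inv c (chart_map c p) = p"
  using homeomorphism_apply1[OF chart_homeo] .

lemma chart_map_inv [simp]: "c \<in> A \<Longrightarrow> x \<in> V c \<Longrightarrow> chart_map c (chart_inv c x) = x"
  using homeomorphism_apply2[OF chart_homeo] .

lemma chart_inv_dom: "c \<in> A \<Longrightarrow> x \<in> V c \<Longrightarrow> chart_inv c x \<in> chart_dom c"
  by auto

lemma chart_continuous: "c \<in> A \<Longrightarrow> continuous_on (chart_dom c) (chart_map c)"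
  using homeomorphism_cont1[OF chart_homeo] .

lemma metric: "t \<in> J \<Longrightarrow> riemannian_metric A (g t)"
  using ricci_flow unfolding eps_ricci_flow_def by blast

lemma metric_posdef: "t \<in> J \<Longrightarrow> c \<in> A \<Longrightarrow> p \<in> chart_dom c \<Longrightarrow> v \<noteq> 0 \<Longrightarrow> v \<bullet> (g t c p *v v) > 0"
  using metric unfolding riemannian_metric_def by blast

lemma G_slice: "(\<lambda>y. G c (t, y)) = in_chart c (g t c)"
  by (simp add: G_def)

lemma flow_chart: "c \<in> A \<Longrightarrow> metric_flow_chart \<kappa> (V c) (G c) \<epsilon>"
proof
  assume c: "c \<in> A"
  show "open (V c)" by (rule chart_open[OF c])
  show "smooth_on (J \<times> V c) (G c)"
    using ricci_flow c unfolding eps_ricci_flow_def G_def by blast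
  fix t x assume t: "t \<in> J" and x: "x \<in> V c"
  then have p: "chart_inv c x \<in> chart_dom c" using chart_inv_dom[OF c] by blast
  show "transpose (G c (t, x)) = G c (t, x)"
    using metric[OF t] c p unfolding riemannian_metric_def G_def in_chart_def by auto
  show "v \<bullet> (G c (t, x) *v v) > 0" if "v \<noteq> 0" for v
    using metric_posdef[OF t c p that] by (simp add: G_def in_chart_def)
  have "((\<lambda>s. g s c (chart_inv c x) $ i $ j) has_real_derivative
           - \<epsilon> * scalar_curvature (g t) c (chart_inv c x) * g t c (chart_inv c x) $ i $ j) (at t within J)" for i j
    using ricci_flow c p t unfolding eps_ricci_flow_def by blast
  then show "((\<lambda>s. G c (s, x) $ i $ j) has_real_derivative
       - \<epsilon> * scalar_curv_comp (\<lambda>y. G c (t, y)) x * G c (t, x) $ i $ j) (at t within J)" for i j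
    using c x unfolding G_slice by (simp add: G_def in_chart_def scalar_curvature_def)
qed

lemma coord_apply [simp]: "c \<in> A \<Longrightarrow> p \<in> chart_dom c \<Longrightarrow> coord F c (t, chart_map c p) = F t p"
  by (simp add: coord_def in_chart_def)

text \<open>The local functions glue to one continuous function on the compact set [0, t1] \<times>
  M, so the violation set is compact and has an earliest time. Together with
  \<open>touch_conditions\<close> this is the maximum principle for a barrier depending on time
  alone.\<close>

lemma touching:
  fixes \<Phi> :: "'a chart \<Rightarrow> real \<times> (real^2) \<Rightarrow> real"
  assumes smooth: "\<And>c. c \<in> A \<Longrightarrow> smooth_on (J \<times> V c) (\<Phi> c)"
    and agree: "\<And>c c' t p. c \<in> A \<Longrightarrow> c' \<in> A \<Longrightarrow> t \<in> J \<Longrightarrow> p \<in> chart_dom c \<Longrightarrow> p \<in> chart_dom c' \<Longrightarrow>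
       \<Phi> c (t, chart_map c p) = \<Phi> c' (t, chart_map c' p)"
    and \<beta>: "continuous_on UNIV \<beta>"
    and init: "\<And>c p. c \<in> A \<Longrightarrow> p \<in> chart_dom c \<Longrightarrow> \<Phi> c (0, chart_map c p) > \<beta> 0"
    and viol: "c1 \<in> A" "t1 \<in> J" "p1 \<in> chart_dom c1" "\<Phi> c1 (t1, chart_map c1 p1) \<le> \<beta> t1"
  obtains c t x where "c \<in> A" "t \<in> J" "0 < t" "x \<in> V c" "\<Phi> c (t, x) = \<beta> t"
    "\<And>y. y \<in> V c \<Longrightarrow> \<Phi> c (t, y) \<ge> \<beta> t" "\<And>s. 0 \<le> s \<Longrightarrow> s \<le> t \<Longrightarrow> \<Phi> c (s, x) \<ge> \<beta> s"
proof -
  \<comment> \<open>The chart is an arbitrary choice at each point; \<open>agree\<close> makes the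
    value independent of it and continuity a local matter.\<close>
  define F where "F = (\<lambda>(t, p). let c = (SOME c. c \<in> A \<and> p \<in> chart_dom c) in \<Phi> c (t, chart_map c p))"
  have F: "F (t, p) = \<Phi> c (t, chart_map c p)" if "t \<in> J" "c \<in> A" "p \<in> chart_dom c" for t c p
  proof -
    define d where "d = (SOME c. c \<in> A \<and> p \<in> chart_dom c)"
    have d: "d \<in> A \<and> p \<in> chart_dom d"
      unfolding d_def by (rule someI[of _ c]) (use that in simp)
    have "F (t, p) = \<Phi> d (t, chart_map d p)" by (simp add: F_def d_def Let_def)
    also have "\<dots> = \<Phi> c (t, chart_map c p)"
      by (rule agree) (use d that in simp_all)
    finally show ?thesis .
  qed
  let ?S = "{0..t1} \<times> (UNIV :: 'a set)"
  have J1: "{0..t1} \<subseteq> J" using viol(2) time_intervalI by auto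
  have contF: "continuous_on ?S F"
    unfolding continuous_on_eq_continuous_within
  proof
    fix z assume z: "z \<in> ?S"
    obtain t p where tp: "z = (t, p)" "t \<in> {0..t1}" using z by auto
    obtain c where c: "c \<in> A" "p \<in> chart_dom c" using chart_exists by blast
    have "continuous_on ({0..t1} \<times> chart_dom c) (\<lambda>z. \<Phi> c (fst z, chart_map c (snd z)))"
      by (rule continuous_on_compose2[OF smooth_on_continuous_on[OF smooth[OF c(1)]]])
        (use J1 in \<open>auto intro!: continuous_intros continuous_on_compose2[OF chart_continuous[OF c(1)]]\<close>)
    then have "continuous_on ({0..t1} \<times> chart_dom c) F"
      by (rule continuous_on_eq) (use F[OF _ c(1)] J1 in auto)
    then have "continuous (at z within {0..t1} \<times> chart_dom c) F"
      using tp c by (auto simp: continuous_on_eq_continuous_within)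
    moreover have "at z within {0..t1} \<times> chart_dom c = at z within ?S"
      by (rule at_within_nhd[of _ "UNIV \<times> chart_dom c"])
        (use tp c in \<open>auto intro: open_Times chart_open\<close>)
    ultimately show "continuous (at z within ?S) F" by simp
  qed
  let ?B = "{z \<in> ?S. F z \<le> \<beta> (fst z)}"
  have compS: "compact ?S" by (intro compact_Times compact_Icc compact_surface)
  have "continuous_on ?S (\<lambda>z. \<beta> (fst z))"
    by (intro continuous_on_compose2[OF \<beta>] continuous_intros) auto
  then have "closed ?B"
    using contF compact_imp_closed[OF compS] by (intro continuous_on_closed_Collect_le)
  then have compB: "compact ?B" using compact_Int_closed[OF compS, of ?B]
    by (simp add: Int_absorb1 Collect_mono_iff)
  have "0 \<le> t1" using viol(2) by (simp add: time_interval_def)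
  have neB: "(t1, p1) \<in> ?B" using F[OF viol(2,1,3)] viol(4) \<open>0 \<le> t1\<close> by simp
  \<comment> \<open>Minimising the time coordinate over the violation set yields the first
    contact.\<close>
  obtain z where z: "z \<in> ?B" and zmin: "\<And>w. w \<in> ?B \<Longrightarrow> fst z \<le> fst w"
    using continuous_attains_inf[OF compB _ continuous_on_fst[OF continuous_on_id]] neB by blast
  obtain t p where tp: "z = (t, p)" by fastforce
  have t: "0 \<le> t" "t \<le> t1" "t \<in> J" "F (t, p) \<le> \<beta> t" using z tp J1 by auto
  obtain c where c: "c \<in> A" "p \<in> chart_dom c" using chart_exists by blast
  have "t \<noteq> 0"
  proof
    assume "t = 0"
    then show False using t(4) F[OF t(3) c] init[OF c] by simp
  qed
  then have "0 < t" using t(1) by simp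
  have before: "F (s, q) > \<beta> s" if "0 \<le> s" "s < t" for s q
    using zmin[of "(s, q)"] that t tp by force
  \<comment> \<open>Before t the inequality is strict everywhere; letting s tend to t from the left
    keeps it weakly at every q. Hence the contact point is a spatial minimum.\<close>
  have at_t: "F (t, q) \<ge> \<beta> t" for q
  proof -
    have "continuous_on {0..t} (\<lambda>s. F (s, q) - \<beta> s)"
      by (intro continuous_intros continuous_on_compose2[OF contF] continuous_on_subset[OF \<beta>])
        (use t in auto)
    then have "((\<lambda>s. F (s, q) - \<beta> s) \<longlongrightarrow> F (t, q) - \<beta> t) (at t within {0..t})"
      using t(1) by (simp add: continuous_on_def)
    moreover have "at t within {0..t} = at_left t"
      by (rule at_within_Icc_at_left[OF \<open>0 < t\<close>])
    moreover have "\<forall>\<^sub>F s in at_left t. 0 \<le> F (s, q) - \<beta> s"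
      using \<open>0 < t\<close> by (intro eventually_at_leftI[of 0]) (auto intro!: less_imp_le before)
    ultimately have "0 \<le> F (t, q) - \<beta> t"
      by (intro tendsto_lowerbound[where F = "at_left t"]) auto
    then show ?thesis by simp
  qed
  show thesis
  proof (rule that[OF c(1) t(3) \<open>0 < t\<close>])
    show "chart_map c p \<in> V c" using c by simp
    show "\<Phi> c (t, chart_map c p) = \<beta> t" using F[OF t(3) c] at_t[of p] t(4) by simp
    show "\<Phi> c (t, y) \<ge> \<beta> t" if "y \<in> V c" for y
      using at_t[of "chart_inv c y"] F[OF t(3) c(1) chart_inv_dom[OF c(1) that]] c that by simp
    show "\<Phi> c (s, chart_map c p) \<ge> \<beta> s" if "0 \<le> s" "s \<le> t" for s
    proof -
      have "s \<in> J" using that t(3) time_intervalI by blast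
      then show ?thesis using F[OF _ c, of s] before[of s p] at_t[of p] that by (cases "s = t") auto
    qed
  qed
qed

end

text \<open>A name for |\<nabla>k|^2 that depends on chart data only, so that its values in two
  charts can be compared.\<close>

definition (in metric_flow_chart) gradsq :: "(real \<times> (real^2) \<Rightarrow> real) \<Rightarrow> real \<times> (real^2) \<Rightarrow> real" where
  "gradsq k = gam k k"

section \<open>Independence of the chart\<close>

context surface_flow
begin

lemma smooth_transition:
  assumes "c \<in> A" "c' \<in> A" "p \<in> chart_dom c" "p \<in> chart_dom c'"
  shows "\<exists>T'. (transition c c' has_derivative T') (at (chart_map c p))"
    and "open (chart_map c ` (chart_dom c \<inter> chart_dom c'))"
proof -
  let ?U = "chart_map c ` (chart_dom c \<inter> chart_dom c')"
  have "openin (top_of_set (V c)) ?U"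
    by (rule homeomorphism_imp_open_map[OF chart_homeo[OF assms(1)]])
      (simp add: openin_open_Int chart_open assms)
  then show op: "open ?U" using chart_open(2)[OF assms(1)] openin_open_trans by blast
  have "smooth_on ?U (transition c c')"
    using atlas assms unfolding smooth_atlas_def by blast
  then have "(transition c c' has_derivative
      frechet_derivative (transition c c') (at (chart_map c p) within ?U)) (at (chart_map c p) within ?U)"
    using assms by (intro smooth_on_has_derivative) auto
  then show "\<exists>T'. (transition c c' has_derivative T') (at (chart_map c p))"
    using at_within_open[OF _ op] assms by auto
qed

lemma metric_transform:
  assumes "c \<in> A" "c' \<in> A" "p \<in> chart_dom c" "p \<in> chart_dom c'" "t \<in> J"
  shows "g t c p = transpose (jacobian (transition c c') (at (chart_map c p))) ** g t c' p
     ** jacobian (transition c c') (at (chart_map c p))"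
  using metric[OF assms(5)] assms(1-4) unfolding riemannian_metric_def Let_def by blast

lemma metric_gradient:
  assumes "c \<in> A" "p \<in> chart_dom c" "t \<in> J"
  shows "g t c p *v gradient (g t) c f p = (\<chi> i. partial i (in_chart c f) (chart_map c p))"
proof -
  have "g t c p ** matrix_inv (g t c p) = mat 1"
    by (rule matrix_inv_right_posdef) (rule metric_posdef[OF assms(3,1,2)])
  then show ?thesis
    using assms by (simp add: gradient_def gradient_comp_def in_chart_def matrix_vector_mul_assoc)
qed

lemma linear_partial:
  assumes "(k has_derivative k') (at x)"
  shows "k' h = (\<chi> i. partial i k x) \<bullet> h"
proof -
  have lin: "linear k'" using assms by (rule has_derivative_linear)
  have p: "partial i k x = k' (axis i 1)" for i
    unfolding partial_def using frechet_derivative_at[OF assms] by simp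
  have "h = h $ 1 *\<^sub>R axis 1 1 + h $ 2 *\<^sub>R axis 2 1" by (simp add: two_vec_eq)
  then have "k' h = k' (h $ 1 *\<^sub>R axis 1 1 + h $ 2 *\<^sub>R axis 2 1)" by (rule arg_cong)
  also have "\<dots> = h $ 1 * k' (axis 1 1) + h $ 2 * k' (axis 2 1)"
    using linear_add[OF lin, of "h $ 1 *\<^sub>R axis 1 1" "h $ 2 *\<^sub>R axis 2 1"] linear_scale[OF lin] by simp
  finally show ?thesis by (simp add: inner_vec_def sum_2 p mult.commute)
qed

text \<open>
  With \<open>v\<close>, \<open>v'\<close> the gradients in the two charts and \<open>y\<close> the image of \<open>v\<close> under the coordinate
  change, both squared norms occur in the expansion of \<open>g'(y - v', y - v') \<ge> 0\<close>; this avoids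
  inverting the Jacobian.
\<close>

lemma gradient_norm_le:
  assumes c: "c \<in> A" "c' \<in> A" and p: "p \<in> chart_dom c" "p \<in> chart_dom c'" and t: "t \<in> J"
    and diff: "in_chart c' f differentiable (at (chart_map c' p))"
  defines "v \<equiv> gradient (g t) c f p" and "v' \<equiv> gradient (g t) c' f p"
  shows "v \<bullet> (g t c p *v v) \<le> v' \<bullet> (g t c' p *v v')"
proof -
  let ?x = "chart_map c p" and ?x' = "chart_map c' p"
  let ?U = "chart_map c ` (chart_dom c \<inter> chart_dom c')"
  define Dm where "Dm = jacobian (transition c c') (at ?x)"
  define n where "n = (\<chi> i. partial i (in_chart c f) ?x)"
  define n' where "n' = (\<chi> i. partial i (in_chart c' f) ?x')"
  have n: "g t c p *v v = n" and n': "g t c' p *v v' = n'"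
    unfolding v_def v'_def n_def n'_def by (rule metric_gradient; fact)+
  have tx: "transition c c' ?x = ?x'" using c p by (simp add: transition_def)
  obtain k' where k': "(in_chart c' f has_derivative k') (at ?x')"
    using diff by (auto simp: differentiable_def)
  have "(transition c c' has_derivative (\<lambda>h. Dm *v h)) (at ?x)"
    unfolding Dm_def using smooth_transition(1)[OF c p] by (simp add: jacobian_works[symmetric] differentiable_def)
  from has_derivative_compose[OF this, of "in_chart c' f" k'] k'
  have comp: "((\<lambda>y. in_chart c' f (transition c c' y)) has_derivative (\<lambda>h. k' (Dm *v h))) (at ?x)"
    by (simp add: tx)
  have "(in_chart c f has_derivative (\<lambda>h. k' (Dm *v h))) (at ?x)"
  proof (rule has_derivative_transform_within_open[OF comp smooth_transition(2)[OF c p]])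
    show "?x \<in> ?U" using p by blast
    show "in_chart c' f (transition c c' y) = in_chart c f y" if "y \<in> ?U" for y
      using that c by (auto simp: in_chart_def transition_def)
  qed
  from linear_partial[OF this] linear_partial[OF k']
  have nn: "n \<bullet> h = n' \<bullet> (Dm *v h)" for h by (simp add: n_def n'_def)
  have q: "w \<bullet> (g t c p *v w) = (Dm *v w) \<bullet> (g t c' p *v (Dm *v w))" for w
    unfolding metric_transform[OF c p t] Dm_def[symmetric]
    by (simp add: matrix_vector_mul_assoc[symmetric] dot_lmul_matrix[symmetric])
      (metis dot_lmul_matrix inner_commute vector_transpose_matrix)
  define y where "y = Dm *v v"
  have s: "y \<bullet> (g t c' p *v v') = v' \<bullet> (g t c' p *v y)"
    by (metis c(2) dot_lmul_matrix inner_commute metric[OF t] p(2) riemannian_metric_def vector_transpose_matrix)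
  have 1: "v \<bullet> (g t c p *v v) = y \<bullet> (g t c' p *v v')"
    using nn[of v] unfolding n n' y_def by (simp add: inner_commute)
  have 2: "v \<bullet> (g t c p *v v) = y \<bullet> (g t c' p *v y)" using q y_def by simp
  have "(y - v') \<bullet> (g t c' p *v (y - v')) \<ge> 0"
    using metric_posdef[OF t c(2) p(2), of "y - v'"] by (cases "y - v' = 0") auto
  then have "0 \<le> y \<bullet> (g t c' p *v y) - y \<bullet> (g t c' p *v v') - v' \<bullet> (g t c' p *v y) + v' \<bullet> (g t c' p *v v')"
    by (simp add: matrix_vector_mult_diff_distrib inner_diff_left inner_diff_right)
  then show ?thesis using 1 2 s by linarith
qed

lemma gradient_norm_agree:
  assumes "c \<in> A" "c' \<in> A" "p \<in> chart_dom c" "p \<in> chart_dom c'" "t \<in> J"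
    and "in_chart c f differentiable (at (chart_map c p))"
    and "in_chart c' f differentiable (at (chart_map c' p))"
  shows "gradient (g t) c f p \<bullet> (g t c p *v gradient (g t) c f p)
       = gradient (g t) c' f p \<bullet> (g t c' p *v gradient (g t) c' f p)"
  using gradient_norm_le[OF assms(1-5,7)] gradient_norm_le[OF assms(2,1,4,3,5,6)] by simp

text \<open>The coefficient g11 in one chart is a combination, with time-independent coefficients,
  of those in the other. The flow equation computes its logarithmic time derivative as -\<epsilon>R
  in either chart, and g11 > 0 can be cancelled.\<close>

lemma curvature_agree:
  assumes c: "c \<in> A" "c' \<in> A" and p: "p \<in> chart_dom c" "p \<in> chart_dom c'" and t: "t \<in> J"
  shows "\<epsilon> * scalar_curvature (g t) c p = \<epsilon> * scalar_curvature (g t) c' p"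
proof -
  define M where "M = jacobian (transition c c') (at (chart_map c p))"
  define q where "q = (\<lambda>s. \<Sum>k\<in>UNIV. \<Sum>l\<in>UNIV. M $ k $ 1 * M $ l $ 1 * g s c' p $ k $ l)"
  have g11: "g s c p $ 1 $ 1 = q s" if "s \<in> J" for s
    unfolding metric_transform[OF c p that] M_def[symmetric] q_def
    by (simp add: matrix_matrix_mult_def transpose_def sum_2 algebra_simps)
  have fl: "((\<lambda>s. g s c p $ i $ j) has_real_derivative
           - \<epsilon> * scalar_curvature (g t) c p * g t c p $ i $ j) (at t within J)"
    if "c \<in> A" "p \<in> chart_dom c" for c i j
    using ricci_flow that t unfolding eps_ricci_flow_def by blast
  have "(q has_real_derivative (\<Sum>k\<in>UNIV. \<Sum>l\<in>UNIV. M $ k $ 1 * M $ l $ 1 *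
      (- \<epsilon> * scalar_curvature (g t) c' p * g t c' p $ k $ l))) (at t within J)"
    unfolding q_def by (intro DERIV_sum DERIV_cmult fl c p)
  also have "(\<Sum>k\<in>UNIV. \<Sum>l\<in>UNIV. M $ k $ 1 * M $ l $ 1 *
      (- \<epsilon> * scalar_curvature (g t) c' p * g t c' p $ k $ l)) = - \<epsilon> * scalar_curvature (g t) c' p * q t"
    by (simp add: q_def sum_2 algebra_simps)
  finally have 2: "(q has_derivative (*) (- \<epsilon> * scalar_curvature (g t) c' p * q t)) (at t within J)"
    by (simp add: has_field_derivative_def)
  have 1: "((\<lambda>s. g s c p $ 1 $ 1) has_derivative (*) (- \<epsilon> * scalar_curvature (g t) c p * q t)) (at t within J)"
    using fl[OF c(1) p(1), of 1 1] g11[OF t] by (simp add: has_field_derivative_def)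
  note e = frechet_derivative_within_eq[OF accessible_time_interval t]
  have "(*) (- \<epsilon> * scalar_curvature (g t) c p * q t) = (*) (- \<epsilon> * scalar_curvature (g t) c' p * q t)"
    using e[OF 1] e[OF 2] frechet_derivative_within_cong[of J "\<lambda>s. g s c p $ 1 $ 1" q, OF g11 t] by simp
  from fun_cong[OF this, of 1]
  have "\<epsilon> * scalar_curvature (g t) c p * q t = \<epsilon> * scalar_curvature (g t) c' p * q t" by simp
  moreover have "q t > 0"
    using metric_posdef[OF t c(1) p(1), of "axis 1 1"] g11[OF t]
    by (simp add: inner_vec_def sum_2 matrix_vector_mult_def axis_eq_0_iff)
  ultimately show ?thesis by simp
qed

definition smooth_fn :: "(real \<Rightarrow> 'a \<Rightarrow> real) \<Rightarrow> bool" where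
  "smooth_fn F \<longleftrightarrow> (\<forall>c\<in>A. smooth_on (J \<times> V c) (coord F c))"

lemma smooth_fn_family: "smooth_family A \<kappa> F \<longleftrightarrow> smooth_fn F"
  by (simp add: smooth_fn_def smooth_family_def coord_def)

lemma smooth_fnD: "smooth_fn F \<Longrightarrow> c \<in> A \<Longrightarrow> smooth_on (J \<times> V c) (coord F c)"
  by (simp add: smooth_fn_def)

lemma coord_slice: "in_chart c (F t) y = coord F c (t, y)"
  by (simp add: coord_def)

lemma gradient_norm_coord:
  assumes c: "c \<in> A" and p: "p \<in> chart_dom c" and t: "t \<in> J" and F: "smooth_fn F"
  shows "gradient (g t) c (F t) p \<bullet> (g t c p *v gradient (g t) c (F t) p)
     = metric_flow_chart.gradsq \<kappa> (V c) (G c) (coord F c) (t, chart_map c p)"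
proof -
  interpret C: metric_flow_chart \<kappa> "V c" "G c" \<epsilon> by (rule flow_chart[OF c])
  have x: "chart_map c p \<in> V c" using p by simp
  have "g t c p = G c (t, chart_map c p)" using c p by (simp add: G_def in_chart_def)
  then show ?thesis
    using C.gradient_norm_eq[OF smooth_fnD[OF F c] t x coord_slice]
    by (simp add: gradient_def G_slice C.gradsq_def)
qed

lemma gam_agree:
  assumes c: "c \<in> A" "c' \<in> A" and p: "p \<in> chart_dom c" "p \<in> chart_dom c'" and t: "t \<in> J" and F: "smooth_fn F"
  shows "metric_flow_chart.gradsq \<kappa> (V c) (G c) (coord F c) (t, chart_map c p)
     = metric_flow_chart.gradsq \<kappa> (V c') (G c') (coord F c') (t, chart_map c' p)"
proof -
  have "in_chart c (F t) differentiable at (chart_map c p)" if "c \<in> A" "p \<in> chart_dom c" for c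
    using spatial_derivative[OF smooth_fnD[OF F that(1)] t _ chart_open(2)[OF that(1)] coord_slice, of "chart_map c p"]
      that by (auto simp: differentiable_def)
  then show ?thesis
    using gradient_norm_agree[OF c p t, of "F t"] gradient_norm_coord[OF _ _ t F] c p by simp
qed

lemma time_derivative_coord:
  assumes c: "c \<in> A" and p: "p \<in> chart_dom c" and t: "t \<in> J" and F: "smooth_fn F"
  shows "((\<lambda>s. F s p) has_real_derivative dir_deriv (J \<times> V c) (1, 0) (coord F c) (t, chart_map c p)) (at t within J)"
  using time_derivative[OF smooth_fnD[OF F c] t, of "chart_map c p"] c p by simp

lemma time_derivative_coord_eq:
  assumes c: "c \<in> A" and p: "p \<in> chart_dom c" and t: "t \<in> J" and F: "smooth_fn F"
    and "((\<lambda>s. F s p) has_real_derivative m) (at t within J)"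
  shows "dir_deriv (J \<times> V c) (1, 0) (coord F c) (t, chart_map c p) = m"
  using time_derivative_eq[OF smooth_fnD[OF F c] t, of "chart_map c p" m] c p assms(5) by simp

end

section \<open>The Harnack inequality\<close>

context metric_flow_chart
begin

definition curv :: "real \<times> (real^2) \<Rightarrow> real" where
  "curv = K + K"

text \<open>The factor t makes this and \<open>heat_harnack\<close> vanish initially, so a negative
  barrier can only be met at positive times.\<close>

definition trace_harnack :: "real \<times> (real^2) \<Rightarrow> real" where
  "trace_harnack = fst * (\<lambda>_. \<epsilon>) * (lap (\<lambda>z. ln (2 * K z)) + K + K)"

definition gradient_ratio :: "(real \<times> (real^2) \<Rightarrow> real) \<Rightarrow> real \<times> (real^2) \<Rightarrow> real" where
  "gradient_ratio h = gam h h * (\<lambda>z. inverse ((1 - h * h) z))"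

definition heat_harnack :: "(real \<times> (real^2) \<Rightarrow> real) \<Rightarrow> (real \<times> (real^2) \<Rightarrow> real) \<Rightarrow> real \<times> (real^2) \<Rightarrow> real" where
  "heat_harnack u h = fst * (lap u + \<rho> + \<rho> - gradient_ratio h)"

lemma gradsq_cong: "(\<And>z. z \<in> D \<Longrightarrow> k z = k' z) \<Longrightarrow> gradsq k = gradsq k'"
  using d1.cong[of k k'] d2.cong[of k k'] by (simp add: gradsq_def gam_def X_def Y_def)

lemma smooth_curv [simp]: "smooth_on D curv"
  by (simp add: curv_def)

lemma X_curv: "X curv z = 2 * X K z" and Y_curv: "Y curv z = 2 * Y K z"
  unfolding curv_def by (simp_all only: X.add Y.add smooth_K plus_fun_apply)

lemma pt_curv: "pt curv z = 2 * pt K z"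
  unfolding curv_def by (simp only: dt.add smooth_K plus_fun_apply)

lemma lap_curv: "lap curv z = 2 * lap K z"
  unfolding curv_def by (simp only: lap_add smooth_K plus_fun_apply)

definition log_heat_pair :: "(real \<times> (real^2) \<Rightarrow> real) \<Rightarrow> (real \<times> (real^2) \<Rightarrow> real) \<Rightarrow> bool" where
  "log_heat_pair u h \<longleftrightarrow> smooth_on D u \<and> smooth_on D h \<and>
     (\<forall>z\<in>D. pt u z = lap u z + gam u u z - u z + 2 * \<rho> z) \<and>
     (\<forall>z\<in>D. pt h z = lap h z + 2 * gam u h z - h z * ln (h z))"

lemma log_heat_pairD:
  assumes "log_heat_pair u h"
  shows "smooth_on D u" and "smooth_on D h"
    and "\<And>z. z \<in> D \<Longrightarrow> pt u z = lap u z + gam u u z - u z + 2 * \<rho> z"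
    and "\<And>z. z \<in> D \<Longrightarrow> pt h z = lap h z + 2 * gam u h z - h z * ln (h z)"
  using assms unfolding log_heat_pair_def by blast+

lemma curv_eq: "t \<in> time_interval \<kappa> \<Longrightarrow> x \<in> V \<Longrightarrow> curv (t, x) = scalar_curv_comp (\<lambda>y. G (t, y)) x"
  by (simp add: scalar_curv_eq curv_def)

end

section \<open>A priori bounds and Harnack estimates for two solutions\<close>

locale heat_pair = surface_flow A \<epsilon> \<kappa> g
  for A :: "'a::{t2_space,second_countable_topology} chart set" and \<epsilon> :: real and \<kappa> :: ereal
    and g :: "real \<Rightarrow> 'a metric_comps" +
  fixes S W :: "real \<Rightarrow> 'a \<Rightarrow> real" and c0 r0 :: real
  assumes c0: "0 < c0" "c0 < 1"
    and r0: "r0 = - (2 * ln c0) / (1 - c0\<^sup>2) - 1" "r0 > 0"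
    and init_curvature: "\<And>c p. c \<in> A \<Longrightarrow> p \<in> chart_dom c \<Longrightarrow> scalar_curvature (g 0) c p \<ge> r0"
    and smooth_S: "smooth_family A \<kappa> S" and smooth_W: "smooth_family A \<kappa> W"
    and pos: "\<And>t p. t \<in> time_interval \<kappa> \<Longrightarrow> 0 < S t p" "\<And>t p. t \<in> time_interval \<kappa> \<Longrightarrow> 0 < W t p"
    and heat_S: "nonlinear_heat_solution A \<epsilon> \<kappa> g S" and heat_W: "nonlinear_heat_solution A \<epsilon> \<kappa> g W"
    and init: "\<And>p. c0 * S 0 p < W 0 p" "\<And>p. W 0 p < S 0 p"
begin

definition "u t p = ln (S t p)"
definition "h t p = W t p / S t p"

abbreviation "curvc c \<equiv> metric_flow_chart.curv \<kappa> (V c) (G c)"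

lemma coord_u: "coord u c = (\<lambda>z. ln (coord S c z))"
  by (auto simp: coord_def in_chart_def u_def)

lemma coord_h: "coord h c = coord W c * (\<lambda>z. inverse (coord S c z))"
  by (auto simp: coord_def in_chart_def h_def divide_inverse)

lemma coord_pos: "z \<in> J \<times> X \<Longrightarrow> coord S c z > 0" "z \<in> J \<times> X \<Longrightarrow> coord W c z > 0"
  using pos by (auto simp: coord_def in_chart_def)

lemma chart_point:
  assumes "c \<in> A" "x \<in> V c"
  obtains p where "p \<in> chart_dom c" "x = chart_map c p"
  using assms by blast

lemma curv_scalar: "c \<in> A \<Longrightarrow> p \<in> chart_dom c \<Longrightarrow> t \<in> J \<Longrightarrow> curvc c (t, chart_map c p) = scalar_curvature (g t) c p"
proof -
  assume c: "c \<in> A" and p: "p \<in> chart_dom c" and t: "t \<in> J"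
  interpret C: metric_flow_chart \<kappa> "V c" "G c" \<epsilon> by (rule flow_chart[OF c])
  show ?thesis using C.curv_eq[OF t, of "chart_map c p"] p by (simp add: scalar_curvature_def G_slice)
qed

lemma heat_coord:
  assumes c: "c \<in> A" and F: "smooth_fn F" and heat: "nonlinear_heat_solution A \<epsilon> \<kappa> g F"
    and z: "t \<in> J" "x \<in> V c"
  shows "dir_deriv (J \<times> V c) (1, 0) (coord F c) (t, x)
    = laplacian (g t) c (F t) (chart_inv c x) - coord F c (t, x) * ln (coord F c (t, x))
      + \<epsilon> * curvc c (t, x) * coord F c (t, x)"
proof -
  obtain p where p: "p \<in> chart_dom c" "x = chart_map c p" using chart_point[OF c z(2)] .
  have "((\<lambda>s. F s p) has_real_derivative laplacian (g t) c (F t) p - F t p * ln (F t p)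
             + \<epsilon> * scalar_curvature (g t) c p * F t p) (at t within J)"
    using heat c z p unfolding nonlinear_heat_solution_def by blast
  from time_derivative_coord_eq[OF c p(1) z(1) F this]
  show ?thesis using c p z curv_scalar[OF c p(1) z(1)] by simp
qed

text \<open>For \<epsilon> > 0 a constant barrier below r0 is used, kept positive so that the
  reaction term has a strict sign. For \<epsilon> = 0 the flow gives no comparison between charts,
  but \<rho> = 0 makes R constant in time within one chart.\<close>

lemma curvature_bound:
  assumes c: "c \<in> A" and p: "p \<in> chart_dom c" and t: "t \<in> J"
  shows "scalar_curvature (g t) c p \<ge> r0"
proof (cases "\<epsilon> = 0")
  case True
  interpret C: metric_flow_chart \<kappa> "V c" "G c" \<epsilon> by (rule flow_chart[OF c])
  let ?x = "chart_map c p"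
  have x: "?x \<in> V c" using p by simp
  have \<rho>: "C.\<rho> = 0" using True C.\<rho>_K by (simp add: fun_eq_iff)
  have "C.pt C.curv = 0" by (simp add: C.curv_def C.T_K \<rho> C.lap_def)
  then have "((\<lambda>s. C.curv (s, ?x)) has_real_derivative 0) (at s within J)" if "s \<in> J" for s
    using time_derivative[OF C.smooth_curv that x] by simp
  moreover have "convex J"
    unfolding time_interval_def
    by (rule is_interval_convex_1[THEN iffD1])
      (auto simp: is_interval_1 intro: le_less_trans[of "ereal _" "ereal _"])
  ultimately obtain k where k: "\<And>s. s \<in> J \<Longrightarrow> C.curv (s, ?x) = k"
    using has_field_derivative_zero_constant[of J "\<lambda>s. C.curv (s, ?x)"] by blast
  then show ?thesis
    using curv_scalar[OF c p t] curv_scalar[OF c p zero_in_J] k[OF t] k[OF zero_in_J] init_curvature[OF c p]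
    by simp
next
  case False
  then have "\<epsilon> > 0" using \<epsilon>_nonneg by simp
  show ?thesis
  proof (rule ccontr)
    assume "\<not> ?thesis"
    then have less: "scalar_curvature (g t) c p < r0" by simp
    \<comment> \<open>Midway between r0 and the larger of 0 and the violating value, hence positive,
      below all initial values and still violated.\<close>
    define r where "r = (max 0 (scalar_curvature (g t) c p) + r0) / 2"
    have r: "0 < r" "r < r0" "scalar_curvature (g t) c p \<le> r" using less r0(2) by (auto simp: r_def)
    obtain c t x where c: "c \<in> A" and t: "t \<in> J" "0 < t" and x: "x \<in> V c" and eq: "curvc c (t, x) = r"
      and ge: "\<And>y. y \<in> V c \<Longrightarrow> curvc c (t, y) \<ge> r"
      and past: "\<And>s. 0 \<le> s \<Longrightarrow> s \<le> t \<Longrightarrow> curvc c (s, x) \<ge> r"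
    proof (rule touching[of curvc "\<lambda>_. r" c t p])
      show "smooth_on (J \<times> V c) (curvc c)" if "c \<in> A" for c
        by (rule metric_flow_chart.smooth_curv[OF flow_chart[OF that]])
      show "curvc c (t, chart_map c p) = curvc c' (t, chart_map c' p)"
        if "c \<in> A" "c' \<in> A" "t \<in> J" "p \<in> chart_dom c" "p \<in> chart_dom c'" for c c' t p
        using curvature_agree[OF that(1,2,4,5,3)] \<open>\<epsilon> > 0\<close> that by (simp add: curv_scalar)
      show "r < curvc c (0, chart_map c p)" if "c \<in> A" "p \<in> chart_dom c" for c p
        using init_curvature[OF that] r that by (simp add: curv_scalar zero_in_J)
      show "curvc c (t, chart_map c p) \<le> r" using r(3) curv_scalar[OF c p t] by simp
    qed (use c p t in auto)
    interpret C: metric_flow_chart \<kappa> "V c" "G c" \<epsilon> by (rule flow_chart[OF c])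
    note tc = C.touch_conditions[OF C.smooth_curv t x eq ge past DERIV_const]
    have "C.pt C.K (t, x) > 0"
    proof (rule C.curvature_lower_barrier[OF _ C.\<rho>_K \<open>\<epsilon> > 0\<close>])
      show "C.K (t, x) > 0" using eq r(1) by (simp add: C.curv_def)
      show "C.X C.K (t, x) = 0" "C.Y C.K (t, x) = 0" using tc(2,3) by (simp_all add: C.X_curv C.Y_curv)
      show "C.lap C.K (t, x) \<ge> 0" using tc(4) by (simp add: C.lap_curv)
    qed (use t x in simp)
    then show False using tc(1) by (simp add: C.pt_curv)
  qed
qed

lemma smooth_fns: "smooth_fn S" "smooth_fn W" "smooth_fn u" "smooth_fn h"
proof -
  show S: "smooth_fn S" and W: "smooth_fn W" using smooth_S smooth_W smooth_fn_family by auto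
  show "smooth_fn u" unfolding smooth_fn_def coord_u
  proof
    fix c assume c: "c \<in> A"
    interpret C: metric_flow_chart \<kappa> "V c" "G c" \<epsilon> by (rule flow_chart[OF c])
    show "smooth_on (J \<times> V c) (\<lambda>z. ln (coord S c z))"
      by (intro C.smooth_ln smooth_fnD[OF S c] coord_pos)
  qed
  show "smooth_fn h" unfolding smooth_fn_def coord_h
  proof
    fix c assume c: "c \<in> A"
    interpret C: metric_flow_chart \<kappa> "V c" "G c" \<epsilon> by (rule flow_chart[OF c])
    have "coord S c z \<noteq> 0" if "z \<in> J \<times> V c" for z using coord_pos(1)[OF that, of c] by simp
    then show "smooth_on (J \<times> V c) (coord W c * (\<lambda>z. inverse (coord S c z)))"
      by (intro C.smooth_mult C.smooth_inverse smooth_fnD[OF S c] smooth_fnD[OF W c])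
  qed
qed

lemma log_heat_pair_coord:
  assumes c: "c \<in> A"
  shows "metric_flow_chart.log_heat_pair \<kappa> (V c) (G c) (coord u c) (coord h c)"
proof -
  interpret C: metric_flow_chart \<kappa> "V c" "G c" \<epsilon> by (rule flow_chart[OF c])
  note sS = smooth_fnD[OF smooth_fns(1) c] and sW = smooth_fnD[OF smooth_fns(2) c]
  have eq: "C.pt (coord F c) z = C.lap (coord F c) z - coord F c z * ln (coord F c z)
      + 2 * C.\<rho> z * coord F c z"
    if F: "smooth_fn F" "nonlinear_heat_solution A \<epsilon> \<kappa> g F" and z: "z \<in> C.D" for F z
  proof -
    obtain t x where tx: "z = (t, x)" "t \<in> J" "x \<in> V c" using z by auto
    have "C.curv z = 2 * C.K z" by (simp add: C.curv_def)
    moreover have "laplacian (g t) c (F t) (chart_inv c x) = C.lap (coord F c) z"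
      using C.laplacian_eq[OF smooth_fnD[OF F(1) c] tx(2,3) coord_slice] c tx
      by (simp add: laplacian_def G_slice)
    ultimately show ?thesis
      using heat_coord[OF c F tx(2,3)] tx by (simp add: C.\<rho>_K)
  qed
  note eqS = eq[OF smooth_fns(1) heat_S] and eqW = eq[OF smooth_fns(2) heat_W]
  note u = C.log_solution[OF sS coord_pos(1) eqS coord_u]
  note h = C.ratio_solution[OF sS coord_pos(1) eqS sW coord_pos(2) eqW coord_u coord_h]
  show ?thesis unfolding C.log_heat_pair_def by (intro conjI ballI u(1,6) h)
qed

lemma h_pos: "t \<in> J \<Longrightarrow> 0 < h t p"
  using pos by (simp add: h_def)

text \<open>The constant c0 is itself a barrier: at a contact the reaction term -c0 ln c0 is
  strictly positive and pushes h up.\<close>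

lemma h_lower:
  assumes t: "t \<in> J"
  shows "h t p > c0"
proof (rule ccontr)
  assume "\<not> ?thesis"
  obtain c where c: "c \<in> A" "p \<in> chart_dom c" using chart_exists by blast
  obtain c t x where c: "c \<in> A" and t: "t \<in> J" "0 < t" and x: "x \<in> V c" and eq: "coord h c (t, x) = c0"
    and ge: "\<And>y. y \<in> V c \<Longrightarrow> coord h c (t, y) \<ge> c0"
    and past: "\<And>s. 0 \<le> s \<Longrightarrow> s \<le> t \<Longrightarrow> coord h c (s, x) \<ge> c0"
  proof (rule touching[of "coord h" "\<lambda>_. c0" c t p])
    show "c0 < coord h c (0, chart_map c p)" if "c \<in> A" "p \<in> chart_dom c" for c p
      using init(1)[of p] pos[OF zero_in_J, of p] that by (simp add: h_def field_simps)
  qed (use c t \<open>\<not> c0 < h t p\<close> smooth_fnD[OF smooth_fns(4)] in auto)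
  interpret C: metric_flow_chart \<kappa> "V c" "G c" \<epsilon> by (rule flow_chart[OF c])
  note P = C.log_heat_pairD[OF log_heat_pair_coord[OF c]]
  note tc = C.touch_conditions[OF P(2) t x eq ge past DERIV_const]
  have "C.pt (coord h c) (t, x) = C.lap (coord h c) (t, x) - c0 * ln c0"
    using P(4)[of "(t, x)"] t x tc(2,3) eq by (simp add: C.gam_def)
  moreover have "c0 * ln c0 < 0" using c0 by (simp add: mult_pos_neg)
  ultimately show False using tc(1,4) by simp
qed

text \<open>At h = 1 the reaction term -h ln h vanishes, so the constant 1 gives no strict sign.
  Compactness provides an initial gap \<delta>, and the gap to 1 is shown to shrink at most
  exponentially.\<close>

lemma h_upper:
  assumes t: "t \<in> J"
  shows "h t p < 1"
proof -
  have "\<exists>\<delta>>0. \<forall>p. h 0 p < 1 - \<delta>"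
  proof -
    have "continuous_on UNIV (h 0)"
      unfolding continuous_on_eq_continuous_within
    proof
      fix p :: 'a
      obtain c where c: "c \<in> A" "p \<in> chart_dom c" using chart_exists by blast
      have "continuous_on (chart_dom c) (\<lambda>p. coord h c (0, chart_map c p))"
        by (rule continuous_on_compose2[OF smooth_on_continuous_on[OF smooth_fnD[OF smooth_fns(4) c(1)]]])
          (use zero_in_J in \<open>auto intro!: continuous_intros chart_continuous c\<close>)
      then have "continuous_on (chart_dom c) (h 0)"
        by (rule continuous_on_eq) (simp add: c)
      then show "continuous (at p) (h 0)"
        using c chart_open(1)[OF c(1)] continuous_on_eq_continuous_at by blast
    qed
    then obtain q where q: "\<And>p. h 0 p \<le> h 0 q"
      using continuous_attains_sup[OF compact_surface] by blast
    have mid: "a < 1 - (1 - b) / 2" if "a \<le> b" "b < 1" for a b :: real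
      using that by (simp add: field_simps)
    have lt: "h 0 q < 1" using init(2)[of q] pos[OF zero_in_J, of q] by (simp add: h_def)
    show ?thesis
    proof (intro exI conjI allI)
      show "(1 - h 0 q) / 2 > 0" using lt by simp
      show "h 0 p < 1 - (1 - h 0 q) / 2" for p by (rule mid[OF q lt])
    qed
  qed
  then obtain \<delta> where \<delta>: "\<delta> > 0" "\<And>p. h 0 p < 1 - \<delta>" by blast
  \<comment> \<open>A barrier for -h. Since -h ln h \<le> 1 - h, the gap can close at rate at most 1
    at a contact; the barrier's gap closes at rate 2, which gives a contradiction.\<close>
  define \<beta> where "\<beta> = (\<lambda>t. \<delta> * exp (- 2 * t) - 1)"
  have d\<beta>: "(\<beta> has_real_derivative - 2 * (\<beta> t + 1)) (at t)" for t
    unfolding \<beta>_def by (auto intro!: derivative_eq_intros)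
  have \<beta>1: "\<beta> t > -1" for t using \<delta>(1) by (simp add: \<beta>_def)
  have "- h t p > \<beta> t"
  proof (rule ccontr)
    assume "\<not> ?thesis"
    obtain c where c: "c \<in> A" "p \<in> chart_dom c" using chart_exists by blast
    obtain c t x where c: "c \<in> A" and t: "t \<in> J" "0 < t" and x: "x \<in> V c" and eq: "(- coord h c) (t, x) = \<beta> t"
      and ge: "\<And>y. y \<in> V c \<Longrightarrow> (- coord h c) (t, y) \<ge> \<beta> t"
      and past: "\<And>s. 0 \<le> s \<Longrightarrow> s \<le> t \<Longrightarrow> (- coord h c) (s, x) \<ge> \<beta> s"
    proof (rule touching[of "\<lambda>c. - coord h c" \<beta> c t p])
      show "\<beta> 0 < (- coord h c) (0, chart_map c p)" if "c \<in> A" "p \<in> chart_dom c" for c p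
        using \<delta>(2)[of p] that by (simp add: \<beta>_def)
      show "continuous_on UNIV \<beta>" unfolding \<beta>_def by (intro continuous_intros)
      show "smooth_on (J \<times> V c) (- coord h c)" if c: "c \<in> A" for c
      proof -
        interpret C: metric_flow_chart \<kappa> "V c" "G c" \<epsilon> by (rule flow_chart[OF c])
        show ?thesis by (intro C.smooth_uminus smooth_fnD[OF smooth_fns(4) c])
      qed
    qed (use c t \<open>\<not> \<beta> t < - h t p\<close> in auto)
    interpret C: metric_flow_chart \<kappa> "V c" "G c" \<epsilon> by (rule flow_chart[OF c])
    note P = C.log_heat_pairD[OF log_heat_pair_coord[OF c]]
    have sm: "smooth_on C.D (- coord h c)" by (intro C.smooth_uminus P(2))
    note tc = C.touch_conditions[OF sm t x eq ge past d\<beta>]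
    have lap: "C.lap (- coord h c) = - C.lap (coord h c)"
      using P(2) by (simp add: C.lap_def algebra_simps)
    have "C.lap (coord h c) (t, x) \<le> 0" using tc(4) unfolding lap by simp
    moreover have "C.pt (coord h c) (t, x) \<ge> 2 * (\<beta> t + 1)"
      using tc(1) unfolding C.dt.uminus[OF P(2)] by simp
    moreover have "C.X (coord h c) (t, x) = 0" "C.Y (coord h c) (t, x) = 0"
      using tc(2,3) unfolding C.X.uminus[OF P(2)] C.Y.uminus[OF P(2)] by simp_all
    then have "C.pt (coord h c) (t, x) = C.lap (coord h c) (t, x) - coord h c (t, x) * ln (coord h c (t, x))"
      using P(4)[of "(t, x)"] t x by (simp add: C.gam_def)
    moreover have "- coord h c (t, x) * ln (coord h c (t, x)) \<le> \<beta> t + 1"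
    proof -
      obtain p where p: "p \<in> chart_dom c" "x = chart_map c p" using chart_point[OF c x] .
      have h0: "coord h c (t, x) > 0" using h_pos[OF t(1)] c p by simp
      then have "ln (1 / coord h c (t, x)) \<le> 1 / coord h c (t, x) - 1" by (intro ln_le_minus_one) simp
      then have "coord h c (t, x) * ln (1 / coord h c (t, x)) \<le> coord h c (t, x) * (1 / coord h c (t, x) - 1)"
        using h0 by (intro mult_left_mono) auto
      moreover have b: "\<beta> t + 1 = 1 - coord h c (t, x)" using eq by simp
      ultimately show ?thesis unfolding b using h0 by (simp add: ln_div algebra_simps)
    qed
    ultimately show False using \<beta>1[of t] by simp
  qed
  then show ?thesis using \<beta>1[of t] by simp
qed

text \<open>Choosing a chart at each point makes ln R a function on the surface, to which gradient
  and time derivative comparisons apply. The choice is immaterial for \<epsilon> > 0.\<close>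

definition "log_curv t p = ln (scalar_curvature (g t) (SOME c. c \<in> A \<and> p \<in> chart_dom c) p)"

lemma log_curv_coord:
  assumes "\<epsilon> > 0" and c: "c \<in> A" and z: "t \<in> J" "x \<in> V c"
  shows "coord log_curv c (t, x) = ln (curvc c (t, x))"
proof -
  obtain p where p: "p \<in> chart_dom c" "x = chart_map c p" using chart_point[OF c z(2)] .
  define d where "d = (SOME c. c \<in> A \<and> p \<in> chart_dom c)"
  have d: "d \<in> A \<and> p \<in> chart_dom d"
    unfolding d_def by (rule someI[of _ c]) (use p c in simp)
  have "scalar_curvature (g t) d p = scalar_curvature (g t) c p"
    using curvature_agree[of d c p t] d c p z \<open>\<epsilon> > 0\<close> by simp
  then show ?thesis using c p z by (simp add: log_curv_def d_def curv_scalar)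
qed

lemma curv_bound:
  assumes c: "c \<in> A"
    and z: "z \<in> J \<times> V c"
  shows "curvc c z \<ge> r0"
proof -
  obtain t p where "z = (t, chart_map c p)" "t \<in> J" "p \<in> chart_dom c" using z by auto
  then show ?thesis using curvature_bound[OF c, of p t] curv_scalar[OF c, of p t] by simp
qed

text \<open>For \<epsilon> > 0 and f = ln R the quantity equals t times the difference of the time
  derivative of f and \<epsilon>|\<nabla>f|^2, by the evolution of f. In this form
  (\<open>formula\<close>) it is visibly the same in all charts.\<close>

lemma curvature_harnack:
  assumes c: "c \<in> A" and z: "t \<in> J" "x \<in> V c"
  shows "metric_flow_chart.trace_harnack \<kappa> (V c) (G c) \<epsilon> (t, x) \<ge> -1"
proof (cases "\<epsilon> = 0")
  case True
  interpret C: metric_flow_chart \<kappa> "V c" "G c" \<epsilon> by (rule flow_chart[OF c])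
  show ?thesis unfolding C.trace_harnack_def using True by simp
next
  case False
  then have \<epsilon>: "\<epsilon> > 0" using \<epsilon>_nonneg by simp
  let ?\<Phi> = "\<lambda>c. metric_flow_chart.trace_harnack \<kappa> (V c) (G c) \<epsilon>"
  have Kpos: "metric_flow_chart.curv \<kappa> (V c) (G c) z > 0" if "c \<in> A" "z \<in> J \<times> V c" for c z
    using curv_bound[OF that] r0(2) by simp
  have smooth_log_curv: "smooth_fn log_curv" unfolding smooth_fn_def
  proof
    fix c assume c: "c \<in> A"
    interpret C: metric_flow_chart \<kappa> "V c" "G c" \<epsilon> by (rule flow_chart[OF c])
    have "smooth_on C.D (\<lambda>z. ln (C.curv z))" by (intro C.smooth_ln C.smooth_curv Kpos[OF c])
    moreover have "smooth_on C.D (coord log_curv c) \<longleftrightarrow> smooth_on C.D (\<lambda>z. ln (C.curv z))"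
      by (rule smooth_on_cong) (use log_curv_coord[OF \<epsilon> c] in auto)
    ultimately show "smooth_on C.D (coord log_curv c)" by simp
  qed
  have sm: "smooth_on (J \<times> V c) (?\<Phi> c)"
    and formula: "\<And>t p. t \<in> J \<Longrightarrow> p \<in> chart_dom c \<Longrightarrow> ?\<Phi> c (t, chart_map c p) =
      t * (dir_deriv (J \<times> V c) (1, 0) (coord log_curv c) (t, chart_map c p)
       - \<epsilon> * metric_flow_chart.gradsq \<kappa> (V c) (G c) (coord log_curv c) (t, chart_map c p))"
    if c: "c \<in> A" for c
  proof -
    interpret C: metric_flow_chart \<kappa> "V c" "G c" \<epsilon> by (rule flow_chart[OF c])
    let ?f = "\<lambda>z. ln (2 * C.K z)"
    have K: "C.curv z = 2 * C.K z" for z by (simp add: C.curv_def)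
    have pos: "C.K z > 0" if "z \<in> C.D" for z using Kpos[OF c that] by (simp add: K)
    have f: "coord log_curv c z = ?f z" if "z \<in> C.D" for z
      using log_curv_coord[OF \<epsilon> c] that by (auto simp: K)
    have "smooth_on C.D ?f"
      using smooth_fnD[OF smooth_log_curv c] smooth_on_cong[of C.D "coord log_curv c" ?f, OF f] by simp
    then show "smooth_on C.D C.trace_harnack"
      unfolding C.trace_harnack_def by (intro C.smooth_mult C.smooth_add C.smooth_const C.smooth_lap C.smooth_K C.sm_\<tau>)
    fix t p assume t: "t \<in> J" and p: "p \<in> chart_dom c"
    let ?z = "(t, chart_map c p)"
    have z: "?z \<in> C.D" using t p by simp
    have "C.pt ?f ?z = \<epsilon> * ((C.lap ?f + C.K + C.K) ?z + C.gradsq ?f ?z)"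
      unfolding C.gradsq_def
      by (rule C.log_curvature_evolution(1)[OF z C.\<rho>_K \<epsilon>_nonneg pos refl refl])
    moreover have "C.pt ?f = C.pt (coord log_curv c)" by (rule C.dt.cong) (simp add: f)
    moreover have "C.gradsq ?f = C.gradsq (coord log_curv c)" by (rule C.gradsq_cong) (simp add: f)
    ultimately show "C.trace_harnack ?z = t * (C.pt (coord log_curv c) ?z - \<epsilon> * C.gradsq (coord log_curv c) ?z)"
      by (simp add: C.trace_harnack_def algebra_simps)
  qed
  show ?thesis
  proof (rule ccontr)
    assume viol: "\<not> ?thesis"
    obtain p where p: "p \<in> chart_dom c" "x = chart_map c p" using chart_point[OF c z(2)] .
    \<comment> \<open>The violating value is the barrier: it lies strictly below -1, as
      \<open>curvature_harnack_barrier\<close> requires.\<close>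
    define \<eta> where "\<eta> = ?\<Phi> c (t, x)"
    have \<eta>: "\<eta> < -1" using viol by (simp add: \<eta>_def)
    obtain c t x where c: "c \<in> A" and t: "t \<in> J" "0 < t" and x: "x \<in> V c" and eq: "?\<Phi> c (t, x) = \<eta>"
      and ge: "\<And>y. y \<in> V c \<Longrightarrow> ?\<Phi> c (t, y) \<ge> \<eta>"
      and past: "\<And>s. 0 \<le> s \<Longrightarrow> s \<le> t \<Longrightarrow> ?\<Phi> c (s, x) \<ge> \<eta>"
    proof (rule touching[of ?\<Phi> "\<lambda>_. \<eta>" c t p])
      show "smooth_on (J \<times> V c) (?\<Phi> c)" if "c \<in> A" for c by (rule sm[OF that])
      show "?\<Phi> c (t, chart_map c p) = ?\<Phi> c' (t, chart_map c' p)"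
        if cp: "c \<in> A" "c' \<in> A" and t: "t \<in> J" and p: "p \<in> chart_dom c" "p \<in> chart_dom c'" for c c' t p
        unfolding formula[OF cp(1) t p(1)] formula[OF cp(2) t p(2)] gam_agree[OF cp p t smooth_log_curv]
          time_derivative_coord_eq[OF cp(1) p(1) t smooth_log_curv time_derivative_coord[OF cp(2) p(2) t smooth_log_curv]] ..
      show "\<eta> < ?\<Phi> c (0, chart_map c p)" if "c \<in> A" "p \<in> chart_dom c" for c p
        using formula[OF that(1) zero_in_J that(2)] \<eta> by simp
      show "?\<Phi> c (t, chart_map c p) \<le> \<eta>" by (simp add: \<eta>_def p)
    qed (use c z p in auto)
    interpret C: metric_flow_chart \<kappa> "V c" "G c" \<epsilon> by (rule flow_chart[OF c])
    note tc = C.touch_conditions[OF sm[OF c] t x eq ge past DERIV_const]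
    have pos: "C.K z > 0" if "z \<in> C.D" for z using Kpos[OF c that] by (simp add: C.curv_def)
    have "C.pt C.trace_harnack (t, x) > 0"
      by (rule C.curvature_harnack_barrier[OF _ C.\<rho>_K \<epsilon> pos refl C.trace_harnack_def])
        (use t x eq \<eta> tc in auto)
    then show False using tc(1) by simp
  qed
qed

text \<open>Here -1 itself is the barrier, since \<open>main_barrier\<close> gives a strict sign at
  F = -1; this also yields the strict conclusion.\<close>

lemma heat_harnack:
  assumes c: "c \<in> A" and z: "t \<in> J" "x \<in> V c"
  shows "metric_flow_chart.heat_harnack \<kappa> (V c) (G c) (coord u c) (coord h c) (t, x) > -1"
proof -
  let ?\<Phi> = "\<lambda>c. metric_flow_chart.heat_harnack \<kappa> (V c) (G c) (coord u c) (coord h c)"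
  have bounds: "c0 < coord h c z" "coord h c z < 1" "0 < coord h c z"
    if "c \<in> A" "z \<in> J \<times> V c" for c z
    using that h_lower h_upper h_pos by auto
  have Kpos: "metric_flow_chart.curv \<kappa> (V c) (G c) z > 0" if "c \<in> A" "z \<in> J \<times> V c" for c z
    using curv_bound[OF that] r0(2) by simp
  have sm: "smooth_on (J \<times> V c) (?\<Phi> c)"
    and formula: "\<And>t p. t \<in> J \<Longrightarrow> p \<in> chart_dom c \<Longrightarrow> ?\<Phi> c (t, chart_map c p) =
      t * (dir_deriv (J \<times> V c) (1, 0) (coord u c) (t, chart_map c p)
       - metric_flow_chart.gradsq \<kappa> (V c) (G c) (coord u c) (t, chart_map c p) + u t p
       - metric_flow_chart.gradsq \<kappa> (V c) (G c) (coord h c) (t, chart_map c p) / (1 - h t p * h t p))"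
    if c: "c \<in> A" for c
  proof -
    interpret C: metric_flow_chart \<kappa> "V c" "G c" \<epsilon> by (rule flow_chart[OF c])
    note P = C.log_heat_pairD[OF log_heat_pair_coord[OF c]]
    note R = C.ratio_gradient_evolution[OF _ P(1,2) bounds(3,2)[OF c] P(4) C.\<rho>_K C.gradient_ratio_def]
    have "smooth_on C.D (C.gradient_ratio (coord h c))"
    \<comment> \<open>The smoothness statement in \<open>ratio_gradient_evolution\<close> is
      obtained from a point of the domain, so a chart with empty domain is treated apart.\<close>
    proof (cases "C.D = {}")
      case True
      then have "smooth_on C.D (C.gradient_ratio (coord h c)) \<longleftrightarrow> smooth_on C.D (0 :: real \<times> (real^2) \<Rightarrow> real)"
        by (intro smooth_on_cong) blast
      then show ?thesis using C.smooth_zero by blast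
    next
      case False
      then obtain z where "z \<in> C.D" by blast
      then show ?thesis by (rule R(1))
    qed
    then show "smooth_on C.D (C.heat_harnack (coord u c) (coord h c))"
      unfolding C.heat_harnack_def
      by (intro C.smooth_mult C.smooth_add C.smooth_diff C.smooth_lap C.smooth_\<rho> C.sm_\<tau> P(1))
    fix t p assume t: "t \<in> J" and p: "p \<in> chart_dom c"
    let ?z = "(t, chart_map c p)"
    have z: "?z \<in> C.D" using t p by simp
    show "C.heat_harnack (coord u c) (coord h c) ?z =
      t * (C.pt (coord u c) ?z - C.gradsq (coord u c) ?z + u t p
       - C.gradsq (coord h c) ?z / (1 - h t p * h t p))"
      unfolding P(3)[OF z] using c p
      by (simp add: C.heat_harnack_def C.gradient_ratio_def C.gradsq_def divide_inverse)
  qed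
  show ?thesis
  proof (rule ccontr)
    assume viol: "\<not> ?thesis"
    obtain p where p: "p \<in> chart_dom c" "x = chart_map c p" using chart_point[OF c z(2)] .
    obtain c t x where c: "c \<in> A" and t: "t \<in> J" "0 < t" and x: "x \<in> V c" and eq: "?\<Phi> c (t, x) = -1"
      and ge: "\<And>y. y \<in> V c \<Longrightarrow> ?\<Phi> c (t, y) \<ge> -1"
      and past: "\<And>s. 0 \<le> s \<Longrightarrow> s \<le> t \<Longrightarrow> ?\<Phi> c (s, x) \<ge> -1"
    proof (rule touching[of ?\<Phi> "\<lambda>_. -1" c t p])
      show "smooth_on (J \<times> V c) (?\<Phi> c)" if "c \<in> A" for c by (rule sm[OF that])
      show "?\<Phi> c (t, chart_map c p) = ?\<Phi> c' (t, chart_map c' p)"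
        if cp: "c \<in> A" "c' \<in> A" and t: "t \<in> J" and p: "p \<in> chart_dom c" "p \<in> chart_dom c'" for c c' t p
        unfolding formula[OF cp(1) t p(1)] formula[OF cp(2) t p(2)]
          gam_agree[OF cp p t smooth_fns(3)] gam_agree[OF cp p t smooth_fns(4)]
          time_derivative_coord_eq[OF cp(1) p(1) t smooth_fns(3) time_derivative_coord[OF cp(2) p(2) t smooth_fns(3)]] ..
      show "-1 < ?\<Phi> c (0, chart_map c p)" if "c \<in> A" "p \<in> chart_dom c" for c p
        using formula[OF that(1) zero_in_J that(2)] by simp
      show "?\<Phi> c (t, chart_map c p) \<le> -1" using viol p by simp
    qed (use c z p in auto)
    interpret C: metric_flow_chart \<kappa> "V c" "G c" \<epsilon> by (rule flow_chart[OF c])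
    note tc = C.touch_conditions[OF sm[OF c] t x eq ge past DERIV_const]
    note P = C.log_heat_pairD[OF log_heat_pair_coord[OF c]]
    have K: "C.curv z = 2 * C.K z" for z by (simp add: C.curv_def)
    have pos: "C.K z > 0" if "z \<in> C.D" for z using Kpos[OF c that] by (simp add: K)
    have zD: "(t, x) \<in> C.D" using t x by simp
    have "C.pt (C.heat_harnack (coord u c) (coord h c)) (t, x) > 0"
    proof (rule C.main_barrier[OF zD P(1,2,3,4) c0 bounds(1,2)[OF c] C.\<rho>_K \<epsilon>_nonneg pos _ refl _
          C.gradient_ratio_def C.heat_harnack_def])
      show "- (2 * ln c0) / (1 - c0\<^sup>2) - 1 \<le> 2 * C.K (t, x)"
        using curv_bound[OF c zD] r0(1) by (simp add: K)
      show "-1 \<le> fst (t, x) * (\<epsilon> * (C.lap (\<lambda>z. ln (2 * C.K z)) + C.K + C.K) (t, x))"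
        using curvature_harnack[OF c t(1) x] by (simp add: C.trace_harnack_def mult.assoc)
    qed (use t x eq tc in auto)
    then show False using tc(1) by simp
  qed
qed

lemma differential_harnack:
  assumes c: "c \<in> A" and t: "t \<in> J" "0 < t" and p: "p \<in> chart_dom c"
  shows "deriv (\<lambda>s. ln (S s p)) t - (metric_norm (g t) c p (gradient (g t) c (\<lambda>q. ln (S t q)) p))\<^sup>2
           + ln (S t p) + 1 / t
         = laplacian (g t) c (\<lambda>q. ln (S t q)) p + \<epsilon> * scalar_curvature (g t) c p + 1 / t"
    and "laplacian (g t) c (\<lambda>q. ln (S t q)) p + \<epsilon> * scalar_curvature (g t) c p + 1 / t
         > (metric_norm (g t) c p (gradient (g t) c (h t) p))\<^sup>2 / (1 - (h t p)\<^sup>2)"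
proof -
  interpret C: metric_flow_chart \<kappa> "V c" "G c" \<epsilon> by (rule flow_chart[OF c])
  note P = C.log_heat_pairD[OF log_heat_pair_coord[OF c]]
  let ?x = "chart_map c p" and ?z = "(t, chart_map c p)"
  have x: "?x \<in> V c" and z: "?z \<in> C.D" using t p by simp_all
  have u: "(\<lambda>q. ln (S t q)) = u t" for t by (simp add: u_def fun_eq_iff)
  have norm: "(metric_norm (g t) c p (gradient (g t) c (F t) p))\<^sup>2 = C.gam (coord F c) (coord F c) ?z"
    if F: "smooth_fn F" for F
  proof -
    have "C.gam (coord F c) (coord F c) ?z \<ge> 0" by (simp add: C.gam_def)
    then show ?thesis
      using gradient_norm_coord[OF c p t(1) F] by (simp add: metric_norm_def C.gradsq_def)
  qed
  have lap: "laplacian (g t) c (u t) p = C.lap (coord u c) ?z"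
    using C.laplacian_eq[OF P(1) t(1) x coord_slice] by (simp add: laplacian_def G_slice)
  have R: "\<epsilon> * scalar_curvature (g t) c p = 2 * C.\<rho> ?z"
    using curv_scalar[OF c p t(1)] by (simp add: C.\<rho>_K C.curv_def)
  have "((\<lambda>s. u s p) has_real_derivative C.pt (coord u c) ?z) (at t within J)"
    by (rule time_derivative_coord[OF c p t(1) smooth_fns(3)])
  \<comment> \<open>A positive time is interior to the interval, so the derivative within it is the
    ordinary one taken by \<open>deriv\<close>.\<close>
  then have "((\<lambda>s. u s p) has_real_derivative C.pt (coord u c) ?z) (at t)"
    using at_within_interior[OF time_interval_interior[OF t]] by simp
  then have "deriv (\<lambda>s. ln (S s p)) t = C.pt (coord u c) ?z"
    by (intro DERIV_imp_deriv) (simp add: u_def)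
  then show "deriv (\<lambda>s. ln (S s p)) t - (metric_norm (g t) c p (gradient (g t) c (\<lambda>q. ln (S t q)) p))\<^sup>2
           + ln (S t p) + 1 / t
         = laplacian (g t) c (\<lambda>q. ln (S t q)) p + \<epsilon> * scalar_curvature (g t) c p + 1 / t"
    unfolding u norm[OF smooth_fns(3)] lap R using P(3)[OF z] c p by (simp add: u_def)
  have "t * (C.lap (coord u c) ?z + 2 * C.\<rho> ?z - C.gam (coord h c) (coord h c) ?z / (1 - (h t p)\<^sup>2)) > -1"
    using heat_harnack[OF c t(1) x] c p
    by (simp add: C.heat_harnack_def C.gradient_ratio_def divide_inverse power2_eq_square algebra_simps)
  then show "laplacian (g t) c (\<lambda>q. ln (S t q)) p + \<epsilon> * scalar_curvature (g t) c p + 1 / t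
         > (metric_norm (g t) c p (gradient (g t) c (h t) p))\<^sup>2 / (1 - (h t p)\<^sup>2)"
    unfolding u norm[OF smooth_fns(4)] lap R using t(2) by (simp add: field_simps)
qed

end

theorem theorem1p1:
  fixes A :: "'a::{t2_space,second_countable_topology} chart set"
    and g :: "real \<Rightarrow> 'a metric_comps"
    and S T h :: "real \<Rightarrow> 'a \<Rightarrow> real"
    and \<epsilon> c\<^sub>0 :: real and \<kappa> :: ereal
  assumes "closed_surface A"
    and "0 \<le> \<epsilon>" and "0 < \<kappa>"
    and "eps_ricci_flow A \<epsilon> \<kappa> g"
    and "0 < c\<^sub>0" and "c\<^sub>0 < 1"
    and "\<forall>c\<in>A. \<forall>p\<in>chart_dom c.
           scalar_curvature (g 0) c p \<ge> - (2 * ln c\<^sub>0) / (1 - c\<^sub>0\<^sup>2) - 1"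
    and "- (2 * ln c\<^sub>0) / (1 - c\<^sub>0\<^sup>2) - 1 > 0"
    and "smooth_family A \<kappa> S" and "smooth_family A \<kappa> T"
    and "\<forall>t\<in>time_interval \<kappa>. \<forall>p. 0 < S t p \<and> 0 < T t p"
    and "nonlinear_heat_solution A \<epsilon> \<kappa> g S"
    and "nonlinear_heat_solution A \<epsilon> \<kappa> g T"
    and "\<forall>p. 0 < c\<^sub>0 * S 0 p \<and> c\<^sub>0 * S 0 p < T 0 p \<and> T 0 p < S 0 p"
    and h_def: "\<forall>t p. h t p = T t p / S t p"
  shows "(\<forall>t\<in>time_interval \<kappa>. \<forall>p. 0 < c\<^sub>0 * S t p \<and> c\<^sub>0 * S t p < T t p \<and> T t p < S t p) \<and>
    (\<forall>t\<in>time_interval \<kappa>. 0 < t \<longrightarrow> (\<forall>c\<in>A. \<forall>p\<in>chart_dom c.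
       deriv (\<lambda>s. ln (S s p)) t - (metric_norm (g t) c p (gradient (g t) c (\<lambda>q. ln (S t q)) p))\<^sup>2
           + ln (S t p) + 1 / t
         = laplacian (g t) c (\<lambda>q. ln (S t q)) p + \<epsilon> * scalar_curvature (g t) c p + 1 / t \<and>
       laplacian (g t) c (\<lambda>q. ln (S t q)) p + \<epsilon> * scalar_curvature (g t) c p + 1 / t
         > (metric_norm (g t) c p (gradient (g t) c (h t) p))\<^sup>2 / (1 - (h t p)\<^sup>2)))"
proof -
  interpret H: heat_pair A \<epsilon> \<kappa> g S T "c\<^sub>0" "- (2 * ln c\<^sub>0) / (1 - c\<^sub>0\<^sup>2) - 1"
    by unfold_locales (use assms in auto)
  have h: "h = H.h" using h_def by (simp add: fun_eq_iff H.h_def)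
  have "0 < c\<^sub>0 * S t p \<and> c\<^sub>0 * S t p < T t p \<and> T t p < S t p" if t: "t \<in> time_interval \<kappa>" for t p
    using H.h_lower[OF t, of p] H.h_upper[OF t, of p] H.pos(1)[OF t, of p] H.c0(1)
    by (simp add: H.h_def field_simps)
  then show ?thesis unfolding h using H.differential_harnack by blast
qed

end
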